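(* Let $Z=\mathrm{Spec}(\mathbb{C}[h])$ and let $q:V\to Z$ be a generalized Danielewski surface such that $q^{-1}(z)$ is integral for every closed point $z\neq z_0=(h)$ of $Z$. Then there exists a fine-labelled rooted tree $\mathfrak{g}$ such that $q:V\to Z$ is $Z$-isomorphic to $q_{\mathfrak{g}}:V_{\mathfrak{g}}\to Z$.
   Context: GDS. A generalized Danielewski surface (GDS) over $Z\simeq\mathbb{A}^1_{\mathbb{C}}$ is a normal affine complex surface $V$ together with a faithfully flat morphism $q:V\to Z$ with reduced fibers and generic fiber isomorphic to $\mathbb{A}^1_{K(Z)}$ ($K(Z)$ the function field of $Z$), such that all but possibly one closed fiber are integral. Trees. A rooted tree $\Gamma$ is a nonempty finite poset $(N(\Gamma),\le)$ with a unique minimal element $e_0$ (the root) such that $(\downarrow e)=\{e'\le e\}$ is a chain for every node $e$. Maximal elements are the leaves, $\mathrm{Leaves}(\Gamma)$; $\mathbf{P}(\Gamma)=N(\Gamma)\setminus\mathrm{Leaves}(\Gamma)$. $\mathrm{Anc}(e)=(\downarrow e)\setminus\{e\}$; for $e\ne e_0$, $\mathrm{Par}(e)$ is the maximal element of $\mathrm{Anc}(e)$. $\mathrm{Child}(e)$ is the set of minimal elements of $\{e'>e\}$. A fine-labelled rooted tree $\mathfrak{g}=(\Gamma,lb)$ is a rooted tree with a function $lb:N(\Gamma)\setminus\{e_0\}\to\mathbb{C}$ such that $lb(f)\ne lb(f')$ for distinct nodes $f,f'$ with the same parent. The scheme $V_{\mathfrak{g}}$. Let $A=\mathbb{C}[h]$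 (polynomial ring in one variable), $Z=\mathrm{Spec}(A)$. $A[\Gamma]$ is the polynomial ring over $A$ in the variables $X_0$ and $X_e$, $e\in\mathbf{P}(\Gamma)$. Convention: $X_{\mathrm{Par}(e_0)}:=X_0$. For $e\in\mathbf{P}(\Gamma)$ and $J\subset\mathrm{Child}(e)$ put $S_e^J=\prod_{g\in\mathrm{Child}(e)\setminus J}(X_{\mathrm{Par}(e)}-lb(g))$ and $S_e=S_e^{\emptyset}$. Put $R_{e_0}=1$, and recursively $R_e=S_{\mathrm{Par}(e)}^{\{e\}}R_{\mathrm{Par}(e)}$ for $e\ne e_0$; for $e\in\mathbf{P}(\Gamma)$ put $Q_e=S_eR_e$. $I_{\mathfrak{g}}\subset A[\Gamma]$ is the ideal generated by $\Delta_{0,e}=hX_e-Q_e$ ($e\in\mathbf{P}(\Gamma)$) and $\Delta_{e',e}=R_{e''}^{-1}(Q_{e'}X_e-Q_eX_{e'})=(X_{\mathrm{Par}(e')}-lb(e''))X_e-X_{e'}\,(Q_e/R_{e''})$ for $e\in\mathbf{P}(\Gamma)$, $e'\in\mathrm{Anc}(e)$, where $e''$ is the unique element of $\mathrm{Child}(e')\cap(\downarrow e)$. Put $B_{\mathfrak{g}}=A[\Gamma]/I_{\mathfrak{g}}$, $V_{\mathfrak{g}}=\mathrm{Spec}(B_{\mathfrak{g}})$, and $q_{\mathfrak{g}}:V_{\mathfrak{g}}\to Z$ the morphism induced by $A\to B_{\mathfrak{g}}$. *)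

theory Defs
  imports
    "HOL-Algebra.Algebra"
    "HOL-Algebra.Algebraic_Closure_Type"
    "HOL-Computational_Algebra.Fraction_Field"
    "HOL-Library.Poly_Mapping"
begin

text \<open>
  All schemes involved are affine, so they are represented by their coordinate rings:
  \<open>Spec B \<rightarrow> Spec A\<close> is a ring homomorphism \<open>\<phi> : A \<rightarrow> B\<close>, and a
  \<open>Spec A\<close>-isomorphism is an isomorphism of rings commuting with the structure maps.
\<close>


section \<open>Rings of fractions\<close>

text \<open>No cancellation is assumed, so \<open>a/s = b/t\<close> means \<open>u (t a - s b) = 0\<close> for some \<open>u \<in> S\<close>.\<close>

definition fraction_rel ::
  "('a, 'm) ring_scheme \<Rightarrow> 'a set \<Rightarrow> (('a \<times> 'a) \<times> ('a \<times> 'a)) set" where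
  "fraction_rel R S =
     {((a, s), (b, t)). a \<in> carrier R \<and> s \<in> S \<and> b \<in> carrier R \<and> t \<in> S \<and>
        (\<exists>u\<in>S. u \<otimes>\<^bsub>R\<^esub> (t \<otimes>\<^bsub>R\<^esub> a) = u \<otimes>\<^bsub>R\<^esub> (s \<otimes>\<^bsub>R\<^esub> b))}"

definition fraction :: "('a, 'm) ring_scheme \<Rightarrow> 'a set \<Rightarrow> 'a \<Rightarrow> 'a \<Rightarrow> ('a \<times> 'a) set" where
  "fraction R S a s = fraction_rel R S `` {(a, s)}"

definition ring_of_fractions :: "('a, 'm) ring_scheme \<Rightarrow> 'a set \<Rightarrow> (('a \<times> 'a) set) ring" where
  "ring_of_fractions R S =
     \<lparr> carrier = (carrier R \<times> S) // fraction_rel R S,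
       monoid.mult = (\<lambda>x y. \<Union>(a, s)\<in>x. \<Union>(b, t)\<in>y. fraction R S (a \<otimes>\<^bsub>R\<^esub> b) (s \<otimes>\<^bsub>R\<^esub> t)),
       one = fraction R S \<one>\<^bsub>R\<^esub> \<one>\<^bsub>R\<^esub>,
       ring.zero = fraction R S \<zero>\<^bsub>R\<^esub> \<one>\<^bsub>R\<^esub>,
       add = (\<lambda>x y. \<Union>(a, s)\<in>x. \<Union>(b, t)\<in>y.
                fraction R S (t \<otimes>\<^bsub>R\<^esub> a \<oplus>\<^bsub>R\<^esub> s \<otimes>\<^bsub>R\<^esub> b) (s \<otimes>\<^bsub>R\<^esub> t)) \<rparr>"

definition fraction_field :: "('a, 'm) ring_scheme \<Rightarrow> (('a \<times> 'a) set) ring" where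
  "fraction_field R = ring_of_fractions R (carrier R - {\<zero>\<^bsub>R\<^esub>})"

lemma (in cring) equiv_fraction_rel:
  assumes "submonoid S R"
  shows "equiv (carrier R \<times> S) (fraction_rel R S)"
proof -
  interpret S: submonoid S R by fact
  have sub: "s \<in> carrier R" if "s \<in> S" for s using that S.subset by blast
  show ?thesis
  proof (rule equivI)
    show "fraction_rel R S \<subseteq> (carrier R \<times> S) \<times> (carrier R \<times> S)"
      by (auto simp: fraction_rel_def)
    show "refl_on (carrier R \<times> S) (fraction_rel R S)"
      using S.one_closed by (auto simp: refl_on_def fraction_rel_def)
    show "sym (fraction_rel R S)"
      by (rule symI) (auto simp: fraction_rel_def intro!: bexI elim: sym)
    show "trans (fraction_rel R S)"
    proof (rule transI, clarify)
      fix a s b t c r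
      assume 1: "((a, s), (b, t)) \<in> fraction_rel R S" and 2: "((b, t), (c, r)) \<in> fraction_rel R S"
      from 1 obtain u where u: "u \<in> S" "u \<otimes> (t \<otimes> a) = u \<otimes> (s \<otimes> b)"
        by (auto simp: fraction_rel_def)
      from 2 obtain v where v: "v \<in> S" "v \<otimes> (r \<otimes> b) = v \<otimes> (t \<otimes> c)"
        by (auto simp: fraction_rel_def)
      have mem: "a \<in> carrier R" "b \<in> carrier R" "c \<in> carrier R" "s \<in> S" "t \<in> S" "r \<in> S"
        using 1 2 by (auto simp: fraction_rel_def)
      note cl = mem(1-3) mem(4-6)[THEN sub] u(1)[THEN sub] v(1)[THEN sub]
      have "(u \<otimes> v \<otimes> t) \<otimes> (r \<otimes> a) = (v \<otimes> r) \<otimes> (u \<otimes> (t \<otimes> a))"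
        using cl by (simp add: m_ac)
      also have "\<dots> = (u \<otimes> s) \<otimes> (v \<otimes> (r \<otimes> b))"
        unfolding u(2) using cl by (simp add: m_ac)
      also have "\<dots> = (u \<otimes> v \<otimes> t) \<otimes> (s \<otimes> c)"
        unfolding v(2) using cl by (simp add: m_ac)
      finally show "((a, s), (c, r)) \<in> fraction_rel R S"
        using mem u(1) v(1) S.m_closed by (auto simp: fraction_rel_def)
    qed
  qed
qed

lemma (in cring) fraction_mult:
  assumes "submonoid S R" "a \<in> carrier R" "b \<in> carrier R" "s \<in> S" "t \<in> S"
  shows "fraction R S a s \<otimes>\<^bsub>ring_of_fractions R S\<^esub> fraction R S b t = fraction R S (a \<otimes> b) (s \<otimes> t)"
proof -
  interpret S: submonoid S R by fact
  have sub: "s \<in> carrier R" if "s \<in> S" for s using that S.subset by blast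
  have *: "fraction R S (a' \<otimes> b') (s' \<otimes> t') = fraction R S (a \<otimes> b) (s \<otimes> t)"
    if A: "(a', s') \<in> fraction R S a s" "(b', t') \<in> fraction R S b t" for a' s' b' t'
  proof -
    from A(1) obtain u where u: "u \<in> S" "u \<otimes> (s' \<otimes> a) = u \<otimes> (s \<otimes> a')"
      by (auto simp: fraction_rel_def fraction_def)
    from A(2) obtain v where v: "v \<in> S" "v \<otimes> (t' \<otimes> b) = v \<otimes> (t \<otimes> b')"
      by (auto simp: fraction_rel_def fraction_def)
    have mem: "a' \<in> carrier R" "b' \<in> carrier R" "s' \<in> S" "t' \<in> S"
      using A by (auto simp: fraction_rel_def fraction_def)
    note cl = mem(1,2) mem(3,4)[THEN sub] assms(2,3) assms(4,5)[THEN sub] u(1)[THEN sub] v(1)[THEN sub]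
    have "(u \<otimes> v) \<otimes> ((s' \<otimes> t') \<otimes> (a \<otimes> b)) = (u \<otimes> (s' \<otimes> a)) \<otimes> (v \<otimes> (t' \<otimes> b))"
      using cl by (simp add: m_ac)
    also have "\<dots> = (u \<otimes> v) \<otimes> ((s \<otimes> t) \<otimes> (a' \<otimes> b'))"
      unfolding u(2) v(2) using cl by (simp add: m_ac)
    finally have "((a \<otimes> b, s \<otimes> t), (a' \<otimes> b', s' \<otimes> t')) \<in> fraction_rel R S"
      unfolding fraction_rel_def using cl mem assms u(1) v(1)
      by (auto intro!: bexI[of _ "u \<otimes> v"])
    thus ?thesis
      unfolding fraction_def using equiv_class_eq[OF equiv_fraction_rel[OF assms(1)]] by metis
  qed
  have self: "(a, s) \<in> fraction R S a s" "(b, t) \<in> fraction R S b t"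
    using equiv_class_self[OF equiv_fraction_rel[OF assms(1)]] assms by (auto simp: fraction_def)
  have "(\<Union>(a', s')\<in>fraction R S a s. \<Union>(b', t')\<in>fraction R S b t.
           fraction R S (a' \<otimes> b') (s' \<otimes> t')) = fraction R S (a \<otimes> b) (s \<otimes> t)" (is "?L = ?R")
  proof (intro equalityI subsetI)
    show "z \<in> ?R" if "z \<in> ?L" for z using that * by auto
    show "z \<in> ?L" if "z \<in> ?R" for z
      apply (rule UN_I[OF self(1)])
      apply (simp only: prod.case)
      apply (rule UN_I[OF self(2)])
      apply (simp only: prod.case that)
      done
  qed
  thus ?thesis by (simp add: ring_of_fractions_def)
qed

lemma (in cring) fraction_add:
  assumes "submonoid S R" "a \<in> carrier R" "b \<in> carrier R" "s \<in> S" "t \<in> S"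
  shows "fraction R S a s \<oplus>\<^bsub>ring_of_fractions R S\<^esub> fraction R S b t
       = fraction R S (t \<otimes> a \<oplus> s \<otimes> b) (s \<otimes> t)"
proof -
  interpret S: submonoid S R by fact
  have sub: "s \<in> carrier R" if "s \<in> S" for s using that S.subset by blast
  have *: "fraction R S (t' \<otimes> a' \<oplus> s' \<otimes> b') (s' \<otimes> t') = fraction R S (t \<otimes> a \<oplus> s \<otimes> b) (s \<otimes> t)"
    if A: "(a', s') \<in> fraction R S a s" "(b', t') \<in> fraction R S b t" for a' s' b' t'
  proof -
    from A(1) obtain u where u: "u \<in> S" "u \<otimes> (s' \<otimes> a) = u \<otimes> (s \<otimes> a')"
      by (auto simp: fraction_rel_def fraction_def)
    from A(2) obtain v where v: "v \<in> S" "v \<otimes> (t' \<otimes> b) = v \<otimes> (t \<otimes> b')"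
      by (auto simp: fraction_rel_def fraction_def)
    have mem: "a' \<in> carrier R" "b' \<in> carrier R" "s' \<in> S" "t' \<in> S"
      using A by (auto simp: fraction_rel_def fraction_def)
    note cl = mem(1,2) mem(3,4)[THEN sub] assms(2,3) assms(4,5)[THEN sub] u(1)[THEN sub] v(1)[THEN sub]
    have "(u \<otimes> v) \<otimes> ((s' \<otimes> t') \<otimes> (t \<otimes> a \<oplus> s \<otimes> b))
        = (v \<otimes> t \<otimes> t') \<otimes> (u \<otimes> (s' \<otimes> a)) \<oplus> (u \<otimes> s \<otimes> s') \<otimes> (v \<otimes> (t' \<otimes> b))"
      using cl by (simp add: m_ac r_distr)
    also have "\<dots> = (u \<otimes> v) \<otimes> ((s \<otimes> t) \<otimes> (t' \<otimes> a' \<oplus> s' \<otimes> b'))"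
      unfolding u(2) v(2) using cl by (simp add: m_ac r_distr)
    finally have "((t \<otimes> a \<oplus> s \<otimes> b, s \<otimes> t), (t' \<otimes> a' \<oplus> s' \<otimes> b', s' \<otimes> t')) \<in> fraction_rel R S"
      unfolding fraction_rel_def using cl mem assms u(1) v(1)
      by (auto intro!: bexI[of _ "u \<otimes> v"])
    thus ?thesis
      unfolding fraction_def using equiv_class_eq[OF equiv_fraction_rel[OF assms(1)]] by metis
  qed
  have self: "(a, s) \<in> fraction R S a s" "(b, t) \<in> fraction R S b t"
    using equiv_class_self[OF equiv_fraction_rel[OF assms(1)]] assms by (auto simp: fraction_def)
  have "(\<Union>(a', s')\<in>fraction R S a s. \<Union>(b', t')\<in>fraction R S b t.
           fraction R S (t' \<otimes> a' \<oplus> s' \<otimes> b') (s' \<otimes> t')) = fraction R S (t \<otimes> a \<oplus> s \<otimes> b) (s \<otimes> t)" (is "?L = ?R")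
  proof (intro equalityI subsetI)
    show "z \<in> ?R" if "z \<in> ?L" for z using that * by auto
    show "z \<in> ?L" if "z \<in> ?R" for z
      apply (rule UN_I[OF self(1)])
      apply (simp only: prod.case)
      apply (rule UN_I[OF self(2)])
      apply (simp only: prod.case that)
      done
  qed
  thus ?thesis by (simp add: ring_of_fractions_def)
qed


section \<open>Normality, reducedness, Krull dimension\<close>

definition integral_over :: "('a, 'm) ring_scheme \<Rightarrow> 'a set \<Rightarrow> 'a \<Rightarrow> bool" where
  "integral_over L K x \<longleftrightarrow>
     (\<exists>p. polynomial\<^bsub>L\<^esub> K p \<and> p \<noteq> [] \<and> hd p = \<one>\<^bsub>L\<^esub> \<and> ring.eval L p x = \<zero>\<^bsub>L\<^esub>)"

definition normal_domain :: "('a, 'm) ring_scheme \<Rightarrow> bool" where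
  "normal_domain R \<longleftrightarrow> domain R \<and>
     (let F = fraction_field R;
          K = (\<lambda>a. fraction R (carrier R - {\<zero>\<^bsub>R\<^esub>}) a \<one>\<^bsub>R\<^esub>) ` carrier R
      in \<forall>x \<in> carrier F. integral_over F K x \<longrightarrow> x \<in> K)"

definition reduced_ring :: "('a, 'm) ring_scheme \<Rightarrow> bool" where
  "reduced_ring R \<longleftrightarrow> (\<forall>x \<in> carrier R. \<forall>n::nat. x [^]\<^bsub>R\<^esub> n = \<zero>\<^bsub>R\<^esub> \<longrightarrow> x = \<zero>\<^bsub>R\<^esub>)"

definition prime_chain :: "('a, 'm) ring_scheme \<Rightarrow> nat \<Rightarrow> (nat \<Rightarrow> 'a set) \<Rightarrow> bool" where
  "prime_chain R n P \<longleftrightarrow> (\<forall>i\<le>n. primeideal (P i) R) \<and> (\<forall>i<n. P i \<subset> P (Suc i))"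

definition has_krull_dim :: "('a, 'm) ring_scheme \<Rightarrow> nat \<Rightarrow> bool" where
  "has_krull_dim R n \<longleftrightarrow>
     (\<exists>P. prime_chain R n P) \<and> (\<forall>m P. prime_chain R m P \<longrightarrow> m \<le> n)"


section \<open>Tensor products and flatness\<close>

definition tensor_relations ::
  "('a, 'r) ring_scheme \<Rightarrow> ('a, 'b, 'm) module_scheme \<Rightarrow> ('a, 'c, 'n) module_scheme
     \<Rightarrow> (('b \<times> 'c) \<Rightarrow>\<^sub>0 int) set" where
  "tensor_relations R M N =
     {frag_of (x \<oplus>\<^bsub>M\<^esub> x', y) - frag_of (x, y) - frag_of (x', y) | x x' y.
        x \<in> carrier M \<and> x' \<in> carrier M \<and> y \<in> carrier N} \<union>
     {frag_of (x, y \<oplus>\<^bsub>N\<^esub> y') - frag_of (x, y) - frag_of (x, y') | x y y'.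
        x \<in> carrier M \<and> y \<in> carrier N \<and> y' \<in> carrier N} \<union>
     {frag_of (a \<odot>\<^bsub>M\<^esub> x, y) - frag_of (x, a \<odot>\<^bsub>N\<^esub> y) | a x y.
        a \<in> carrier R \<and> x \<in> carrier M \<and> y \<in> carrier N}"

definition tensor_kernel ::
  "('a, 'r) ring_scheme \<Rightarrow> ('a, 'b, 'm) module_scheme \<Rightarrow> ('a, 'c, 'n) module_scheme
     \<Rightarrow> (('b \<times> 'c) \<Rightarrow>\<^sub>0 int) set" where
  "tensor_kernel R M N =
     generate (free_Abelian_group (carrier M \<times> carrier N)) (tensor_relations R M N)"

definition tensor_product ::
  "('a, 'r) ring_scheme \<Rightarrow> ('a, 'b, 'm) module_scheme \<Rightarrow> ('a, 'c, 'n) module_scheme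
     \<Rightarrow> ((('b \<times> 'c) \<Rightarrow>\<^sub>0 int) set) monoid" where
  "tensor_product R M N =
     free_Abelian_group (carrier M \<times> carrier N) Mod tensor_kernel R M N"

text \<open>The map \<open>f \<otimes> id : M \<otimes> N \<rightarrow> M' \<otimes> N\<close> on cosets, for \<open>R\<close>-linear \<open>f : M \<rightarrow> M'\<close>.\<close>

definition tensor_map ::
  "('a, 'r) ring_scheme \<Rightarrow> ('a, 'b, 'm) module_scheme \<Rightarrow> ('a, 'c, 'n) module_scheme \<Rightarrow> ('b \<Rightarrow> 'b)
     \<Rightarrow> (('b \<times> 'c) \<Rightarrow>\<^sub>0 int) set \<Rightarrow> (('b \<times> 'c) \<Rightarrow>\<^sub>0 int) set" where
  "tensor_map R M' N f C =
     (\<Union>z\<in>C. tensor_kernel R M' N #>\<^bsub>free_Abelian_group (carrier M' \<times> carrier N)\<^esub>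
               frag_extend (\<lambda>(x, y). frag_of (f x, y)) z)"

definition linear_maps ::
  "('a, 'r) ring_scheme \<Rightarrow> ('a, 'b, 'm) module_scheme \<Rightarrow> ('a, 'c, 'n) module_scheme \<Rightarrow> ('b \<Rightarrow> 'c) set" where
  "linear_maps R M N =
     {f \<in> carrier M \<rightarrow> carrier N.
        (\<forall>x \<in> carrier M. \<forall>y \<in> carrier M. f (x \<oplus>\<^bsub>M\<^esub> y) = f x \<oplus>\<^bsub>N\<^esub> f y) \<and>
        (\<forall>a \<in> carrier R. \<forall>x \<in> carrier M. f (a \<odot>\<^bsub>M\<^esub> x) = a \<odot>\<^bsub>N\<^esub> f x)}"

text \<open>
  \<open>N\<close> is flat if tensoring with \<open>N\<close> preserves injectivity.  HOL cannot quantify over all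
  types, so the test modules \<open>M\<close>, \<open>M'\<close> have carriers in the type \<open>(nat \<Rightarrow> 'a) set\<close>.
  Every countably generated \<open>R\<close>-module is isomorphic to one of these (cosets of a submodule of
  the finitely supported sequences in \<open>R\<close>), and finitely generated test modules already suffice.
\<close>

definition flat_module :: "('a, 'r) ring_scheme \<Rightarrow> ('a, 'c, 'n) module_scheme \<Rightarrow> bool" where
  "flat_module R N \<longleftrightarrow> Module.module R N \<and>
     (\<forall>(M :: ('a, (nat \<Rightarrow> 'a) set) module) (M' :: ('a, (nat \<Rightarrow> 'a) set) module) f.
        Module.module R M \<and> Module.module R M' \<and> f \<in> linear_maps R M M' \<and> inj_on f (carrier M)
        \<longrightarrow> inj_on (tensor_map R M' N f) (carrier (tensor_product R M N)))"

definition restrict_scalars :: "('b, 'm) ring_scheme \<Rightarrow> ('a \<Rightarrow> 'b) \<Rightarrow> ('a, 'b) module" where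
  "restrict_scalars B \<phi> =
     \<lparr> carrier = carrier B, monoid.mult = monoid.mult B, one = one B, ring.zero = ring.zero B,
       add = add B, module.smult = (\<lambda>a b. \<phi> a \<otimes>\<^bsub>B\<^esub> b) \<rparr>"

text \<open>A morphism of schemes is faithfully flat if it is flat and surjective.\<close>

definition faithfully_flat ::
  "('a, 'r) ring_scheme \<Rightarrow> ('b, 'm) ring_scheme \<Rightarrow> ('a \<Rightarrow> 'b) \<Rightarrow> bool" where
  "faithfully_flat A B \<phi> \<longleftrightarrow> flat_module A (restrict_scalars B \<phi>) \<and>
     (\<forall>p. primeideal p A \<longrightarrow> (\<exists>P. primeideal P B \<and> {a \<in> carrier A. \<phi> a \<in> P} = p))"


section \<open>Generalized Danielewski surfaces\<close>

abbreviation Ch :: "complex poly ring" where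
  "Ch \<equiv> ring_of_type_algebra"

text \<open>
  The fibres are the spectra of \<open>B \<otimes> A/p = B/pB\<close> for \<open>p\<close> maximal and of
  \<open>B \<otimes> Frac A\<close>, the localization of \<open>B\<close> at the image of \<open>A - {0}\<close>.
\<close>

definition closed_fibre ::
  "('b, 'm) ring_scheme \<Rightarrow> (complex poly \<Rightarrow> 'b) \<Rightarrow> complex poly set \<Rightarrow> 'b set ring" where
  "closed_fibre B \<phi> p = B Quot (Idl\<^bsub>B\<^esub> (\<phi> ` p))"

definition generic_fibre ::
  "('b, 'm) ring_scheme \<Rightarrow> (complex poly \<Rightarrow> 'b) \<Rightarrow> ('b \<times> 'b) set ring" where
  "generic_fibre B \<phi> = ring_of_fractions B (\<phi> ` (UNIV - {0}))"

text \<open>The isomorphism is one of algebras over \<open>K(Z) = \<complex>(h)\<close>, as expressed on constants.\<close>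

definition generic_fibre_is_affine_line ::
  "('b, 'm) ring_scheme \<Rightarrow> (complex poly \<Rightarrow> 'b) \<Rightarrow> bool" where
  "generic_fibre_is_affine_line B \<phi> \<longleftrightarrow>
     (\<exists>\<theta> \<in> ring_iso (ring_of_type_algebra :: complex poly fract poly ring) (generic_fibre B \<phi>).
        \<forall>a s. s \<noteq> 0 \<longrightarrow> \<theta> [:Fract a s:] = fraction B (\<phi> ` (UNIV - {0})) (\<phi> a) (\<phi> s))"

definition normal_affine_surface ::
  "('b, 'm) ring_scheme \<Rightarrow> (complex \<Rightarrow> 'b) \<Rightarrow> bool" where
  "normal_affine_surface B \<iota> \<longleftrightarrow>
     \<iota> \<in> ring_hom (ring_of_type_algebra :: complex ring) B \<and>
     (\<exists>F. finite F \<and> F \<subseteq> carrier B \<and> generate_ring B (range \<iota> \<union> F) = carrier B) \<and>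
     normal_domain B \<and> has_krull_dim B 2"

text \<open>
  As \<open>q\<close> is a morphism of complex schemes, the \<open>\<complex>\<close>-algebra structure of \<open>B\<close> is
  \<open>\<lambda>c. \<phi> [:c:]\<close>.  Closed points of \<open>Spec \<complex>[h]\<close> are the maximal ideals.
\<close>

definition GDS :: "('b, 'm) ring_scheme \<Rightarrow> (complex poly \<Rightarrow> 'b) \<Rightarrow> bool" where
  "GDS B \<phi> \<longleftrightarrow>
     \<phi> \<in> ring_hom Ch B \<and>
     normal_affine_surface B (\<lambda>c. \<phi> [:c:]) \<and>
     faithfully_flat Ch B \<phi> \<and>
     (\<forall>p. maximalideal p Ch \<longrightarrow> reduced_ring (closed_fibre B \<phi> p)) \<and>
     reduced_ring (generic_fibre B \<phi>) \<and>
     generic_fibre_is_affine_line B \<phi> \<and>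
     (\<exists>p0. maximalideal p0 Ch \<and>
        (\<forall>p. maximalideal p Ch \<and> p \<noteq> p0 \<longrightarrow> domain (closed_fibre B \<phi> p)))"


section \<open>Fine-labelled rooted trees\<close>

text \<open>The value of \<open>lb\<close> at the root is irrelevant.\<close>

record 'n labelled_tree =
  nodes :: "'n set"
  tree_le :: "'n rel"
  lb :: "'n \<Rightarrow> complex"

definition minimal_in :: "'n rel \<Rightarrow> 'n set \<Rightarrow> 'n \<Rightarrow> bool" where
  "minimal_in r Y e \<longleftrightarrow> e \<in> Y \<and> (\<forall>x \<in> Y. (x, e) \<in> r \<longrightarrow> x = e)"

definition maximal_in :: "'n rel \<Rightarrow> 'n set \<Rightarrow> 'n \<Rightarrow> bool" where
  "maximal_in r Y e \<longleftrightarrow> e \<in> Y \<and> (\<forall>x \<in> Y. (e, x) \<in> r \<longrightarrow> x = e)"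

definition down :: "('n, 'z) labelled_tree_scheme \<Rightarrow> 'n \<Rightarrow> 'n set" where
  "down T e = {x \<in> nodes T. (x, e) \<in> tree_le T}"

definition rooted_tree :: "('n, 'z) labelled_tree_scheme \<Rightarrow> bool" where
  "rooted_tree T \<longleftrightarrow>
     finite (nodes T) \<and> nodes T \<noteq> {} \<and> partial_order_on (nodes T) (tree_le T) \<and>
     (\<exists>!e. minimal_in (tree_le T) (nodes T) e) \<and>
     (\<forall>e \<in> nodes T. \<forall>x \<in> down T e. \<forall>y \<in> down T e. (x, y) \<in> tree_le T \<or> (y, x) \<in> tree_le T)"

definition tree_root :: "('n, 'z) labelled_tree_scheme \<Rightarrow> 'n" where
  "tree_root T = (THE e. minimal_in (tree_le T) (nodes T) e)"

definition leaves :: "('n, 'z) labelled_tree_scheme \<Rightarrow> 'n set" where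
  "leaves T = {e. maximal_in (tree_le T) (nodes T) e}"

definition parents :: "('n, 'z) labelled_tree_scheme \<Rightarrow> 'n set" where
  "parents T = nodes T - leaves T"

definition anc :: "('n, 'z) labelled_tree_scheme \<Rightarrow> 'n \<Rightarrow> 'n set" where
  "anc T e = down T e - {e}"

definition par :: "('n, 'z) labelled_tree_scheme \<Rightarrow> 'n \<Rightarrow> 'n" where
  "par T e = (THE x. maximal_in (tree_le T) (anc T e) x)"

definition child :: "('n, 'z) labelled_tree_scheme \<Rightarrow> 'n \<Rightarrow> 'n set" where
  "child T e = {x. minimal_in (tree_le T) {y \<in> nodes T. (e, y) \<in> tree_le T \<and> y \<noteq> e} x}"

definition fine_labelled_tree :: "('n, 'z) labelled_tree_scheme \<Rightarrow> bool" where
  "fine_labelled_tree T \<longleftrightarrow> rooted_tree T \<and>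
     (\<forall>f \<in> nodes T - {tree_root T}. \<forall>f' \<in> nodes T - {tree_root T}.
        f \<noteq> f' \<and> par T f = par T f' \<longrightarrow> lb T f \<noteq> lb T f')"


section \<open>The algebra attached to a fine-labelled rooted tree\<close>

text \<open>
  Polynomials over \<open>\<complex>[h]\<close> in variables indexed by \<open>'n option\<close>: the variable \<open>X\<^sub>0\<close> has
  index \<open>None\<close> and \<open>X\<^sub>e\<close> has index \<open>Some e\<close>.
\<close>

type_synonym 'n tree_poly = "('n option \<Rightarrow>\<^sub>0 nat) \<Rightarrow>\<^sub>0 complex poly"

definition Const :: "complex poly \<Rightarrow> 'n tree_poly" where
  "Const a = Poly_Mapping.single 0 a"

definition Var :: "'n option \<Rightarrow> 'n tree_poly" where
  "Var v = Poly_Mapping.single (Poly_Mapping.single v 1) 1"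

definition tree_poly_ring :: "('n, 'z) labelled_tree_scheme \<Rightarrow> 'n tree_poly ring" where
  "tree_poly_ring T = ring_of_type_algebra
     \<lparr> carrier := {p. \<forall>m \<in> Poly_Mapping.keys p.
                     Poly_Mapping.keys m \<subseteq> insert None (Some ` parents T)} \<rparr>"

definition Var_par :: "('n, 'z) labelled_tree_scheme \<Rightarrow> 'n \<Rightarrow> 'n tree_poly" where
  "Var_par T e = (if e = tree_root T then Var None else Var (Some (par T e)))"

definition S_poly :: "('n, 'z) labelled_tree_scheme \<Rightarrow> 'n \<Rightarrow> 'n set \<Rightarrow> 'n tree_poly" where
  "S_poly T e J = (\<Prod>g \<in> child T e - J. Var_par T e - Const [:lb T g:])"

text \<open>The recursive description of \<open>R\<^sub>e\<close> is \<open>R_poly_root\<close> and \<open>R_poly_rec\<close> below.\<close>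

definition R_poly :: "('n, 'z) labelled_tree_scheme \<Rightarrow> 'n \<Rightarrow> 'n tree_poly" where
  "R_poly T e = (\<Prod>f \<in> down T e - {tree_root T}. S_poly T (par T f) {f})"

definition Q_poly :: "('n, 'z) labelled_tree_scheme \<Rightarrow> 'n \<Rightarrow> 'n tree_poly" where
  "Q_poly T e = S_poly T e {} * R_poly T e"

text \<open>The quotient \<open>Q\<^sub>e / R\<^bsub>e''\<^esub>\<close> for \<open>e'' \<le> e\<close>, see \<open>Q_quot_mult\<close> below.\<close>

definition Q_quot :: "('n, 'z) labelled_tree_scheme \<Rightarrow> 'n \<Rightarrow> 'n \<Rightarrow> 'n tree_poly" where
  "Q_quot T e e'' = S_poly T e {} * (\<Prod>f \<in> down T e - down T e''. S_poly T (par T f) {f})"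

definition child_below :: "('n, 'z) labelled_tree_scheme \<Rightarrow> 'n \<Rightarrow> 'n \<Rightarrow> 'n" where
  "child_below T e' e = (THE x. x \<in> child T e' \<inter> down T e)"

definition Delta0 :: "('n, 'z) labelled_tree_scheme \<Rightarrow> 'n \<Rightarrow> 'n tree_poly" where
  "Delta0 T e = Const [:0, 1:] * Var (Some e) - Q_poly T e"

definition Delta :: "('n, 'z) labelled_tree_scheme \<Rightarrow> 'n \<Rightarrow> 'n \<Rightarrow> 'n tree_poly" where
  "Delta T e' e = (let e'' = child_below T e' e in
     (Var_par T e' - Const [:lb T e'':]) * Var (Some e) - Var (Some e') * Q_quot T e e'')"

context
  fixes T :: "('n, 'z) labelled_tree_scheme"
  assumes T: "rooted_tree T"
begin

private lemma po: "partial_order_on (nodes T) (tree_le T)" and fin: "finite (nodes T)"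
  using T unfolding rooted_tree_def by - (elim conjE, assumption)+

private lemma fin_le: "finite (tree_le T)"
  using finite_subset[OF partial_order_onD(4)[OF po]] fin by simp

private lemma le_trans: "(x, y) \<in> tree_le T \<Longrightarrow> (y, z) \<in> tree_le T \<Longrightarrow> (x, z) \<in> tree_le T"
  by (rule transD[OF partial_order_onD(2)[OF po]])

private lemma le_antisym: "(x, y) \<in> tree_le T \<Longrightarrow> (y, x) \<in> tree_le T \<Longrightarrow> x = y"
  by (rule antisymD[OF partial_order_onD(3)[OF po]])

private lemma le_refl: "x \<in> nodes T \<Longrightarrow> (x, x) \<in> tree_le T"
  by (rule refl_onD[OF partial_order_onD(1)[OF po]])

private lemma le_nodes: "(x, y) \<in> tree_le T \<Longrightarrow> x \<in> nodes T \<and> y \<in> nodes T"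
  using partial_order_onD(4)[OF po] by auto

private lemma le_linear: "(x, e) \<in> tree_le T \<Longrightarrow> (y, e) \<in> tree_le T \<Longrightarrow> (x, y) \<in> tree_le T \<or> (y, x) \<in> tree_le T"
proof -
  assume xy: "(x, e) \<in> tree_le T" "(y, e) \<in> tree_le T"
  have "\<forall>e \<in> nodes T. \<forall>x \<in> down T e. \<forall>y \<in> down T e. (x, y) \<in> tree_le T \<or> (y, x) \<in> tree_le T"
    using T by (simp add: rooted_tree_def)
  moreover have "e \<in> nodes T" "x \<in> down T e" "y \<in> down T e"
    using xy le_nodes by (auto simp: down_def)
  ultimately show ?thesis by simp
qed

private lemma ex_minimal:
  assumes "Y \<subseteq> nodes T" "Y \<noteq> {}"
  shows "\<exists>x. minimal_in (tree_le T) Y x"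
proof -
  have "wf (tree_le T - Id)"
    by (rule partial_order_on_well_order_on[OF fin_le po])
  with assms(2) obtain x where "x \<in> Y" "\<And>y. (y, x) \<in> tree_le T - Id \<Longrightarrow> y \<notin> Y"
    using wfE_min[of "tree_le T - Id" _ Y] by blast
  thus ?thesis by (auto simp: minimal_in_def)
qed

private lemma ex_maximal:
  assumes "Y \<subseteq> nodes T" "Y \<noteq> {}"
  shows "\<exists>x. maximal_in (tree_le T) Y x"
proof -
  have po': "partial_order_on (nodes T) ((tree_le T)\<inverse>)" using po by simp
  have "wf ((tree_le T)\<inverse> - Id)"
    by (rule partial_order_on_well_order_on[OF _ po']) (use fin_le in simp)
  with assms(2) obtain x where "x \<in> Y" "\<And>y. (y, x) \<in> (tree_le T)\<inverse> - Id \<Longrightarrow> y \<notin> Y"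
    using wfE_min[of "(tree_le T)\<inverse> - Id" _ Y] by blast
  thus ?thesis by (auto simp: maximal_in_def)
qed

private lemma root_minimal: "minimal_in (tree_le T) (nodes T) (tree_root T)"
proof -
  have "\<exists>!e. minimal_in (tree_le T) (nodes T) e"
    using T unfolding rooted_tree_def by - (elim conjE, assumption)
  thus ?thesis unfolding tree_root_def by (rule theI')
qed

lemma root_least:
  assumes "e \<in> nodes T" shows "(tree_root T, e) \<in> tree_le T"
proof -
  have "down T e \<subseteq> nodes T" "e \<in> down T e" using assms le_refl by (auto simp: down_def)
  then obtain x where x: "minimal_in (tree_le T) (down T e) x" using ex_minimal[of "down T e"] by blast
  have "minimal_in (tree_le T) (nodes T) x"
    using x le_trans by (auto simp: minimal_in_def down_def)
  hence "x = tree_root T" using T root_minimal by (auto simp: rooted_tree_def)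
  thus ?thesis using x by (simp add: minimal_in_def down_def)
qed

lemma par_greatest:
  assumes "e \<in> nodes T" "e \<noteq> tree_root T"
  shows "par T e \<in> anc T e" "\<And>x. x \<in> anc T e \<Longrightarrow> (x, par T e) \<in> tree_le T"
proof -
  have "tree_root T \<in> anc T e" "anc T e \<subseteq> nodes T"
    using root_least[OF assms(1)] assms le_nodes by (auto simp: anc_def down_def)
  then obtain p where p: "maximal_in (tree_le T) (anc T e) p" using ex_maximal[of "anc T e"] by blast
  have gr: "(x, p) \<in> tree_le T" if "x \<in> anc T e" for x
    using that p le_linear[of x e p] le_refl by (auto simp: maximal_in_def anc_def down_def)
  have "par T e = p"
    unfolding par_def by (rule the_equality, rule p) (use gr p in \<open>auto simp: maximal_in_def\<close>)
  thus "par T e \<in> anc T e" "\<And>x. x \<in> anc T e \<Longrightarrow> (x, par T e) \<in> tree_le T"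
    using p gr by (auto simp: maximal_in_def)
qed

private lemma down_par:
  assumes "e \<in> nodes T" "e \<noteq> tree_root T"
  shows "down T e = insert e (down T (par T e))" "e \<notin> down T (par T e)" "par T e \<in> nodes T"
proof -
  note p = par_greatest[OF assms]
  show "down T e = insert e (down T (par T e))"
    using p le_trans le_refl assms(1) by (auto simp: anc_def down_def)
  show "e \<notin> down T (par T e)" "par T e \<in> nodes T"
    using p(1) le_antisym by (auto simp: anc_def down_def)
qed

private lemma fin_down: "finite (down T e)"
  using fin by (simp add: down_def)

lemma child_iff: "f \<in> child T e \<longleftrightarrow> f \<in> nodes T \<and> f \<noteq> tree_root T \<and> par T f = e"
proof (intro iffI)
  assume f: "f \<in> child T e"
  have fn: "f \<in> nodes T" using f by (simp add: child_def minimal_in_def)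
  have ef: "(e, f) \<in> tree_le T" "f \<noteq> e" using f by (auto simp: child_def minimal_in_def)
  have en: "e \<in> nodes T" using ef(1) le_nodes by simp
  have fr: "f \<noteq> tree_root T"
  proof
    assume "f = tree_root T"
    hence "(f, e) \<in> tree_le T" using root_least[OF en] by simp
    thus False using le_antisym[OF ef(1)] ef(2) by simp
  qed
  note p = par_greatest[OF fn fr]
  have 1: "(e, par T f) \<in> tree_le T" using p(2) ef en by (auto simp: anc_def down_def)
  have 2: "par T f \<in> nodes T" "(par T f, f) \<in> tree_le T" "par T f \<noteq> f"
    using p(1) by (auto simp: anc_def down_def)
  have "par T f = e"
    using f 1 2 by (auto simp: child_def minimal_in_def)
  thus "f \<in> nodes T \<and> f \<noteq> tree_root T \<and> par T f = e" using fn fr by simp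
next
  assume f: "f \<in> nodes T \<and> f \<noteq> tree_root T \<and> par T f = e"
  hence fn: "f \<in> nodes T" and fr: "f \<noteq> tree_root T" and e: "e = par T f" by auto
  note p = par_greatest[OF fn fr, folded e]
  have 1: "(e, f) \<in> tree_le T" "e \<noteq> f" using p(1) by (auto simp: anc_def down_def)
  have "x = f" if x: "x \<in> nodes T" "(e, x) \<in> tree_le T" "x \<noteq> e" "(x, f) \<in> tree_le T" for x
  proof (rule ccontr)
    assume "x \<noteq> f"
    hence "(x, e) \<in> tree_le T" using p(2)[of x] x by (simp add: anc_def down_def)
    thus False using le_antisym[OF x(2)] x(3) by simp
  qed
  thus "f \<in> child T e" using fn 1 by (auto simp: child_def minimal_in_def)
qed

lemma child_below_props:
  assumes "e \<in> nodes T" "e' \<in> anc T e"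
  shows "child_below T e' e \<in> child T e'" "child_below T e' e \<in> down T e"
proof -
  let ?X = "{y \<in> nodes T. (e', y) \<in> tree_le T \<and> y \<noteq> e' \<and> (y, e) \<in> tree_le T}"
  have "e \<in> ?X" using assms le_refl by (auto simp: anc_def down_def)
  then obtain x where x: "minimal_in (tree_le T) ?X x" using ex_minimal[of ?X] by blast
  have xc: "x \<in> child T e' \<inter> down T e"
    using x le_trans by (auto simp: child_def minimal_in_def down_def)
  have "y = x" if y: "y \<in> child T e' \<inter> down T e" for y
    using y xc le_linear[of x e y] by (auto simp: child_def minimal_in_def down_def)
  hence "child_below T e' e = x" unfolding child_below_def using xc by blast
  thus "child_below T e' e \<in> child T e'" "child_below T e' e \<in> down T e" using xc by auto
qed

lemma R_poly_root: "R_poly T (tree_root T) = 1"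
proof -
  have "down T (tree_root T) \<subseteq> {tree_root T}"
  proof
    fix x assume "x \<in> down T (tree_root T)"
    hence x: "x \<in> nodes T" "(x, tree_root T) \<in> tree_le T" by (simp_all add: down_def)
    show "x \<in> {tree_root T}" using le_antisym[OF x(2) root_least[OF x(1)]] by (rule ssubst) simp
  qed
  hence *: "down T (tree_root T) - {tree_root T} = {}" by (rule Diff_eq_empty_iff[THEN iffD2])
  show ?thesis unfolding R_poly_def * by simp
qed

lemma R_poly_rec:
  assumes "e \<in> nodes T" "e \<noteq> tree_root T"
  shows "R_poly T e = S_poly T (par T e) {e} * R_poly T (par T e)"
proof -
  have "down T e - {tree_root T} = insert e (down T (par T e) - {tree_root T})"
    by (subst down_par(1)[OF assms]) (use assms(2) in blast)
  thus ?thesis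
    unfolding R_poly_def using down_par(2)[OF assms] fin_down by (simp del: Diff_insert0)
qed

lemma Q_quot_mult:
  assumes "(e'', e) \<in> tree_le T"
  shows "Q_quot T e e'' * R_poly T e'' = Q_poly T e"
proof -
  have sub: "down T e'' \<subseteq> down T e" using assms le_trans by (auto simp: down_def)
  have "tree_root T \<in> down T e''" using assms root_least le_nodes by (auto simp: down_def)
  with sub have eq: "down T e - {tree_root T} = (down T e - down T e'') \<union> (down T e'' - {tree_root T})"
    by auto
  have "R_poly T e = (\<Prod>f \<in> down T e - down T e''. S_poly T (par T f) {f}) * R_poly T e''"
    unfolding R_poly_def eq by (rule prod.union_disjoint) (use fin_down in auto)
  thus ?thesis by (simp add: Q_quot_def Q_poly_def mult.assoc)
qed

text \<open>Hence \<open>\<Delta>\<^bsub>e',e\<^esub>\<close> is the quotient of \<open>Q\<^bsub>e'\<^esub> X\<^sub>e - Q\<^sub>e X\<^bsub>e'\<^esub>\<close> by \<open>R\<^bsub>e''\<^esub>\<close>.\<close>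

lemma Delta_mult:
  assumes "e \<in> nodes T" "e' \<in> anc T e"
  shows "R_poly T (child_below T e' e) * Delta T e' e
       = Q_poly T e' * Var (Some e) - Q_poly T e * Var (Some e')"
proof -
  define c where "c = child_below T e' e"
  have c: "c \<in> child T e'" "(c, e) \<in> tree_le T"
    using child_below_props[OF assms] by (auto simp: c_def down_def)
  have cn: "c \<in> nodes T" "c \<noteq> tree_root T" "par T c = e'" using c(1) child_iff by auto
  have "finite (child T e')" using fin by (rule finite_subset[rotated]) (auto simp: child_iff)
  hence "S_poly T e' {} = (Var_par T e' - Const [:lb T c:]) * S_poly T e' {c}"
    unfolding S_poly_def using prod.remove[OF _ c(1)] by (metis Diff_empty)
  hence Q': "Q_poly T e' = (Var_par T e' - Const [:lb T c:]) * R_poly T c"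
    using R_poly_rec[OF cn(1,2)] cn(3) by (simp add: Q_poly_def mult.assoc)
  show ?thesis
    unfolding Delta_def c_def[symmetric] Let_def Q' Q_quot_mult[OF c(2), symmetric]
    by (simp add: algebra_simps)
qed

end

lemma keys_uminus_poly: "Poly_Mapping.keys (- p) = Poly_Mapping.keys (p :: 'n tree_poly)"
  by (auto simp: in_keys_iff)

lemma cring_tree_poly_ring: "cring (tree_poly_ring T)"
proof -
  interpret P: cring "ring_of_type_algebra :: 'a tree_poly ring" by (rule cring_from_type_algebra)
  let ?V = "insert None (Some ` parents T)"
  let ?K = "{p :: 'a tree_poly. \<forall>m \<in> Poly_Mapping.keys p. Poly_Mapping.keys m \<subseteq> ?V}"
  have uminus: "\<ominus>\<^bsub>ring_of_type_algebra\<^esub> p = - p" for p :: "'a tree_poly"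
    by (rule P.minus_equality) (auto simp: ring_of_type_algebra_def)
  have "subcring ?K (ring_of_type_algebra :: 'a tree_poly ring)"
  proof (rule P.subcringI')
    show "subring ?K (ring_of_type_algebra :: 'a tree_poly ring)"
    proof (rule P.subringI)
      fix p q assume pq: "p \<in> ?K" "q \<in> ?K"
      show "\<ominus>\<^bsub>ring_of_type_algebra\<^esub> p \<in> ?K" using pq by (simp add: uminus keys_uminus_poly)
      show "p \<oplus>\<^bsub>ring_of_type_algebra\<^esub> q \<in> ?K"
        using pq Poly_Mapping.keys_add[of p q] by (auto simp: ring_of_type_algebra_def dest!: subsetD)
      have "Poly_Mapping.keys m \<subseteq> ?V" if m: "m \<in> Poly_Mapping.keys (p * q)" for m
      proof -
        obtain a b where ab: "m = a + b" "a \<in> Poly_Mapping.keys p" "b \<in> Poly_Mapping.keys q"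
          using m keys_mult[of p q] by blast
        thus ?thesis using pq Poly_Mapping.keys_add[of a b] by blast
      qed
      thus "p \<otimes>\<^bsub>ring_of_type_algebra\<^esub> q \<in> ?K" by (simp add: ring_of_type_algebra_def)
    qed (auto simp: ring_of_type_algebra_def)
  qed
  thus ?thesis unfolding tree_poly_ring_def by (rule P.subcring_iff[THEN iffD1, rotated]) (simp add: ring_of_type_algebra_def)
qed

lemma Const_in_tree_poly_ring [simp]: "Const a \<in> carrier (tree_poly_ring T)"
  by (simp add: tree_poly_ring_def Const_def)

lemma Var_in_tree_poly_ring:
  "v \<in> insert None (Some ` parents T) \<Longrightarrow> Var v \<in> carrier (tree_poly_ring T)"
  by (auto simp: tree_poly_ring_def Var_def)

lemma tree_poly_ring_closed:
  assumes "p \<in> carrier (tree_poly_ring T)" "q \<in> carrier (tree_poly_ring T)"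
  shows "p * q \<in> carrier (tree_poly_ring T)" "p + q \<in> carrier (tree_poly_ring T)"
    "p - q \<in> carrier (tree_poly_ring T)"
proof -
  interpret cring "tree_poly_ring T" by (rule cring_tree_poly_ring)
  have neg: "- q \<in> carrier (tree_poly_ring T)"
    using assms(2) by (simp add: tree_poly_ring_def keys_uminus_poly)
  have add: "p + r \<in> carrier (tree_poly_ring T)" if "r \<in> carrier (tree_poly_ring T)" for r
    using a_closed[OF assms(1) that] by (simp add: tree_poly_ring_def ring_of_type_algebra_def)
  show "p * q \<in> carrier (tree_poly_ring T)"
    using m_closed[OF assms] by (simp add: tree_poly_ring_def ring_of_type_algebra_def)
  show "p + q \<in> carrier (tree_poly_ring T)" "p - q \<in> carrier (tree_poly_ring T)"
    using add[OF assms(2)] add[OF neg] by simp_all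
qed

lemma tree_poly_ring_prod:
  assumes "\<And>x. x \<in> A \<Longrightarrow> f x \<in> carrier (tree_poly_ring T)"
  shows "prod f A \<in> carrier (tree_poly_ring T)"
proof -
  interpret cring "tree_poly_ring T" by (rule cring_tree_poly_ring)
  have "1 \<in> carrier (tree_poly_ring T)"
    using one_closed by (simp add: tree_poly_ring_def ring_of_type_algebra_def)
  thus ?thesis using assms
    by (induction A rule: infinite_finite_induct) (auto intro: tree_poly_ring_closed)
qed

lemma par_in_parents:
  assumes "rooted_tree T" "e \<in> nodes T" "e \<noteq> tree_root T"
  shows "par T e \<in> parents T"
  using par_greatest(1)[OF assms] assms(2)
  by (auto simp: anc_def down_def parents_def leaves_def maximal_in_def)

lemma Deltas_in_tree_poly_ring:
  assumes T: "rooted_tree T" and e: "e \<in> parents T"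
  shows "Delta0 T e \<in> carrier (tree_poly_ring T)"
    and "e' \<in> anc T e \<Longrightarrow> Delta T e' e \<in> carrier (tree_poly_ring T)"
proof -
  note cl = tree_poly_ring_closed Var_in_tree_poly_ring Const_in_tree_poly_ring
  have V: "Var_par T f \<in> carrier (tree_poly_ring T)" if "f \<in> nodes T" for f
    using par_in_parents[OF T that] by (auto simp: Var_par_def intro!: cl)
  have S: "S_poly T f J \<in> carrier (tree_poly_ring T)" if "f \<in> nodes T" for f J
    unfolding S_poly_def by (intro tree_poly_ring_prod cl V that)
  have par: "par T f \<in> nodes T" if "f \<in> nodes T" "f \<noteq> tree_root T" for f
    using par_in_parents[OF T that] by (simp add: parents_def)
  have en: "e \<in> nodes T" using e by (simp add: parents_def)
  have "Q_poly T e \<in> carrier (tree_poly_ring T)"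
    unfolding Q_poly_def R_poly_def
    by (intro cl S en tree_poly_ring_prod par) (auto simp: down_def)
  thus "Delta0 T e \<in> carrier (tree_poly_ring T)"
    unfolding Delta0_def using e by (intro cl) auto
  assume e': "e' \<in> anc T e"
  define c where "c = child_below T e' e"
  have cn: "c \<in> nodes T" using child_below_props(1)[OF T en e'] child_iff[OF T] by (simp add: c_def)
  have e'n: "e' \<in> nodes T" "e' \<in> parents T"
    using e' en by (auto simp: anc_def down_def parents_def leaves_def maximal_in_def)
  have "f \<noteq> tree_root T" if "f \<in> down T e - down T c" for f
    using that root_least[OF T cn] by (auto simp: down_def)
  hence "Q_quot T e c \<in> carrier (tree_poly_ring T)"
    unfolding Q_quot_def by (intro cl S en tree_poly_ring_prod par) (auto simp: down_def)
  thus "Delta T e' e \<in> carrier (tree_poly_ring T)"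
    unfolding Delta_def Let_def c_def[symmetric] using e e'n by (intro cl V) auto
qed

definition tree_ideal :: "('n, 'z) labelled_tree_scheme \<Rightarrow> 'n tree_poly set" where
  "tree_ideal T = Idl\<^bsub>tree_poly_ring T\<^esub>
     ({Delta0 T e | e. e \<in> parents T} \<union> {Delta T e' e | e e'. e \<in> parents T \<and> e' \<in> anc T e})"

definition tree_algebra :: "('n, 'z) labelled_tree_scheme \<Rightarrow> 'n tree_poly set ring" where
  "tree_algebra T = tree_poly_ring T Quot tree_ideal T"

definition tree_structure_map ::
  "('n, 'z) labelled_tree_scheme \<Rightarrow> complex poly \<Rightarrow> 'n tree_poly set" where
  "tree_structure_map T a = tree_ideal T +>\<^bsub>tree_poly_ring T\<^esub> Const a"

definition isomorphic_over_Ch ::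
  "('b, 'm) ring_scheme \<Rightarrow> (complex poly \<Rightarrow> 'b) \<Rightarrow> ('c, 'k) ring_scheme \<Rightarrow> (complex poly \<Rightarrow> 'c) \<Rightarrow> bool" where
  "isomorphic_over_Ch B \<phi> C \<psi> \<longleftrightarrow> (\<exists>\<theta> \<in> ring_iso B C. \<forall>a. \<theta> (\<phi> a) = \<psi> a)"

end

theory Submission
  imports Defs
    "HOL-Computational_Algebra.Fundamental_Theorem_Algebra"
    "HOL-Library.Sublist"
begin

text \<open>
  The generic fibre embeds \<open>B\<close> into \<open>\<complex>(h)[X]\<close>. As \<open>B\<close> is finitely generated, a multiple of
  \<open>d/dX\<close> by a polynomial in \<open>h\<close> preserves \<open>B\<close>; hence a generator \<open>x \<in> B\<close> of least slope
  exists, and integrality of the fibres over \<open>c \<noteq> 0\<close> gives \<open>B[1/h] = \<complex>[h, 1/h, x]\<close>.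

  The tree records the values of functions on the special fibre. At the root, \<open>x\<close> is either
  transcendental on \<open>h = 0\<close> or, by reducedness, annihilated by some \<open>S = \<Prod>(x - c)\<close> with distinct
  \<open>c\<close>; these are the labels of the children, and \<open>X = S/h\<close> is examined on each part of the fibre
  in the same way. Each step divides the derivative by \<open>h\<close>, so the bounded pole of \<open>d/dx\<close> on
  \<open>B\<close> bounds the depth of the tree.

  That the \<open>X\<^sub>e\<close> generate \<open>B\<close> is checked modulo \<open>h\<close> at the leaves, where \<open>X\<close> is transcendental.
  The relations are exhausted by the \<open>\<Delta>\<close>: one adjoins the inner nodes one at a time, and the
  leading coefficient in \<open>X\<^sub>f\<close> of a relation vanishes along the component of the truncated tree at
  \<open>f\<close>, so that the \<open>\<Delta>\<close> lower its degree.
\<close>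

section \<open>Subrings with a derivation\<close>

text \<open>Components of the fibre \<open>h = 0\<close> appear neither as ideals nor as
  localisations. The component at a node is handled through a function \<open>r\<close>, the value
  of \<open>R_poly\<close>, that lives on it: a statement "holds on the component" when it holds
  modulo \<open>h\<close> after multiplication by \<open>r\<close>. This explains the many auxiliary
  factors \<open>r\<close>.

  The obstacle is the kernel. At an inner node \<open>f\<close> the coordinate \<open>Y\<close> is
  algebraic on the fibre of \<open>B\<close>, since \<open>S(Y) * R = h * X_f\<close>. In the
  subring \<open>C\<close> generated by the variables of a truncated tree with leaf \<open>f\<close>
  it must instead be shown to be transcendental, and divisibility in \<open>B\<close> says nothing
  about this. Characteristic zero replaces dimension theory: at depth \<open>d\<close> the operator
  \<open>h^d * D\<close> acts on the component as \<open>d/dY\<close> up to a nonzero constant, so a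
  relation \<open>g(Y) = 0\<close> of least degree could be differentiated to a smaller one. The
  same estimate bounds the depth of the tree. It is therefore proved once, for an arbitrary subring
  \<open>C\<close> that need not be stable under \<open>D\<close>, and applied both to truncated
  algebras and to \<open>B\<close>.\<close>

locale type_ring_hom =
  fixes f :: "'a::comm_ring_1 \<Rightarrow> 'b::comm_ring_1"
  assumes hom_one [simp]: "f 1 = 1"
    and hom_add [simp]: "f (a + b) = f a + f b"
    and hom_mult [simp]: "f (a * b) = f a * f b"
begin

lemma hom_zero [simp]: "f 0 = 0"
  using hom_add[of 0 0] by simp

lemma hom_uminus [simp]: "f (- a) = - f a"
  using hom_add[of a "- a"] by (simp add: eq_neg_iff_add_eq_0 add.commute)

lemma hom_diff [simp]: "f (a - b) = f a - f b"
  using hom_add[of a "- b"] by simp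

lemma hom_power [simp]: "f (a ^ n) = f a ^ n"
  by (induction n) auto

lemma hom_prod: "f (prod g A) = (\<Prod>x\<in>A. f (g x))"
  by (induction A rule: infinite_finite_induct) auto

text \<open>Needed for two coefficient rings: all of \<open>complex poly\<close> through
  \<open>\<iota>\<close>, and the constants through \<open>k\<close>. The second kind describes
  functions on a single fibre.\<close>

definition peval :: "'a poly \<Rightarrow> 'b \<Rightarrow> 'b" where
  "peval p y = poly (map_poly f p) y"

lemma peval_0 [simp]: "peval 0 y = 0"
  by (simp add: peval_def)

lemma peval_pCons [simp]: "peval (pCons a p) y = f a + y * peval p y"
  by (cases "p = 0 \<and> a = 0") (auto simp: peval_def map_poly_pCons)

lemma peval_1 [simp]: "peval 1 y = 1"
  using peval_pCons[of 1 0 y] by (simp del: peval_pCons add: one_pCons) 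

lemma peval_add: "peval (p + q) y = peval p y + peval q y"
proof (induction p arbitrary: q)
  case (pCons a p)
  obtain b r where "q = pCons b r" by (cases q) auto
  with pCons.IH[of r] show ?case by (simp add: algebra_simps)
qed auto

lemma peval_smult: "peval (Polynomial.smult a p) y = f a * peval p y"
  by (induction p) (auto simp: algebra_simps)

lemma peval_mult: "peval (p * q) y = peval p y * peval q y"
  by (induction p) (auto simp: algebra_simps peval_add peval_smult)

lemma peval_prod: "peval (prod g A) y = (\<Prod>x\<in>A. peval (g x) y)"
  by (induction A rule: infinite_finite_induct) (auto simp: peval_mult)

lemma peval_power: "peval (p ^ n) y = peval p y ^ n"
  by (induction n) (auto simp: peval_mult)

end

lemma peval_natural:
  assumes "type_ring_hom f" "type_ring_hom g" "type_ring_hom s" "\<And>a. s (f a) = g a"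
  shows "s (type_ring_hom.peval f p y) = type_ring_hom.peval g p (s y)"
proof -
  interpret f: type_ring_hom f by fact
  interpret g: type_ring_hom g by fact
  interpret s: type_ring_hom s by fact
  show ?thesis by (induction p) (auto simp: assms(4))
qed

locale type_subring =
  fixes C :: "'a::comm_ring_1 set"
  assumes one_mem [simp]: "1 \<in> C"
    and diff_mem: "a \<in> C \<Longrightarrow> b \<in> C \<Longrightarrow> a - b \<in> C"
    and mult_mem: "a \<in> C \<Longrightarrow> b \<in> C \<Longrightarrow> a * b \<in> C"
begin

lemma zero_mem [simp]: "0 \<in> C" using diff_mem[of 1 1] by simp
lemma uminus_mem: "a \<in> C \<Longrightarrow> - a \<in> C" using diff_mem[of 0 a] by simp
lemma add_mem: "a \<in> C \<Longrightarrow> b \<in> C \<Longrightarrow> a + b \<in> C" using diff_mem[of a "- b"] uminus_mem by simp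
lemma power_mem: "a \<in> C \<Longrightarrow> a ^ n \<in> C" by (induction n) (auto intro: mult_mem)
lemma prod_mem: "(\<And>x. x \<in> A \<Longrightarrow> g x \<in> C) \<Longrightarrow> prod g A \<in> C"
  by (induction A rule: infinite_finite_induct) (auto intro: mult_mem)
lemma sum_mem: "(\<And>x. x \<in> A \<Longrightarrow> g x \<in> C) \<Longrightarrow> sum g A \<in> C"
  by (induction A rule: infinite_finite_induct) (auto intro: add_mem)

lemmas mems = one_mem zero_mem diff_mem mult_mem uminus_mem add_mem power_mem prod_mem

end

text \<open>The ring \<open>\<complex>[h]\<close> inside \<open>'r\<close>; \<open>D\<close> plays the role of \<open>\<partial>/\<partial>X\<^sub>0\<close>.\<close>

locale Ch_derivation = type_ring_hom \<iota> for \<iota> :: "complex poly \<Rightarrow> 'r::idom" +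
  fixes D :: "'r \<Rightarrow> 'r"
  assumes D_add: "\<And>a b. D (a + b) = D a + D b"
    and D_mult: "\<And>a b. D (a * b) = D a * b + a * D b"
    and D_const: "\<And>a. D (\<iota> a) = 0"
    and h_nz: "\<iota> [:0, 1:] \<noteq> 0"
begin

definition h :: 'r where "h = \<iota> [:0, 1:]"
definition k :: "complex \<Rightarrow> 'r" where "k c = \<iota> [:c:]"

lemma h_neq_0 [simp]: "h \<noteq> 0" using h_nz by (simp add: h_def)

sublocale k: type_ring_hom k
  by unfold_locales (auto simp: k_def hom_add[symmetric] hom_mult[symmetric] mult.commute simp flip: one_pCons)

lemma D_0 [simp]: "D 0 = 0" using D_const[of 0] by simp
lemma D_1 [simp]: "D 1 = 0" using D_const[of 1] by simp
lemma D_h [simp]: "D h = 0" using D_const by (simp add: h_def)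
lemma D_k [simp]: "D (k c) = 0" using D_const by (simp add: k_def)
lemma D_diff: "D (a - b) = D a - D b" using D_add[of "a - b" b] by (simp add: algebra_simps)
lemma D_h_mult: "D (h * a) = h * D a" by (simp add: D_mult)
lemma D_h_power: "D (h ^ n * a) = h ^ n * D a"
  by (induction n) (auto simp: D_mult)

lemma D_peval: "D (k.peval p y) = k.peval (pderiv p) y * D y"
  by (induction p) (auto simp: D_add D_mult pderiv_pCons k.peval_add algebra_simps)

text \<open>With \<open>F\<close> the labels of the children of a node, possibly without one of
  them, this is the value of \<open>S_poly\<close>.\<close>

definition lin :: "'r \<Rightarrow> complex set \<Rightarrow> 'r" where
  "lin y F = (\<Prod>c\<in>F. y - k c)"

lemma lin_empty [simp]: "lin y {} = 1" by (simp add: lin_def)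

lemma lin_remove: "finite F \<Longrightarrow> c \<in> F \<Longrightarrow> lin y F = (y - k c) * lin y (F - {c})"
  unfolding lin_def by (rule prod.remove)

lemma lin_peval: "lin y F = k.peval (\<Prod>c\<in>F. [:- c, 1:]) y"
  by (simp add: lin_def k.peval_prod)

end

section \<open>Functions and derivatives along one component of the fibre
  \<open>h = 0\<close>\<close>

locale Ch_sub = Ch_derivation \<iota> D + type_subring C
  for \<iota> :: "complex poly \<Rightarrow> 'a::idom" and D and C :: "'a set" +
  assumes \<iota>_mem [simp]: "\<iota> a \<in> C"
begin

lemma h_mem [simp]: "h \<in> C" by (simp add: h_def)
lemma k_mem [simp]: "k c \<in> C" by (simp add: k_def)

lemma lin_mem: "y \<in> C \<Longrightarrow> lin y F \<in> C"
  unfolding lin_def by (auto intro!: mems)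

lemma peval_mem: "y \<in> C \<Longrightarrow> k.peval p y \<in> C"
  by (induction p) (auto intro!: mems)

text \<open>Elements that are invertible along the component of the fibre \<open>h = 0\<close> on which \<open>r\<close> lives.\<close>

definition units_at :: "'a \<Rightarrow> 'a set" where
  "units_at r = {u \<in> C. \<exists>g w. g \<noteq> 0 \<and> w \<in> C \<and> u * r = k g * r + h * w}"

lemma units_atI: "u \<in> C \<Longrightarrow> g \<noteq> 0 \<Longrightarrow> w \<in> C \<Longrightarrow> u * r = k g * r + h * w \<Longrightarrow> u \<in> units_at r"
  by (auto simp: units_at_def)

lemma units_atE:
  assumes "u \<in> units_at r"
  obtains g w where "u \<in> C" "g \<noteq> 0" "w \<in> C" "u * r = k g * r + h * w"
  using assms by (auto simp: units_at_def)

lemma units_at_sub: "u \<in> units_at r \<Longrightarrow> u \<in> C" by (simp add: units_at_def)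

lemma units_at_1: "1 \<in> units_at r"
  by (rule units_atI[of _ 1 0]) auto

lemma units_at_mult:
  assumes "u \<in> units_at r" "v \<in> units_at r"
  shows "u * v \<in> units_at r"
proof -
  obtain g w where u: "u \<in> C" "g \<noteq> 0" "w \<in> C" "u * r = k g * r + h * w" using assms(1) by (rule units_atE)
  obtain g' w' where v: "v \<in> C" "g' \<noteq> 0" "w' \<in> C" "v * r = k g' * r + h * w'" using assms(2) by (rule units_atE)
  have "u * v * r = u * (v * r)" by (simp add: mult_ac)
  also have "\<dots> = k g' * (u * r) + h * (u * w')" unfolding v(4) by (simp add: algebra_simps)
  also have "\<dots> = k (g * g') * r + h * (k g' * w + u * w')"
    unfolding u(4) by (simp add: algebra_simps)
  finally show ?thesis
    by (rule units_atI[rotated 3]) (use u v in \<open>auto intro!: mems\<close>)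
qed

lemma units_at_prod: "(\<And>x. x \<in> A \<Longrightarrow> g x \<in> units_at r) \<Longrightarrow> prod g A \<in> units_at r"
  by (induction A rule: infinite_finite_induct) (auto intro: units_at_mult units_at_1)

lemma units_at_power: "u \<in> units_at r \<Longrightarrow> u ^ n \<in> units_at r"
  by (induction n) (auto intro: units_at_mult units_at_1)

lemma units_at_add_h:
  assumes "u \<in> units_at r" "w \<in> C" "r \<in> C"
  shows "u + h * w \<in> units_at r"
proof -
  obtain g w' where u: "u \<in> C" "g \<noteq> 0" "w' \<in> C" "u * r = k g * r + h * w'" using assms(1) by (rule units_atE)
  show ?thesis
    by (rule units_atI[of _ g "w' + w * r"]) (use u assms in \<open>auto intro!: mems simp: algebra_simps\<close>)
qed

lemma units_at_mono:
  assumes "u \<in> units_at r" "m \<in> C"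
  shows "u \<in> units_at (m * r)"
proof -
  obtain g w where u: "u \<in> C" "g \<noteq> 0" "w \<in> C" "u * r = k g * r + h * w" using assms(1) by (rule units_atE)
  have "u * (m * r) = m * (u * r)" by (simp add: mult_ac)
  also have "\<dots> = k g * (m * r) + h * (m * w)" unfolding u(4) by (simp add: algebra_simps)
  finally show ?thesis by (rule units_atI[rotated 3]) (use u assms in \<open>auto intro!: mems\<close>)
qed

text \<open>Modulo \<open>h\<close>, \<open>u * r\<close> is \<open>k g * r\<close>, and the nonzero
  constant \<open>g\<close> is invertible already in \<open>C\<close>. So \<open>u\<close> can be
  cancelled without localising.\<close>

lemma units_at_cancel:
  assumes u: "u \<in> units_at r" and z: "z \<in> C" and w: "w \<in> C" "u * r * z = h * w"
  shows "\<exists>v\<in>C. r * z = h * v"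
proof -
  obtain g w' where u: "u \<in> C" "g \<noteq> 0" "w' \<in> C" "u * r = k g * r + h * w'" using u by (rule units_atE)
  have 1: "k (inverse g) * k g = 1" using u(2) by (simp flip: k.hom_mult)
  have "k g * (r * z) = h * (w - w' * z)"
    using w(2) unfolding u(4) by (simp add: algebra_simps)
  hence "k (inverse g) * k g * (r * z) = h * (k (inverse g) * (w - w' * z))"
    by (simp add: mult_ac)
  thus ?thesis unfolding 1 using u z w by (auto intro!: bexI[of _ "k (inverse g) * (w - w' * z)"] mems)
qed

text \<open>By hypothesis \<open>y\<close> has the value \<open>c\<close> where \<open>r\<close>
  lives, so \<open>y - k c'\<close> is the nonzero constant \<open>c - c'\<close> there.\<close>

lemma units_at_shift:
  assumes "y \<in> C" "w \<in> C" "(y - k c) * r = h * w" "c \<noteq> c'"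
  shows "y - k c' \<in> units_at r"
proof (rule units_atI)
  have "(y - k c') * r = k (c - c') * r + (y - k c) * r" by (simp add: algebra_simps)
  thus "(y - k c') * r = k (c - c') * r + h * w" using assms(3) by simp
qed (use assms in \<open>auto intro!: mems\<close>)

text \<open>Where \<open>r\<close> lives, the derivative of \<open>y\<close> is \<open>h\<^sup>-\<^sup>d\<close> times a unit.\<close>

definition chainok :: "nat \<Rightarrow> 'a \<Rightarrow> 'a \<Rightarrow> bool" where
  "chainok d y r \<longleftrightarrow> y \<in> C \<and> r \<in> C \<and> r \<in> units_at r \<and>
     (\<exists>u\<in>units_at r. u * h ^ d * D y \<in> units_at r \<and> u * h ^ d * D r \<in> C)"

lemma chainok_0: "y \<in> C \<Longrightarrow> D y = 1 \<Longrightarrow> chainok 0 y 1"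
  unfolding chainok_def by (auto intro!: bexI[of _ 1] units_at_1)

lemma D_lin:
  assumes "y \<in> C" shows "\<exists>m\<in>C. D (lin y F) = m * D y"
  unfolding lin_peval D_peval using assms peval_mem by blast

text \<open>Descent to the child labelled \<open>c\<close>. Differentiating
  \<open>h * y' = (y - k c) * r'\<close>, with \<open>y\<close> equal to \<open>c\<close> where
  \<open>r'\<close> lives, leaves \<open>h * D y'\<close> equal to \<open>D y * r'\<close> up to a
  term that vanishes there. One more power of \<open>h\<close> thus enters the denominator.\<close>

lemma chainok_step:
  assumes ok: "chainok d y r" and F: "finite F" "c \<in> F" and y': "y' \<in> C" "h * y' = lin y F * r"
  shows "chainok (Suc d) y' (lin y (F - {c}) * r)"
proof -
  define m where "m = lin y (F - {c})"
  define r' where "r' = m * r"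
  note m' = m_def[symmetric] r'_def[symmetric]
  have y: "y \<in> C" and r: "r \<in> C" "r \<in> units_at r" using ok by (auto simp: chainok_def)
  obtain v where v: "v \<in> units_at r" "v * h ^ d * D y \<in> units_at r" "v * h ^ d * D r \<in> C"
    using ok by (auto simp: chainok_def)
  have mC: "m \<in> C" using y lin_mem by (simp add: m_def)
  have r'C: "r' \<in> C" using mC r by (auto simp: r'_def intro: mems)
  have hy': "h * y' = (y - k c) * r'"
    using y'(2) lin_remove[OF F, of y] by (simp add: m_def r'_def mult_ac)
  have mono: "u \<in> units_at r'" if "u \<in> units_at r" for u
    unfolding r'_def using units_at_mono[OF that mC] .
  have "m \<in> units_at r'"
    unfolding m_def lin_def
    by (intro units_at_prod units_at_shift[OF y y'(1)]) (use hy' in auto)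
  hence r'u: "r' \<in> units_at r'" using mono[OF r(2)] by (subst r'_def) (rule units_at_mult)
  define u' where "u' = v * h ^ d * D y"
  define b where "b = v * h ^ d * D r"
  obtain m1 where m1: "m1 \<in> C" "D m = m1 * D y" using D_lin[OF y] unfolding m_def by blast
  define w where "w = m1 * u' * r + m * b"
  have u': "u' \<in> units_at r'" using v(2) mono by (simp add: u'_def)
  have wC: "w \<in> C" using m1 u' units_at_sub r mC v(3) by (auto simp: w_def b_def intro!: mems)
  have Dr': "v * h ^ d * D r' = w"
    by (simp add: r'_def D_mult m1 w_def u'_def b_def algebra_simps)
  have "h * D y' = D y * r' + (y - k c) * D r'"
    using arg_cong[OF hy', of D] by (simp add: D_mult D_diff)
  hence "v * h ^ d * (h * D y') = v * h ^ d * (D y * r' + (y - k c) * D r')" by simp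
  hence "v * h ^ Suc d * D y' = u' * r' + (y - k c) * (v * h ^ d * D r')"
    by (simp add: u'_def algebra_simps)
  \<comment> \<open>The extra factor \<open>r'\<close> turns the unwanted term
    \<open>(y - k c) * w\<close> into \<open>h * (y' * w)\<close>; it is harmless because
    \<open>r'\<close> is itself a unit on its own component.\<close>
  hence "r' * (v * h ^ Suc d * D y') = r' * (u' * r' + (y - k c) * w)" by (simp only: Dr')
  also have "\<dots> = u' * r' * r' + h * (y' * w)"
  proof -
    have "h * (y' * w) = (y - k c) * r' * w" by (subst hy'[symmetric]) (simp add: mult_ac)
    thus ?thesis by (simp add: algebra_simps)
  qed
  finally have 1: "(r' * v) * h ^ Suc d * D y' = u' * r' * r' + h * (y' * w)" by (simp add: mult_ac)
  have 2: "(r' * v) * h ^ Suc d * D y' \<in> units_at r'"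
    unfolding 1 by (intro units_at_add_h units_at_mult u' r'u r'C mems y' wC)
  have "(r' * v) * h ^ Suc d * D r' = r' * h * w"
    by (subst Dr'[symmetric]) (simp add: mult_ac)
  moreover have "r' * h * w \<in> C" using r'C wC by (intro mems h_mem)
  ultimately have 3: "(r' * v) * h ^ Suc d * D r' \<in> C" by (simp only:)
  show ?thesis unfolding chainok_def m'
    using y' r'C r'u units_at_mult[OF r'u mono[OF v(1)]] 2 3 by blast
qed

text \<open>If \<open>d > N\<close>, the element \<open>u * h ^ d * D y\<close> would be a unit
  where \<open>r\<close> lives and also a multiple of \<open>h\<close> in \<open>C\<close>;
  cancelling it would put \<open>r\<close> into \<open>h * C\<close>.\<close>

lemma chainok_depth:
  assumes ok: "chainok d y r" and N: "\<And>b. b \<in> C \<Longrightarrow> h ^ N * D b \<in> C" and r: "\<And>w. w \<in> C \<Longrightarrow> r \<noteq> h * w"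
  shows "d \<le> N"
proof (rule ccontr)
  assume "\<not> d \<le> N"
  then obtain j where j: "d = Suc (N + j)" using less_imp_Suc_add[of N d] by auto
  obtain u where u: "u \<in> units_at r" "u * h ^ d * D y \<in> units_at r" and C: "y \<in> C" "r \<in> C"
    using ok by (auto simp: chainok_def)
  have "(u * h ^ d * D y) * r * 1 = h * (u * h ^ j * (h ^ N * D y) * r)"
    by (simp add: j power_add mult_ac)
  moreover have "u * h ^ j * (h ^ N * D y) * r \<in> C"
    by (intro mems h_mem N C units_at_sub[OF u(1)])
  ultimately show False using units_at_cancel[OF u(2) one_mem] r by fastforce
qed

end

section \<open>Polynomials in the variables of a tree\<close>

lemma poly_mapping_add_induct [case_names zero single add]:
  fixes p :: "'a \<Rightarrow>\<^sub>0 'b::comm_monoid_add"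
  assumes "P 0" "\<And>m a. P (Poly_Mapping.single m a)" "\<And>p q. P p \<Longrightarrow> P q \<Longrightarrow> P (p + q)"
  shows "P p"
proof (induction p rule: update_induct)
  case const
  show ?case by (rule assms(1))
next
  case (update f m a)
  have "Poly_Mapping.update m a f = f + Poly_Mapping.single m a"
    using update by (intro poly_mapping_eqI)
      (auto simp: lookup_update lookup_add lookup_single when_def in_keys_iff)
  thus ?case using update assms by simp
qed

definition monom_eval :: "('v \<Rightarrow> 'r::comm_ring_1) \<Rightarrow> ('v \<Rightarrow>\<^sub>0 nat) \<Rightarrow> 'r" where
  "monom_eval \<xi> m = (\<Prod>v\<in>Poly_Mapping.keys m. \<xi> v ^ Poly_Mapping.lookup m v)"

definition poly_eval ::
  "(complex poly \<Rightarrow> 'r::comm_ring_1) \<Rightarrow> ('v \<Rightarrow> 'r) \<Rightarrow> (('v \<Rightarrow>\<^sub>0 nat) \<Rightarrow>\<^sub>0 complex poly) \<Rightarrow> 'r" where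
  "poly_eval \<iota> \<xi> p = (\<Sum>m\<in>Poly_Mapping.keys p. \<iota> (Poly_Mapping.lookup p m) * monom_eval \<xi> m)"

lemma monom_eval_superset:
  assumes "finite S" "Poly_Mapping.keys m \<subseteq> S"
  shows "monom_eval \<xi> m = (\<Prod>v\<in>S. \<xi> v ^ Poly_Mapping.lookup m v)"
  unfolding monom_eval_def by (rule prod.mono_neutral_left) (use assms in \<open>auto simp: in_keys_iff\<close>)

lemma monom_eval_add: "monom_eval \<xi> (m + n) = monom_eval \<xi> m * monom_eval \<xi> n"
proof -
  let ?S = "Poly_Mapping.keys m \<union> Poly_Mapping.keys n"
  have "monom_eval \<xi> (m + n) = (\<Prod>v\<in>?S. \<xi> v ^ Poly_Mapping.lookup (m + n) v)"
    by (rule monom_eval_superset) (use Poly_Mapping.keys_add[of m n] in auto)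
  also have "\<dots> = monom_eval \<xi> m * monom_eval \<xi> n"
    by (simp add: monom_eval_superset[of ?S] lookup_add power_add prod.distrib)
  finally show ?thesis .
qed

lemma poly_eval_superset:
  assumes "type_ring_hom f" "finite S" "Poly_Mapping.keys p \<subseteq> S"
  shows "poly_eval f \<xi> p = (\<Sum>m\<in>S. f (Poly_Mapping.lookup p m) * monom_eval \<xi> m)"
proof -
  interpret f: type_ring_hom f by fact
  show ?thesis
    unfolding poly_eval_def by (rule sum.mono_neutral_left) (use assms in \<open>auto simp: in_keys_iff\<close>)
qed

lemma poly_eval_add:
  assumes "type_ring_hom f"
  shows "poly_eval f \<xi> (p + q) = poly_eval f \<xi> p + poly_eval f \<xi> q"
proof -
  interpret f: type_ring_hom f by fact
  let ?S = "Poly_Mapping.keys p \<union> Poly_Mapping.keys q"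
  have "poly_eval f \<xi> (p + q) = (\<Sum>m\<in>?S. f (Poly_Mapping.lookup (p + q) m) * monom_eval \<xi> m)"
    by (rule poly_eval_superset[OF assms]) (use Poly_Mapping.keys_add[of p q] in auto)
  also have "\<dots> = poly_eval f \<xi> p + poly_eval f \<xi> q"
    by (simp add: poly_eval_superset[OF assms, of ?S] lookup_add distrib_right sum.distrib)
  finally show ?thesis .
qed

lemma poly_eval_single:
  assumes "type_ring_hom f"
  shows "poly_eval f \<xi> (Poly_Mapping.single m a) = f a * monom_eval \<xi> m"
proof -
  interpret f: type_ring_hom f by fact
  show ?thesis by (simp add: poly_eval_superset[OF assms, of "{m}"] keys_single)
qed

lemma poly_eval_mult:
  assumes "type_ring_hom f"
  shows "poly_eval f \<xi> (p * q) = poly_eval f \<xi> p * poly_eval f \<xi> q"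
proof (induction p rule: poly_mapping_add_induct)
  case (single m a)
  interpret f: type_ring_hom f by fact
  show ?case
    by (induction q rule: poly_mapping_add_induct)
       (simp_all add: poly_eval_add[OF assms] poly_eval_single[OF assms] mult_single
          monom_eval_add algebra_simps, simp add: poly_eval_def)
qed (simp_all add: poly_eval_add[OF assms] distrib_right, simp add: poly_eval_def)

lemma poly_eval_Const [simp]: "type_ring_hom f \<Longrightarrow> poly_eval f \<xi> (Const a) = f a"
  by (simp add: Const_def poly_eval_single monom_eval_def)

lemma poly_eval_Var [simp]: 
  assumes "type_ring_hom f" shows "poly_eval f \<xi> (Var v) = \<xi> v"
proof -
  interpret f: type_ring_hom f by fact
  show ?thesis by (simp add: Var_def poly_eval_single[OF assms] monom_eval_def keys_single)
qed

lemma type_ring_hom_poly_eval: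
  assumes "type_ring_hom f" shows "type_ring_hom (poly_eval f \<xi>)"
proof
  interpret f: type_ring_hom f by fact
  show "poly_eval f \<xi> 1 = 1"
    using poly_eval_single[OF assms, of \<xi> 0 1] by (simp add: monom_eval_def)
qed (simp_all add: assms poly_eval_add poly_eval_mult)

lemma type_ring_hom_Const: "type_ring_hom Const"
  by unfold_locales (simp_all add: Const_def single_add mult_single single_one)

text \<open>Generated inductively, not described by supports as in \<open>tree_poly_ring\<close>, so
  that statements about polynomials follow by rule induction. Smaller sets \<open>E\<close> belong
  to truncated trees.\<close>

inductive_set gen :: "'n set \<Rightarrow> 'n tree_poly set" for E where
  gen_Const: "Const a \<in> gen E"
| gen_None: "Var None \<in> gen E"
| gen_Some: "e \<in> E \<Longrightarrow> Var (Some e) \<in> gen E"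
| gen_add: "p \<in> gen E \<Longrightarrow> q \<in> gen E \<Longrightarrow> p + q \<in> gen E"
| gen_mult: "p \<in> gen E \<Longrightarrow> q \<in> gen E \<Longrightarrow> p * q \<in> gen E"

lemma gen_mono:
  assumes "E \<subseteq> E'" shows "gen E \<subseteq> gen E'"
proof
  show "p \<in> gen E'" if "p \<in> gen E" for p
    using that by induction (use assms in \<open>auto intro: gen.intros\<close>)
qed

lemma type_subring_gen: "type_subring (gen E)"
proof
  interpret C: type_ring_hom Const by (rule type_ring_hom_Const)
  show 1: "1 \<in> gen E" using gen_Const[of 1 E] by simp
  show "p - q \<in> gen E" if "p \<in> gen E" "q \<in> gen E" for p q
  proof -
    have "p - q = p + Const (- 1) * q" by (simp del: C.hom_uminus add: C.hom_uminus)
    moreover have "p + Const (- 1) * q \<in> gen E" using that by (intro gen.intros)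
    ultimately show ?thesis by simp
  qed
qed (auto intro: gen_mult)

lemma tree_poly_ring_eq_gen: "carrier (tree_poly_ring T) = gen (parents T)"
proof (intro equalityI subsetI)
  interpret G: type_subring "gen (parents T)" by (rule type_subring_gen)
  fix p :: "'a tree_poly" assume p: "p \<in> carrier (tree_poly_ring T)"
  have mon: "Poly_Mapping.single m 1 \<in> gen (parents T)"
    if "Poly_Mapping.keys m \<subseteq> insert None (Some ` parents T)" for m
    using that
  proof (induction m rule: update_induct)
    case const
    thus ?case by simp
  next
    case (update m v n)
    have eq: "Poly_Mapping.update v n m = m + Poly_Mapping.single v n"
      using update by (intro poly_mapping_eqI)
        (auto simp: lookup_update lookup_add lookup_single when_def in_keys_iff)
    have v: "v \<in> insert None (Some ` parents T)" "Poly_Mapping.keys m \<subseteq> insert None (Some ` parents T)"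
      using update.prems update.hyps by (auto simp: keys_update)
    have "Var v \<in> gen (parents T)" using v by (auto intro: gen.intros)
    moreover have "Poly_Mapping.single (Poly_Mapping.single v n) 1 = Var v ^ n"
    proof (induction n)
      case (Suc n)
      have "Poly_Mapping.single v (Suc n) = Poly_Mapping.single v 1 + Poly_Mapping.single v n"
        by (simp flip: single_add)
      hence "Poly_Mapping.single (Poly_Mapping.single v (Suc n)) 1 =
          Var v * Poly_Mapping.single (Poly_Mapping.single v n) (1 :: complex poly)"
        by (simp only: Var_def mult_single mult_1)
      thus ?case by (simp only: Suc.IH power_Suc)
    qed auto
    ultimately have "Poly_Mapping.single (Poly_Mapping.single v n) 1 \<in> gen (parents T)"
      by (simp add: G.power_mem)
    moreover have "Poly_Mapping.single (Poly_Mapping.update v n m) 1 =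
        Poly_Mapping.single m 1 * Poly_Mapping.single (Poly_Mapping.single v n) (1 :: complex poly)"
      by (simp add: eq mult_single)
    ultimately show ?case using update.IH[OF v(2)] by (simp add: G.mult_mem)
  qed
  show "p \<in> gen (parents T)"
    using p
  proof (induction p rule: update_induct)
    case const
    show ?case by simp
  next
    case (update q m a)
    have eq: "Poly_Mapping.update m a q = q + Const a * Poly_Mapping.single m 1"
      using update by (intro poly_mapping_eqI)
        (auto simp: lookup_update lookup_add lookup_single when_def in_keys_iff Const_def mult_single)
    have "Poly_Mapping.keys m \<subseteq> insert None (Some ` parents T)" "q \<in> carrier (tree_poly_ring T)"
      using update.prems update.hyps by (auto simp: tree_poly_ring_def keys_update)
    thus ?case unfolding eq using update.IH mon by (auto intro: gen.intros)
  qed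
next
  fix p :: "'a tree_poly" assume "p \<in> gen (parents T)"
  thus "p \<in> carrier (tree_poly_ring T)"
    by induction (auto intro!: tree_poly_ring_closed Var_in_tree_poly_ring)
qed

text \<open>Provides the degree in the last variable \<open>X_f\<close>, on which the elimination in
  \<open>kernel_insert\<close> runs.\<close>

lemma gen_insert:
  assumes "p \<in> gen (insert f E)"
  shows "\<exists>q. (\<forall>i. Polynomial.coeff q i \<in> gen E) \<and> p = poly q (Var (Some f))"
  using assms
proof induction
  interpret G: type_subring "gen E" by (rule type_subring_gen)
  have const: "\<exists>q. (\<forall>i. Polynomial.coeff q i \<in> gen E) \<and> a = poly q (Var (Some f))" if "a \<in> gen E" for a
    by (rule exI[of _ "[:a:]"]) (use that in \<open>auto simp: coeff_pCons split: nat.splits\<close>)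
  {
    case (gen_Const a)
    show ?case by (intro const gen.intros)
  next
    case gen_None
    show ?case by (intro const gen.intros)
  next
    case (gen_Some e)
    show ?case
    proof (cases "e = f")
      case True
      thus ?thesis by (intro exI[of _ "[:0, 1:]"]) (auto simp: coeff_pCons split: nat.splits)
    qed (use gen_Some in \<open>auto intro: const gen.intros\<close>)
  next
    case (gen_add p q)
    then obtain p' q' where "\<forall>i. Polynomial.coeff p' i \<in> gen E" "p = poly p' (Var (Some f))"
      "\<forall>i. Polynomial.coeff q' i \<in> gen E" "q = poly q' (Var (Some f))" by blast
    thus ?case by (intro exI[of _ "p' + q'"]) (auto intro: G.add_mem)
  next
    case (gen_mult p q)
    then obtain p' q' where "\<forall>i. Polynomial.coeff p' i \<in> gen E" "p = poly p' (Var (Some f))"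
      "\<forall>i. Polynomial.coeff q' i \<in> gen E" "q = poly q' (Var (Some f))" by blast
    thus ?case
      by (intro exI[of _ "p' * q'"]) (auto simp: Polynomial.coeff_mult intro!: G.sum_mem G.mult_mem)
  }
qed

section \<open>Ancestors, branching and the ideal of a labelled tree\<close>

locale labelled_rooted_tree =
  fixes T :: "('n, 'z) labelled_tree_scheme"
  assumes fine: "fine_labelled_tree T"
begin

lemma rooted: "rooted_tree T" using fine by (simp add: fine_labelled_tree_def)

lemma partial_order: "partial_order_on (nodes T) (tree_le T)" and finite_nodes: "finite (nodes T)"
  using rooted by (simp_all add: rooted_tree_def)

lemma le_trans: "(x, y) \<in> tree_le T \<Longrightarrow> (y, z) \<in> tree_le T \<Longrightarrow> (x, z) \<in> tree_le T"
  by (rule transD[OF partial_order_onD(2)[OF partial_order]])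

lemma le_antisym: "(x, y) \<in> tree_le T \<Longrightarrow> (y, x) \<in> tree_le T \<Longrightarrow> x = y"
  by (rule antisymD[OF partial_order_onD(3)[OF partial_order]])

lemma le_refl: "x \<in> nodes T \<Longrightarrow> (x, x) \<in> tree_le T"
  by (rule refl_onD[OF partial_order_onD(1)[OF partial_order]])

lemma le_nodes: "(x, y) \<in> tree_le T \<Longrightarrow> x \<in> nodes T \<and> y \<in> nodes T"
  using partial_order_onD(4)[OF partial_order] by auto

lemma le_linear:
  assumes "(x, e) \<in> tree_le T" "(y, e) \<in> tree_le T"
  shows "(x, y) \<in> tree_le T \<or> (y, x) \<in> tree_le T"
proof -
  have "x \<in> down T e" "y \<in> down T e" "e \<in> nodes T" using assms le_nodes by (auto simp: down_def)
  thus ?thesis using rooted by (simp add: rooted_tree_def)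
qed

lemma root_node: "tree_root T \<in> nodes T"
proof -
  obtain e where "e \<in> nodes T" using rooted by (auto simp: rooted_tree_def)
  thus ?thesis using le_nodes[OF root_least[OF rooted]] by blast
qed

lemma down_iff: "x \<in> down T e \<longleftrightarrow> (x, e) \<in> tree_le T"
  using le_nodes by (auto simp: down_def)

lemma anc_iff: "x \<in> anc T e \<longleftrightarrow> (x, e) \<in> tree_le T \<and> x \<noteq> e"
  by (auto simp: anc_def down_iff)

lemma finite_anc: "finite (anc T e)"
  using finite_nodes by (rule finite_subset[rotated]) (auto simp: anc_def down_def)

lemma anc_trans: "x \<in> anc T y \<Longrightarrow> y \<in> anc T z \<Longrightarrow> x \<in> anc T z"
  unfolding anc_iff using le_trans le_antisym by blast

lemma not_anc_self: "e \<notin> anc T e" by (simp add: anc_iff)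

lemma anc_nodes: "x \<in> anc T e \<Longrightarrow> x \<in> nodes T \<and> e \<in> nodes T"
  unfolding anc_iff using le_nodes by blast

lemma anc_parents: "x \<in> anc T e \<Longrightarrow> x \<in> parents T"
  using le_nodes by (auto simp: anc_iff parents_def leaves_def maximal_in_def)

lemma anc_card: "x \<in> anc T y \<Longrightarrow> card (anc T x) < card (anc T y)"
  by (rule psubset_card_mono[OF finite_anc]) (use anc_trans not_anc_self in blast)

lemma anc_root: "anc T (tree_root T) = {}"
proof -
  have "x = tree_root T" if "(x, tree_root T) \<in> tree_le T" for x
    using le_antisym[OF that] root_least[OF rooted] le_nodes[OF that] by blast
  thus ?thesis by (auto simp: anc_iff)
qed

lemma root_anc: "e \<in> nodes T \<Longrightarrow> e \<noteq> tree_root T \<Longrightarrow> tree_root T \<in> anc T e"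
  using root_least[OF rooted] by (auto simp: anc_iff)

lemma par_anc: "e \<in> nodes T \<Longrightarrow> e \<noteq> tree_root T \<Longrightarrow> par T e \<in> anc T e"
  by (rule par_greatest(1)[OF rooted])

lemma anc_par:
  assumes "e \<in> nodes T" "e \<noteq> tree_root T"
  shows "anc T e = insert (par T e) (anc T (par T e))"
proof (intro equalityI subsetI)
  fix x assume "x \<in> anc T e"
  hence "(x, par T e) \<in> tree_le T" by (rule par_greatest(2)[OF rooted assms])
  thus "x \<in> insert (par T e) (anc T (par T e))" by (simp add: anc_iff)
next
  fix x assume "x \<in> insert (par T e) (anc T (par T e))"
  thus "x \<in> anc T e" using par_anc[OF assms] anc_trans by blast
qed

lemma card_anc_par:
  assumes "e \<in> nodes T" "e \<noteq> tree_root T"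
  shows "card (anc T e) = Suc (card (anc T (par T e)))"
  unfolding anc_par[OF assms] using finite_anc not_anc_self by simp

lemma tree_induct [consumes 1, case_names root par]:
  assumes "e \<in> nodes T" "P (tree_root T)"
    and "\<And>e. e \<in> nodes T \<Longrightarrow> e \<noteq> tree_root T \<Longrightarrow> P (par T e) \<Longrightarrow> P e"
  shows "P e"
  using assms(1)
proof (induction "card (anc T e)" arbitrary: e rule: less_induct)
  case less
  show ?case
  proof (cases "e = tree_root T")
    case False
    hence p: "par T e \<in> anc T e" using less par_anc by blast
    hence "P (par T e)" using less(1)[OF anc_card[OF p]] anc_nodes by blast
    thus ?thesis using assms(3) less False by blast
  qed (simp add: assms(2))
qed

lemmas child_iff' = child_iff[OF rooted]

lemma finite_child: "finite (child T e)"
  using finite_nodes by (rule finite_subset[rotated]) (auto simp: child_iff')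

lemma inj_lb_child: "inj_on (lb T) (child T e)"
proof (rule inj_onI, rule ccontr)
  fix x y assume "x \<in> child T e" "y \<in> child T e" "lb T x = lb T y" "x \<noteq> y"
  moreover from this have "x \<in> nodes T - {tree_root T}" "y \<in> nodes T - {tree_root T}" "par T x = par T y"
    by (simp_all add: child_iff')
  ultimately show False using fine by (simp add: fine_labelled_tree_def)
qed

lemma child_anc: "c \<in> child T e \<Longrightarrow> e \<in> anc T c"
  using par_anc by (auto simp: child_iff')

lemma child_below:
  assumes "e' \<in> anc T e"
  shows "child_below T e' e \<in> child T e'" "(child_below T e' e, e) \<in> tree_le T"
  using child_below_props[OF rooted _ assms] anc_nodes[OF assms] by (auto simp: down_iff)

lemma child_below_unique:
  assumes "c \<in> child T e'" "(c, e) \<in> tree_le T"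
  shows "child_below T e' e = c"
proof -
  have e': "e' \<in> anc T c" by (rule child_anc[OF assms(1)])
  hence e: "e' \<in> anc T e" using assms(2) anc_trans[of e' c e] by (cases "c = e") (auto simp: anc_iff)
  note b = child_below[OF e]
  have *: "x = y" if "x \<in> child T e'" "y \<in> child T e'" "(x, y) \<in> tree_le T" for x y
    using that child_anc[OF that(1)] le_nodes by (auto simp: child_def minimal_in_def anc_iff)
  show ?thesis
    using le_linear[OF b(2) assms(2)] *[OF b(1) assms(1)] *[OF assms(1) b(1)] by auto
qed

text \<open>The last common ancestor, found as the one with the most ancestors. If the paths to
  \<open>a\<close> and \<open>f\<close> left it through the same child, that child would be a later
  common ancestor, as neither of \<open>a\<close> and \<open>f\<close> lies above the other.\<close>

lemma branch_point:
  assumes "a \<in> nodes T" "f \<in> nodes T" "a \<noteq> f" "a \<notin> anc T f" "f \<notin> anc T a"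
  obtains e where "e \<in> anc T a" "e \<in> anc T f" "child_below T e a \<noteq> child_below T e f"
proof -
  let ?M = "anc T a \<inter> anc T f"
  have "a \<noteq> tree_root T" "f \<noteq> tree_root T" using assms root_anc by metis+
  hence "tree_root T \<in> ?M" using root_anc assms by simp
  moreover have "finite ?M" using finite_anc by blast
  ultimately have "Max ((\<lambda>y. card (anc T y)) ` ?M) \<in> (\<lambda>y. card (anc T y)) ` ?M"
    by (intro Max_in) auto
  then obtain e where e: "e \<in> ?M" "Max ((\<lambda>y. card (anc T y)) ` ?M) = card (anc T e)" by auto
  have max: "card (anc T y) \<le> card (anc T e)" if "y \<in> ?M" for y
    unfolding e(2)[symmetric] using that \<open>finite ?M\<close> by (intro Max_ge) auto
  have "child_below T e a \<noteq> child_below T e f"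
  proof
    assume eq: "child_below T e a = child_below T e f" (is "?c = _")
    have c: "?c \<in> child T e" "(?c, a) \<in> tree_le T" "(?c, f) \<in> tree_le T"
      using child_below[of e a] child_below[of e f] e(1) eq by auto
    have "?c \<noteq> a" "?c \<noteq> f" using c assms by (auto simp: anc_iff)
    hence "?c \<in> ?M" using c by (simp add: anc_iff)
    thus False using max[of ?c] anc_card[OF child_anc[OF c(1)]] by simp
  qed
  thus ?thesis using that e(1) by blast
qed

lemma leaf_iff: "f \<in> leaves T \<longleftrightarrow> f \<in> nodes T \<and> f \<notin> parents T"
  by (auto simp: parents_def leaves_def maximal_in_def)

lemma parents_nodes: "e \<in> parents T \<Longrightarrow> e \<in> nodes T" by (simp add: parents_def)

lemma parent_has_child:
  assumes "e \<in> parents T" shows "child T e \<noteq> {}"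
proof -
  obtain x where "e \<in> anc T x"
    using assms by (auto simp: parents_def leaves_def maximal_in_def anc_iff)
  thus ?thesis using child_below(1) by blast
qed

lemma Var_par_gen:
  assumes "e \<in> nodes T" shows "Var_par T e \<in> gen (anc T e)"
  using par_anc[OF assms] by (auto simp: Var_par_def intro: gen.intros)

lemma S_poly_gen:
  assumes "e \<in> nodes T" shows "S_poly T e J \<in> gen (anc T e)"
proof -
  interpret G: type_subring "gen (anc T e)" by (rule type_subring_gen)
  show ?thesis unfolding S_poly_def using Var_par_gen[OF assms]
    by (auto intro!: G.mems gen_Const)
qed

lemma S_poly_par_gen:
  assumes "k \<in> down T e - {tree_root T}" shows "S_poly T (par T k) J \<in> gen (anc T e)"
proof -
  have k: "k \<in> nodes T" "k \<noteq> tree_root T" "(k, e) \<in> tree_le T" using assms by (auto simp: down_def)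
  have p: "par T k \<in> anc T k" by (rule par_anc[OF k(1,2)])
  have "par T k \<in> anc T e"
  proof (cases "k = e")
    case False
    hence "k \<in> anc T e" using k(3) by (simp add: anc_iff)
    thus ?thesis by (rule anc_trans[OF p])
  qed (use p in simp)
  hence "anc T (par T k) \<subseteq> anc T e" using anc_trans by blast
  thus ?thesis using S_poly_gen[of "par T k" J] gen_mono[of "anc T (par T k)" "anc T e"] anc_nodes[OF p] by blast
qed

lemma R_poly_gen: "R_poly T e \<in> gen (anc T e)"
proof -
  interpret G: type_subring "gen (anc T e)" by (rule type_subring_gen)
  show ?thesis unfolding R_poly_def by (intro G.mems S_poly_par_gen)
qed

lemma Q_poly_gen: "e \<in> nodes T \<Longrightarrow> Q_poly T e \<in> gen (anc T e)"
  unfolding Q_poly_def by (intro gen_mult S_poly_gen R_poly_gen)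

lemma Q_quot_gen: 
  assumes "(c, e) \<in> tree_le T" shows "Q_quot T e c \<in> gen (anc T e)"
proof -
  interpret G: type_subring "gen (anc T e)" by (rule type_subring_gen)
  have "tree_root T \<in> down T c" using root_least[OF rooted] le_nodes[OF assms] by (simp add: down_iff)
  thus ?thesis unfolding Q_quot_def using le_nodes[OF assms]
    by (intro G.mems S_poly_gen S_poly_par_gen) auto
qed

lemma R_poly_factor:
  assumes "(k, e) \<in> tree_le T" shows "\<exists>M\<in>gen (anc T e). R_poly T e = M * R_poly T k"
proof -
  interpret G: type_subring "gen (anc T e)" by (rule type_subring_gen)
  have fin: "finite (down T x)" for x using finite_nodes by (simp add: down_def)
  have sub: "down T k \<subseteq> down T e" using assms le_trans by (auto simp: down_iff)
  have r: "tree_root T \<in> down T k" using root_least[OF rooted] le_nodes[OF assms] by (simp add: down_iff)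
  have eq: "down T e - {tree_root T} = (down T e - down T k) \<union> (down T k - {tree_root T})"
    using sub r by auto
  have "R_poly T e = (\<Prod>f \<in> down T e - down T k. S_poly T (par T f) {f}) * R_poly T k"
    unfolding R_poly_def eq by (rule prod.union_disjoint) (use fin in auto)
  moreover have "(\<Prod>f \<in> down T e - down T k. S_poly T (par T f) {f}) \<in> gen (anc T e)"
    using r by (intro G.mems S_poly_par_gen) auto
  ultimately show ?thesis by blast
qed

text \<open>Restores the one factor of \<open>S_poly\<close> that \<open>R_poly T k\<close> omits.
  Through \<open>Delta0\<close> it shows that \<open>R_poly T k\<close> times this factor is
  divisible by \<open>h\<close>.\<close>

lemma Q_poly_par:
  assumes "k \<in> nodes T" "k \<noteq> tree_root T"
  shows "Q_poly T (par T k) = (Var_par T (par T k) - Const [:lb T k:]) * R_poly T k"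
proof -
  have "k \<in> child T (par T k)" using assms by (simp add: child_iff')
  hence "S_poly T (par T k) {} = (Var_par T (par T k) - Const [:lb T k:]) * S_poly T (par T k) {k}"
    unfolding S_poly_def using prod.remove[OF finite_child] by (metis Diff_empty)
  thus ?thesis by (simp add: Q_poly_def R_poly_rec[OF rooted assms] mult.assoc)
qed

lemma ideal_tree_ideal: "ideal (tree_ideal T) (tree_poly_ring T)"
proof -
  interpret P: cring "tree_poly_ring T" by (rule cring_tree_poly_ring)
  show ?thesis unfolding tree_ideal_def
    by (rule P.genideal_ideal) (use Deltas_in_tree_poly_ring[OF rooted] in auto)
qed

lemma tree_poly_ring_simps:
  "a \<otimes>\<^bsub>tree_poly_ring T\<^esub> b = a * b" "a \<oplus>\<^bsub>tree_poly_ring T\<^esub> b = a + b"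
  "\<one>\<^bsub>tree_poly_ring T\<^esub> = 1" "\<zero>\<^bsub>tree_poly_ring T\<^esub> = 0"
  by (simp_all add: tree_poly_ring_def ring_of_type_algebra_def)

lemma ideal_0: "0 \<in> tree_ideal T"
  using additive_subgroup.zero_closed[OF ideal.axioms(1)[OF ideal_tree_ideal]]
  by (simp add: tree_poly_ring_simps)

lemma ideal_add: "i \<in> tree_ideal T \<Longrightarrow> j \<in> tree_ideal T \<Longrightarrow> i + j \<in> tree_ideal T"
  using additive_subgroup.a_closed[OF ideal.axioms(1)[OF ideal_tree_ideal]]
  by (simp add: tree_poly_ring_simps)

lemma ideal_mult: "i \<in> tree_ideal T \<Longrightarrow> p \<in> gen (parents T) \<Longrightarrow> p * i \<in> tree_ideal T"
  using ideal.I_l_closed[OF ideal_tree_ideal]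
  by (simp add: tree_poly_ring_simps tree_poly_ring_eq_gen)

lemma ideal_uminus: "i \<in> tree_ideal T \<Longrightarrow> - i \<in> tree_ideal T"
proof -
  interpret G: type_subring "gen (parents T)" by (rule type_subring_gen)
  show "i \<in> tree_ideal T \<Longrightarrow> - i \<in> tree_ideal T"
    using ideal_mult[of i "- 1"] G.uminus_mem[of 1] by simp
qed

lemma ideal_diff: "i \<in> tree_ideal T \<Longrightarrow> j \<in> tree_ideal T \<Longrightarrow> i - j \<in> tree_ideal T"
  using ideal_add[of i "- j"] ideal_uminus by simp

lemma Delta0_ideal: "e \<in> parents T \<Longrightarrow> Delta0 T e \<in> tree_ideal T"
  and Delta_ideal: "e \<in> parents T \<Longrightarrow> e' \<in> anc T e \<Longrightarrow> Delta T e' e \<in> tree_ideal T"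
proof -
  interpret P: cring "tree_poly_ring T" by (rule cring_tree_poly_ring)
  have "{Delta0 T e | e. e \<in> parents T} \<union> {Delta T e' e | e e'. e \<in> parents T \<and> e' \<in> anc T e} \<subseteq> tree_ideal T"
    unfolding tree_ideal_def
    by (rule P.genideal_self) (use Deltas_in_tree_poly_ring[OF rooted] in auto)
  thus "e \<in> parents T \<Longrightarrow> Delta0 T e \<in> tree_ideal T"
    "e \<in> parents T \<Longrightarrow> e' \<in> anc T e \<Longrightarrow> Delta T e' e \<in> tree_ideal T" by auto
qed

end

section \<open>Kernel and image of an evaluation\<close>

locale tree_evaluation = labelled_rooted_tree T + B: Ch_derivation \<iota> D
  for T :: "('n, 'z) labelled_tree_scheme" and \<iota> :: "complex poly \<Rightarrow> 'r::idom" and D :: "'r \<Rightarrow> 'r" +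
  fixes \<xi> :: "'n option \<Rightarrow> 'r"
begin

abbreviation "h \<equiv> B.h"
abbreviation "k \<equiv> B.k"
abbreviation "keval \<equiv> B.k.peval"
abbreviation "H \<equiv> Const [:0, 1:] :: 'n tree_poly"

definition \<pi> :: "'n tree_poly \<Rightarrow> 'r" where "\<pi> = poly_eval \<iota> \<xi>"

lemma \<iota>_hom: "type_ring_hom \<iota>" by unfold_locales

sublocale \<pi>: type_ring_hom \<pi>
  unfolding \<pi>_def by (rule type_ring_hom_poly_eval[OF \<iota>_hom])

sublocale CC: type_ring_hom "\<lambda>c. Const [:c:] :: 'n tree_poly"
proof -
  interpret C: type_ring_hom "Const :: _ \<Rightarrow> 'n tree_poly" by (rule type_ring_hom_Const)
  show "type_ring_hom (\<lambda>c. Const [:c:] :: 'n tree_poly)"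
    by unfold_locales (simp_all flip: C.hom_add C.hom_mult one_pCons add: mult.commute)
qed

lemma Const_0_1 [simp]: "Const 0 = (0 :: 'n tree_poly)" "Const 1 = (1 :: 'n tree_poly)"
  by (simp_all add: Const_def)

lemma \<pi>_Const [simp]: "\<pi> (Const a) = \<iota> a"
  and \<pi>_Var [simp]: "\<pi> (Var v) = \<xi> v"
  by (simp_all add: \<pi>_def \<iota>_hom)

lemma \<pi>_H [simp]: "\<iota> [:0, 1:] = h" by (simp add: B.h_def)
lemma \<pi>_k [simp]: "\<iota> [:c:] = k c" by (simp add: B.k_def)

lemma \<pi>_peval: "\<pi> (CC.peval g p) = keval g (\<pi> p)"
  by (rule peval_natural) (unfold_locales, simp)

lemma \<pi>_S: "\<pi> (S_poly T e J) = B.lin (\<pi> (Var_par T e)) (lb T ` (child T e - J))"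
proof -
  have "\<pi> (S_poly T e J) = (\<Prod>g\<in>child T e - J. \<pi> (Var_par T e) - k (lb T g))"
    by (simp add: S_poly_def \<pi>.hom_prod)
  also have "\<dots> = B.lin (\<pi> (Var_par T e)) (lb T ` (child T e - J))"
    unfolding B.lin_def 
    by (subst prod.reindex) (auto intro: inj_on_subset[OF inj_lb_child])
  finally show ?thesis .
qed

lemma lb_image_diff: "c \<in> child T e \<Longrightarrow> lb T ` (child T e - {c}) = lb T ` child T e - {lb T c}"
  using inj_lb_child[of e] by (auto simp: inj_on_def)

lemma \<pi>_R_poly:
  assumes "e \<in> nodes T" "e \<noteq> tree_root T"
  shows "\<pi> (R_poly T e) = B.lin (\<pi> (Var_par T (par T e))) (lb T ` child T (par T e) - {lb T e}) * \<pi> (R_poly T (par T e))"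
proof -
  have c: "e \<in> child T (par T e)" using assms by (simp add: child_iff')
  show ?thesis
    unfolding R_poly_rec[OF rooted assms] lb_image_diff[OF c, symmetric] by (simp add: \<pi>_S)
qed

end

text \<open>\<open>\<pi>_R\<close> keeps each \<open>R_poly\<close> from vanishing on the special
  fibre, and \<open>\<pi>_leaf\<close> makes the coordinate at a leaf transcendental on its
  component. The first enters the computation of the kernel, the second that of the image.\<close>

locale tree_presentation = tree_evaluation T \<iota> D \<xi> + B: Ch_sub \<iota> D B
  for T :: "('n, 'z) labelled_tree_scheme" and \<iota> :: "complex poly \<Rightarrow> 'r::idom" and D :: "'r \<Rightarrow> 'r"
    and B and \<xi> :: "'n option \<Rightarrow> 'r" +
  assumes \<xi>_None: "\<xi> None \<in> B" "D (\<xi> None) = 1"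
    and transcendental: "\<And>q. B.peval q (\<xi> None) = 0 \<Longrightarrow> q = 0"
    and \<xi>_Some: "\<And>e. e \<in> parents T \<Longrightarrow> \<xi> (Some e) \<in> B"
    and \<pi>_Q: "\<And>e. e \<in> parents T \<Longrightarrow> h * \<xi> (Some e) = \<pi> (Q_poly T e)"
    and \<pi>_R: "\<And>e w. e \<in> nodes T \<Longrightarrow> w \<in> B \<Longrightarrow> \<pi> (R_poly T e) \<noteq> h * w"
    and \<pi>_leaf: "\<And>f g w. f \<in> leaves T \<Longrightarrow> g \<noteq> 0 \<Longrightarrow> w \<in> B \<Longrightarrow>
      \<pi> (R_poly T f) * keval g (\<pi> (Var_par T f)) \<noteq> h * w"
    and away_from_h: "\<And>b. b \<in> B \<Longrightarrow> \<exists>n q. h ^ n * b = B.peval q (\<xi> None)"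
begin

lemma \<pi>_Delta0: "e \<in> parents T \<Longrightarrow> \<pi> (Delta0 T e) = 0"
  using \<pi>_Q by (simp add: Delta0_def)

text \<open>Only the multiple of \<open>Delta\<close> by \<open>R_poly\<close> visibly maps to zero;
  \<open>\<pi>_R\<close> with \<open>w = 0\<close> shows that this factor can be cancelled in the
  domain.\<close>

lemma \<pi>_Delta:
  assumes "e \<in> parents T" "e' \<in> anc T e"
  shows "\<pi> (Delta T e' e) = 0"
proof -
  have "child_below T e' e \<in> nodes T" using child_below[OF assms(2)] le_nodes by blast
  hence "\<pi> (R_poly T (child_below T e' e)) \<noteq> 0" using \<pi>_R[of _ 0] by auto
  moreover have "\<pi> (R_poly T (child_below T e' e) * Delta T e' e) = 0"
    unfolding Delta_mult[OF rooted parents_nodes[OF assms(1)] assms(2)]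
    by (simp add: \<pi>_Q[OF assms(1), symmetric] \<pi>_Q[OF anc_parents[OF assms(2)], symmetric])
  ultimately show ?thesis by simp
qed

lemma \<pi>_ideal: "i \<in> tree_ideal T \<Longrightarrow> \<pi> i = 0"
proof -
  interpret P: cring "tree_poly_ring T" by (rule cring_tree_poly_ring)
  define K where "K = {p \<in> carrier (tree_poly_ring T). \<pi> p = 0}"
  interpret G: type_subring "gen (parents T)" by (rule type_subring_gen)
  note c = tree_poly_ring_eq_gen[of T] 
  have neg: "\<ominus>\<^bsub>tree_poly_ring T\<^esub> a = - a" if "a \<in> carrier (tree_poly_ring T)" for a
    by (rule P.minus_equality) (use that c G.uminus_mem in \<open>simp_all add: tree_poly_ring_simps\<close>)
  have "ideal K (tree_poly_ring T)"
  proof (rule idealI)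
    show "ring (tree_poly_ring T)" by (rule P.ring_axioms)
    show "subgroup K (add_monoid (tree_poly_ring T))"
    proof (rule P.add.subgroupI)
      show "\<ominus>\<^bsub>tree_poly_ring T\<^esub> a \<in> K" if "a \<in> K" for a
        using neg[of a] that P.a_inv_closed[of a] by (simp add: K_def)
    qed (use P.zero_closed P.add.m_closed in \<open>auto simp: K_def tree_poly_ring_simps\<close>)
  qed (use P.m_closed in \<open>auto simp: K_def tree_poly_ring_simps\<close>)
  hence "tree_ideal T \<subseteq> K"
    unfolding tree_ideal_def
    by (rule P.genideal_minimal)
       (auto simp: K_def \<pi>_Delta0 \<pi>_Delta Deltas_in_tree_poly_ring[OF rooted])
  thus "i \<in> tree_ideal T \<Longrightarrow> \<pi> i = 0" by (auto simp: K_def)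
qed

lemma \<pi>_gen_B:
  assumes "E \<subseteq> parents T" "p \<in> gen E" shows "\<pi> p \<in> B"
  using assms(2) by induction (use \<xi>_None \<xi>_Some assms(1) in \<open>auto intro: B.mems\<close>)

lemma \<pi>_Var_par_step:
  assumes "e \<in> nodes T" "e \<noteq> tree_root T"
  shows "h * \<pi> (Var_par T e) = B.lin (\<pi> (Var_par T (par T e))) (lb T ` child T (par T e)) * \<pi> (R_poly T (par T e))"
proof -
  have "par T e \<in> parents T" using par_anc[OF assms] anc_parents by blast
  thus ?thesis using \<pi>_Q[of "par T e"] assms by (simp add: Var_par_def Q_poly_def \<pi>_S)
qed

end

text \<open>Here \<open>E\<close> is the set of inner nodes of a truncated tree, and \<open>f\<close> is one of its leaves.\<close>

locale truncated_presentation = tree_presentation T \<iota> D B \<xi>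
  for T :: "('n, 'z) labelled_tree_scheme" and \<iota> :: "complex poly \<Rightarrow> 'r::idom" and D :: "'r \<Rightarrow> 'r" and B and \<xi> +
  fixes E :: "'n set" and f :: 'n
  assumes E: "E \<subseteq> parents T" and E_closed: "\<And>e. e \<in> E \<Longrightarrow> anc T e \<subseteq> E"
    and f: "f \<in> nodes T" "f \<notin> E" "anc T f \<subseteq> E"
begin

sublocale G: type_subring "gen E" by (rule type_subring_gen)

text \<open>The coordinate ring of the truncated tree. Divisibility by \<open>h\<close> in
  \<open>C\<close> is stronger than in \<open>B\<close>, and it is the one that matters for
  relations.\<close>

definition C :: "'r set" where "C = \<pi> ` gen E"

sublocale C: Ch_sub \<iota> D C
proof
  show "1 \<in> C" unfolding C_def using \<pi>.hom_one G.one_mem by (metis imageI)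
  show "a - b \<in> C" if "a \<in> C" "b \<in> C" for a b
    using that G.diff_mem by (auto simp: C_def simp flip: \<pi>.hom_diff)
  show "a * b \<in> C" if "a \<in> C" "b \<in> C" for a b
    using that G.mult_mem by (auto simp: C_def simp flip: \<pi>.hom_mult)
  show "\<iota> a \<in> C" for a unfolding C_def using \<pi>_Const gen_Const by (metis imageI)
qed

lemma C_B: "C \<subseteq> B" using \<pi>_gen_B[OF E] by (auto simp: C_def)

lemma \<pi>_C [simp]: "p \<in> gen E \<Longrightarrow> \<pi> p \<in> C" by (simp add: C_def)

text \<open>Divisibility by \<open>H\<close> modulo \<open>tree_ideal T\<close>, not modulo the
  kernel of \<open>\<pi>\<close>: that the two ideals agree is still to be shown.\<close>

definition near :: "'n tree_poly \<Rightarrow> bool" where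
  "near a \<longleftrightarrow> (\<exists>s\<in>gen E. a - H * s \<in> tree_ideal T)"

lemma gen_E_parents: "p \<in> gen E \<Longrightarrow> p \<in> gen (parents T)" using gen_mono[OF E] by blast

lemma near_\<pi>: "near a \<Longrightarrow> \<exists>w\<in>C. \<pi> a = h * w"
  unfolding near_def using \<pi>_ideal by fastforce

lemma near_ideal: "i \<in> tree_ideal T \<Longrightarrow> near i"
  unfolding near_def by (rule bexI[of _ 0]) auto

lemma near_H: "s \<in> gen E \<Longrightarrow> near (H * s)"
  unfolding near_def by (rule bexI[of _ s]) (auto simp: ideal_0)

lemma near_add: "near a \<Longrightarrow> near b \<Longrightarrow> near (a + b)"
proof -
  assume "near a" "near b"
  then obtain s t where "s \<in> gen E" "a - H * s \<in> tree_ideal T" "t \<in> gen E" "b - H * t \<in> tree_ideal T"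
    by (auto simp: near_def)
  thus "near (a + b)" unfolding near_def
    using ideal_add[of "a - H * s" "b - H * t"] by (intro bexI[of _ "s + t"]) (auto simp: algebra_simps intro: gen_add)
qed

lemma near_mult: "p \<in> gen E \<Longrightarrow> near a \<Longrightarrow> near (p * a)"
proof -
  assume p: "p \<in> gen E" and "near a"
  then obtain s where s: "s \<in> gen E" "a - H * s \<in> tree_ideal T" by (auto simp: near_def)
  show "near (p * a)" unfolding near_def
    using ideal_mult[OF s(2) gen_E_parents[OF p]] s p
    by (intro bexI[of _ "p * s"]) (auto simp: algebra_simps intro: gen_mult)
qed

lemma near_diff: "near a \<Longrightarrow> near b \<Longrightarrow> near (a - b)"
  using near_add[of a "(- 1) * b"] near_mult[of "- 1" b] G.uminus_mem[OF G.one_mem] by simp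

abbreviation "R \<equiv> R_poly T f"
abbreviation "Y \<equiv> Var_par T f"

lemma R_gen [simp]: "R \<in> gen E" using R_poly_gen gen_mono[OF f(3)] by blast
lemma Y_gen [simp]: "Y \<in> gen E" using Var_par_gen[OF f(1)] gen_mono[OF f(3)] by blast

lemma R_factor:
  assumes "(e, f) \<in> tree_le T" obtains M where "M \<in> gen E" "R = M * R_poly T e"
  using R_poly_factor[OF assms] gen_mono[OF f(3)] by blast

lemma anc_E: "a \<in> anc T f \<Longrightarrow> a \<in> E" using f(3) by blast

text \<open>\<open>R\<close> contains the factor \<open>R_poly T e\<close>, which together with the
  linear factor gives \<open>Q_poly T (par T e)\<close>, and \<open>Delta0\<close> makes this a
  multiple of \<open>H\<close>. On the component of \<open>f\<close>, each coordinate on the path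
  thus equals the label of the next node.\<close>

lemma near_label:
  assumes "e \<noteq> tree_root T" "(e, f) \<in> tree_le T"
  shows "near (R * (Var_par T (par T e) - Const [:lb T e:]))"
proof -
  have e: "e \<in> nodes T" using le_nodes[OF assms(2)] by simp
  have p: "par T e \<in> anc T f"
    using par_anc[OF e assms(1)] anc_trans[of "par T e" e f] assms(2) by (cases "e = f") (auto simp: anc_iff)
  obtain M where M: "M \<in> gen E" "R = M * R_poly T e" using R_factor[OF assms(2)] .
  have "R * (Var_par T (par T e) - Const [:lb T e:]) = M * Q_poly T (par T e)"
    by (simp add: M(2) Q_poly_par[OF e assms(1)] mult_ac)
  also have "\<dots> = M * (H * Var (Some (par T e)) - Delta0 T (par T e))"
    by (simp add: Delta0_def)
  finally show ?thesis
    using near_mult[OF M(1) near_diff[OF near_H near_ideal]] Delta0_ideal anc_parents[OF p] anc_E[OF p]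
    by (auto intro: gen_Some)
qed

lemma unrelated:
  assumes "a \<in> E" "a \<notin> anc T f"
  obtains e where "e \<in> anc T a" "e \<in> anc T f"
    "lb T (child_below T e a) \<noteq> lb T (child_below T e f)"
proof -
  have "a \<in> nodes T" using assms E parents_nodes by blast
  moreover have "f \<notin> anc T a" "a \<noteq> f" using assms E_closed f by blast+
  ultimately obtain e where e: "e \<in> anc T a" "e \<in> anc T f" "child_below T e a \<noteq> child_below T e f"
    using branch_point[of a f] f(1) assms by metis
  moreover have "lb T (child_below T e a) \<noteq> lb T (child_below T e f)"
    using child_below(1)[OF e(1)] child_below(1)[OF e(2)] e(3) inj_lb_child[of e] by (auto simp: inj_on_def)
  ultimately show ?thesis using that by blast
qed

lemma child_below_props':
  assumes "e \<in> anc T a"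
  shows "child_below T e a \<in> nodes T" "child_below T e a \<noteq> tree_root T" "par T (child_below T e a) = e"
  using child_below(1)[OF assms] by (auto simp: child_iff')

text \<open>
  The variable \<open>X\<^sub>a\<close> of an inner node is controlled by its ancestors: on the path to \<open>f\<close> through
  the label of the next node, and away from this path through \<open>\<Delta>\<^bsub>e,a\<^esub>\<close>.
\<close>

lemma gen_E_induct [consumes 1, case_names Const Y label unrelated add mult]:
  assumes p: "p \<in> gen E"
    and Const: "\<And>a. P (Const a)"
    and Y: "P Y"
    and label: "\<And>e. e \<noteq> tree_root T \<Longrightarrow> (e, f) \<in> tree_le T \<Longrightarrow> P (Var_par T (par T e))"
    and unrel: "\<And>a e z. a \<in> E \<Longrightarrow> e \<in> anc T a \<Longrightarrow> e \<in> anc T f \<Longrightarrow>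
      lb T (child_below T e a) \<noteq> lb T (child_below T e f) \<Longrightarrow>
      Delta T e a = (Var_par T e - Const [:lb T (child_below T e a):]) * Var (Some a) - z \<Longrightarrow>
      z \<in> gen E \<Longrightarrow> P z \<Longrightarrow>
      P (Var (Some a))"
    and add: "\<And>p q. p \<in> gen E \<Longrightarrow> q \<in> gen E \<Longrightarrow> P p \<Longrightarrow> P q \<Longrightarrow> P (p + q)"
    and mult: "\<And>p q. p \<in> gen E \<Longrightarrow> q \<in> gen E \<Longrightarrow> P p \<Longrightarrow> P q \<Longrightarrow> P (p * q)"
  shows "P p"
proof -
  have below: "P (Var_par T e)" if "(e, f) \<in> tree_le T" for e
  proof (cases "e = f")
    case False
    hence e: "e \<in> anc T f" using that by (simp add: anc_iff)
    show ?thesis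
      using label[of "child_below T e f"] child_below(2)[OF e] child_below_props'[OF e] by simp
  qed (use Y in simp)
  have None: "P (Var None)"
    using below[of "tree_root T"] root_least[OF rooted f(1)] by (simp add: Var_par_def)
  have gen: "P q" if "\<And>a. a \<in> A \<Longrightarrow> P (Var (Some a))" "A \<subseteq> E" "q \<in> gen A" for q A
    using that(3)
  proof induction
    case (gen_add p q)
    thus ?case using add gen_mono[OF that(2)] by blast
  next
    case (gen_mult p q)
    thus ?case using mult gen_mono[OF that(2)] by blast
  qed (use Const None that(1) in auto)
  have "P (Var (Some a))" if "a \<in> E" for a
    using that
  proof (induction "card (anc T a)" arbitrary: a rule: less_induct)
    case less
    show ?case
    proof (cases "a \<in> anc T f")
      case True
      thus ?thesis using below[OF child_below(2)[OF True]] child_below_props'[OF True]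
        by (simp add: Var_par_def)
    next
      case False
      then obtain e where e: "e \<in> anc T a" "e \<in> anc T f"
        "lb T (child_below T e a) \<noteq> lb T (child_below T e f)"
        using unrelated less.prems by metis
      \<comment> \<open>Apart from \<open>X_a\<close> itself, \<open>Delta T e a\<close> involves
        only variables of proper ancestors of \<open>a\<close>, so the induction on depth covers
        \<open>z\<close>.\<close>
      define z where "z = Var (Some e) * Q_quot T a (child_below T e a)"
      have z: "z \<in> gen (anc T a)"
        unfolding z_def using e(1) by (intro gen_mult gen_Some Q_quot_gen child_below)
      have aE: "anc T a \<subseteq> E" using E_closed less.prems by blast
      have IH: "P (Var (Some b))" if "b \<in> anc T a" for b
        using less.hyps[OF anc_card[OF that]] that aE by blast
      show ?thesis
      proof (rule unrel[OF less.prems e])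
        show "P z" by (rule gen[OF IH aE z])
        show "z \<in> gen E" using z gen_mono[OF aE] by blast
        show "Delta T e a = (Var_par T e - Const [:lb T (child_below T e a):]) * Var (Some a) - z"
          by (simp add: Delta_def z_def Let_def)
      qed
    qed
  qed
  thus ?thesis using gen[of E p] p by blast
qed

text \<open>On the component of \<open>f\<close> every function of the truncated tree is a
  polynomial in \<open>Y\<close> with constant coefficients: coordinates on the path are constants
  there, and those off the path are solved for by a \<open>Delta\<close>.\<close>

lemma good:
  assumes "p \<in> gen E"
  shows "\<exists>g. near (R * (p - CC.peval g Y))"
  using assms
proof (induction rule: gen_E_induct)
  case (Const a)
  obtain a0 a' where a: "a = pCons a0 a'" by (cases a) auto
  interpret C': type_ring_hom "Const :: _ \<Rightarrow> 'n tree_poly" by (rule type_ring_hom_Const)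
  have "[:0, 1:] * a' = pCons 0 a'" by simp
  hence "Const a = Const [:a0:] + H * Const a'"
    unfolding a C'.hom_add[symmetric] C'.hom_mult[symmetric] by simp
  hence eq: "R * (Const a - CC.peval [:a0:] Y) = H * (R * Const a')" by (simp add: mult_ac)
  have "near (R * (Const a - CC.peval [:a0:] Y))"
    unfolding eq by (intro near_H gen_mult gen_Const R_gen)
  thus ?case by blast
next
  case Y
  have "near (R * (Y - CC.peval [:0, 1:] Y))" by (simp add: near_ideal ideal_0)
  thus ?case by blast
next
  case (label e)
  thus ?case using near_label[OF label] by (intro exI[of _ "[:lb T e:]"]) simp
next
  case (unrelated a e z)
  let ?c = "lb T (child_below T e a)" and ?c' = "lb T (child_below T e f)"
  obtain g where g: "near (R * (z - CC.peval g Y))" using unrelated by blast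
  have a: "a \<in> parents T" using unrelated(1) E by blast
  have "near (R * (Var_par T e - Const [:?c':]))"
    using near_label[OF _ child_below(2)[OF unrelated(3)]] child_below_props'[OF unrelated(3)] by simp
  hence 1: "near (Var (Some a) * (R * (Var_par T e - Const [:?c':])))"
    by (rule near_mult[OF gen_Some[OF unrelated(1)]])
  have 2: "near (R * Delta T e a)"
    by (intro near_mult near_ideal Delta_ideal a unrelated R_gen)
  \<comment> \<open>On the component, \<open>Var_par T e\<close> equals \<open>?c'\<close>, so
    \<open>Delta T e a\<close> reads \<open>(?c' - ?c) * X_a = z\<close>, with an invertible
    coefficient because the labels differ.\<close>
  have 3: "near (R * Delta T e a - Var (Some a) * (R * (Var_par T e - Const [:?c':])) + R * (z - CC.peval g Y))"
    by (intro near_add near_diff 1 2 g)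
  have eq: "R * Delta T e a - Var (Some a) * (R * (Var_par T e - Const [:?c':])) + R * (z - CC.peval g Y)
      = R * (Const [:?c' - ?c:] * Var (Some a) - CC.peval g Y)"
    unfolding unrelated(5) using CC.hom_diff[of ?c' ?c] by (simp add: algebra_simps)
  define d where "d = inverse (?c' - ?c)"
  have d: "Const [:d:] * Const [:?c' - ?c:] = (1 :: 'n tree_poly)"
    using unrelated(4) CC.hom_mult[of d "?c' - ?c", symmetric] CC.hom_one by (simp add: d_def)
  have "Const [:d:] * (R * (Const [:?c' - ?c:] * Var (Some a) - CC.peval g Y))
      = R * ((Const [:d:] * Const [:?c' - ?c:]) * Var (Some a) - CC.peval (Polynomial.smult d g) Y)"
    by (simp add: algebra_simps CC.peval_smult)
  hence "near (R * (Var (Some a) - CC.peval (Polynomial.smult d g) Y))"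
    using near_mult[OF gen_Const 3[unfolded eq], of "[:d:]"] d by simp
  thus ?case by blast
next
  case (add p q)
  then obtain g g' where g: "near (R * (p - CC.peval g Y))" "near (R * (q - CC.peval g' Y))" by blast
  have "near (R * (p + q - CC.peval (g + g') Y))"
    using near_add[OF g] by (simp add: CC.peval_add algebra_simps)
  thus ?case by blast
next
  case (mult p q)
  then obtain g g' where g: "near (R * (p - CC.peval g Y))" "near (R * (q - CC.peval g' Y))" by blast
  have Yg: "CC.peval g Y \<in> gen E"
  proof (induction g)
    case (pCons a g)
    thus ?case unfolding CC.peval_pCons by (intro gen_add gen_mult gen_Const Y_gen)
  qed simp
  have "near (q * (R * (p - CC.peval g Y)) + CC.peval g Y * (R * (q - CC.peval g' Y)))"
    by (intro near_add near_mult g mult Yg)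
  hence "near (R * (p * q - CC.peval (g * g') Y))"
    by (simp add: CC.peval_mult algebra_simps)
  thus ?case by blast
qed

abbreviation "r \<equiv> \<pi> R"
abbreviation "y \<equiv> \<pi> Y"

text \<open>\<open>chainok_step\<close> iterated down the path from the root; each edge contributes
  one \<open>h\<close>, hence the depth as exponent.\<close>

lemma chainok_below:
  assumes "(e, f) \<in> tree_le T"
  shows "C.chainok (card (anc T e)) (\<pi> (Var_par T e)) (\<pi> (R_poly T e))"
proof -
  have "e \<in> nodes T" using le_nodes[OF assms] by simp
  thus ?thesis using assms
  proof (induction rule: tree_induct)
    case root
    have "\<xi> None \<in> C" using \<pi>_C[OF gen_None] by simp
    thus ?case using \<xi>_None by (simp add: anc_root R_poly_root[OF rooted] Var_par_def C.chainok_0)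
  next
    case (par e)
    have p: "par T e \<in> anc T e" by (rule par_anc[OF par(1,2)])
    hence pf: "(par T e, f) \<in> tree_le T" using par(4) le_trans by (auto simp: anc_iff)
    have pE: "par T e \<in> anc T f" using par(4) p anc_trans[of "par T e" e f] by (cases "e = f") (auto simp: anc_iff)
    have e: "e \<in> child T (par T e)" using par by (simp add: child_iff')
    have "\<pi> (Var_par T e) \<in> C"
      using par pE anc_E by (auto simp: Var_par_def intro!: \<pi>_C gen_Some simp del: \<pi>_Var)
    thus ?case unfolding card_anc_par[OF par(1,2)] \<pi>_R_poly[OF par(1,2)]
      by (intro C.chainok_step par(3) pf) (use e finite_child \<pi>_Var_par_step[OF par(1,2)] in auto)
  qed
qed

lemma units_below:
  assumes "(e, f) \<in> tree_le T" "u \<in> C.units_at (\<pi> (R_poly T e))" shows "u \<in> C.units_at r"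
proof -
  obtain M where "M \<in> gen E" "R = M * R_poly T e" using R_factor[OF assms(1)] .
  thus ?thesis using C.units_at_mono[OF assms(2), of "\<pi> M"] by simp
qed

lemma r_unit: "r \<in> C.units_at r"
  using chainok_below[OF le_refl[OF f(1)]] by (simp add: C.chainok_def)

abbreviation "d \<equiv> card (anc T f)"

lemma D_Var_par:
  assumes "(e, f) \<in> tree_le T"
  shows "\<exists>u\<in>C.units_at r. u * h ^ d * D (\<pi> (Var_par T e)) \<in> C"
proof -
  obtain u where u: "u \<in> C.units_at (\<pi> (R_poly T e))"
    "u * h ^ card (anc T e) * D (\<pi> (Var_par T e)) \<in> C.units_at (\<pi> (R_poly T e))"
    using chainok_below[OF assms] by (auto simp: C.chainok_def)
  have "anc T e \<subseteq> anc T f" using assms anc_trans[of _ e f] by (cases "e = f") (auto simp: anc_iff)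
  hence "card (anc T e) \<le> d" by (rule card_mono[OF finite_anc])
  then obtain j where j: "d = j + card (anc T e)" using nat_le_iff_add by (metis add.commute)
  have "h ^ j * (u * h ^ card (anc T e) * D (\<pi> (Var_par T e))) \<in> C"
    by (rule C.mult_mem[OF C.power_mem[OF C.h_mem] C.units_at_sub[OF u(2)]])
  moreover have "h ^ j * (u * h ^ card (anc T e) * D (\<pi> (Var_par T e))) = u * h ^ d * D (\<pi> (Var_par T e))"
    unfolding j by (simp add: power_add mult_ac)
  ultimately show ?thesis using units_below[OF assms u(1)] by auto
qed

text \<open>Near the component of \<open>f\<close>, the poles of \<open>D\<close> on all of
  \<open>C\<close> have order at most \<open>d\<close>, also for variables off the path. Such a
  variable is reached by differentiating its \<open>Delta\<close>, whose linear factor is a unit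
  there.\<close>

lemma D_gen:
  assumes "p \<in> gen E"
  shows "\<exists>u\<in>C.units_at r. u * h ^ d * D (\<pi> p) \<in> C"
  using assms
proof (induction rule: gen_E_induct)
  case (Const a)
  show ?case by (rule bexI[of _ 1]) (auto simp: B.D_const C.units_at_1)
next
  case Y
  show ?case by (rule D_Var_par[OF le_refl[OF f(1)]])
next
  case (label e)
  have "(par T e, f) \<in> tree_le T"
    using par_anc[of e] label le_nodes le_trans[of "par T e" e f] by (auto simp: anc_iff)
  thus ?case by (rule D_Var_par)
next
  case (unrelated a e z)
  let ?c = "lb T (child_below T e a)" and ?c' = "lb T (child_below T e f)"
  have ef: "(e, f) \<in> tree_le T" using unrelated(3) by (simp add: anc_iff)
  obtain u where u: "u \<in> C.units_at r" "u * h ^ d * D (\<pi> z) \<in> C" using unrelated by blast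
  obtain v where v: "v \<in> C.units_at r" "v * h ^ d * D (\<pi> (Var_par T e)) \<in> C" using D_Var_par[OF ef] by blast
  define w where "w = \<pi> (Var_par T e) - k ?c"
  have Ve: "\<pi> (Var_par T e) \<in> C"
    using chainok_below[OF ef] by (simp add: C.chainok_def)
  have "near (R * (Var_par T e - Const [:?c':]))"
    using near_label[OF _ child_below(2)[OF unrelated(3)]] child_below_props'[OF unrelated(3)] by simp
  then obtain s where s: "s \<in> C" "(\<pi> (Var_par T e) - k ?c') * r = h * s"
    using near_\<pi> by (fastforce simp: mult_ac)
  have wu: "w \<in> C.units_at r"
    unfolding w_def by (rule C.units_at_shift[OF Ve s]) (use unrelated(4) in simp)
  have aC: "\<xi> (Some a) \<in> C" using \<pi>_C[OF gen_Some[OF unrelated(1)]] by simp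
  have "a \<in> parents T" using unrelated(1) E by blast
  hence "\<pi> (Delta T e a) = 0" by (rule \<pi>_Delta[OF _ unrelated(2)])
  hence wz: "w * \<xi> (Some a) = \<pi> z" unfolding unrelated(5) by (simp add: w_def)
  have "D (\<pi> z) = D (\<pi> (Var_par T e)) * \<xi> (Some a) + w * D (\<xi> (Some a))"
    unfolding wz[symmetric] by (simp add: w_def B.D_diff B.D_mult)
  hence "(u * v * w) * h ^ d * D (\<xi> (Some a)) =
      v * (u * h ^ d * D (\<pi> z)) - u * (v * h ^ d * D (\<pi> (Var_par T e))) * \<xi> (Some a)"
    by (simp add: algebra_simps)
  also have "\<dots> \<in> C" by (rule C.diff_mem[OF C.mult_mem[OF C.units_at_sub[OF v(1)] u(2)] C.mult_mem[OF C.mult_mem[OF C.units_at_sub[OF u(1)] v(2)] aC]])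
  finally have "(u * v * w) * h ^ d * D (\<xi> (Some a)) \<in> C" .
  moreover have "u * v * w \<in> C.units_at r" by (intro C.units_at_mult u v wu)
  ultimately show ?case by (intro bexI[of _ "u * v * w"]) auto
next
  case (add p q)
  then obtain u v where u: "u \<in> C.units_at r" "u * h ^ d * D (\<pi> p) \<in> C"
    and v: "v \<in> C.units_at r" "v * h ^ d * D (\<pi> q) \<in> C" by blast
  have "(u * v) * h ^ d * D (\<pi> (p + q)) = v * (u * h ^ d * D (\<pi> p)) + u * (v * h ^ d * D (\<pi> q))"
    by (simp add: B.D_add algebra_simps)
  also have "\<dots> \<in> C" by (rule C.add_mem[OF C.mult_mem[OF C.units_at_sub[OF v(1)] u(2)] C.mult_mem[OF C.units_at_sub[OF u(1)] v(2)]])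
  finally show ?case using C.units_at_mult[OF u(1) v(1)] by blast
next
  case (mult p q)
  then obtain u v where u: "u \<in> C.units_at r" "u * h ^ d * D (\<pi> p) \<in> C"
    and v: "v \<in> C.units_at r" "v * h ^ d * D (\<pi> q) \<in> C" by blast
  have "(u * v) * h ^ d * D (\<pi> (p * q)) = v * (u * h ^ d * D (\<pi> p)) * \<pi> q + u * (v * h ^ d * D (\<pi> q)) * \<pi> p"
    by (simp add: B.D_mult algebra_simps)
  also have "\<dots> \<in> C"
    by (rule C.add_mem[OF C.mult_mem[OF C.mult_mem[OF C.units_at_sub[OF v(1)] u(2)] \<pi>_C[OF mult(2)]] C.mult_mem[OF C.mult_mem[OF C.units_at_sub[OF u(1)] v(2)] \<pi>_C[OF mult(1)]]])
  finally show ?case using C.units_at_mult[OF u(1) v(1)] by blast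
qed

text \<open>For \<open>g \<noteq> 0\<close> of least degree, apply \<open>h\<^sup>d \<partial>/\<partial>X\<^sub>0\<close>, which acts near \<open>f\<close> as \<open>d/dY\<close> up to a unit.\<close>

lemma Y_transcendental:
  assumes "w \<in> C" "r * keval g y = h * w"
  shows "g = 0"
  using assms
proof (induction "degree g" arbitrary: g w rule: less_induct)
  case less
  show ?case
  proof (cases "degree g = 0")
    case True
    then obtain c where g: "g = [:c:]" by (metis degree_eq_zeroE)
    show ?thesis
    proof (rule ccontr)
      assume "g \<noteq> 0"
      hence "k (inverse c) * k c = 1" using g by (simp flip: B.k.hom_mult)
      moreover have "k (inverse c) * k c * r = h * (k (inverse c) * w)"
        using less(3) g by (simp add: mult_ac)
      ultimately have "r = h * (k (inverse c) * w)" by simp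
      thus False using \<pi>_R[OF f(1)] less(2) C_B by (meson C.k_mem C.mult_mem subsetD)
    qed
  next
    case False
    obtain u where u: "u \<in> C.units_at r" "u * h ^ d * D y \<in> C.units_at r" "u * h ^ d * D r \<in> C"
      using chainok_below[OF le_refl[OF f(1)]] by (auto simp: C.chainok_def)
    obtain p where p: "w = \<pi> p" "p \<in> gen E" using less(2) by (auto simp: C_def)
    obtain v where v: "v \<in> C.units_at r" "v * h ^ d * D w \<in> C" using D_gen[OF p(2)] p(1) by blast
    define u' where "u' = u * h ^ d * D y"
    define b where "b = u * h ^ d * D r"
    define w' where "w' = r * (u * (v * h ^ d * D w)) - v * b * w"
    have b: "b \<in> C" using u(3) by (simp add: b_def)
    have w': "w' \<in> C" unfolding w'_def
      by (intro C.diff_mem C.mult_mem[of r] C.mult_mem[of u] C.mult_mem[of _ w] C.mult_mem[of v b]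
          v(2) b less(2) C.units_at_sub[OF u(1)] C.units_at_sub[OF v(1)] \<pi>_C R_gen)
    have "D (r * keval g y) = h * D w" by (simp add: less(3) B.D_h_mult)
    hence "u * v * h ^ d * (D r * keval g y + r * (keval (pderiv g) y * D y)) = u * v * h ^ d * (h * D w)"
      by (simp add: B.D_mult B.D_peval)
    hence "v * b * keval g y + r * (v * u') * keval (pderiv g) y = h * (u * (v * h ^ d * D w))"
      by (simp add: u'_def b_def algebra_simps)
    \<comment> \<open>One more factor \<open>r\<close> completes \<open>r * keval g y\<close> in the
      first summand, which is divisible by \<open>h\<close> by hypothesis; only the term with
      \<open>pderiv g\<close> survives.\<close>
    hence "r * (v * b * keval g y + r * (v * u') * keval (pderiv g) y) = h * (r * (u * (v * h ^ d * D w)))"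
      by (simp add: mult_ac)
    hence "v * b * (r * keval g y) + (r * (v * u')) * r * keval (pderiv g) y = h * (r * (u * (v * h ^ d * D w)))"
      by (simp add: algebra_simps)
    hence "(r * (v * u')) * r * keval (pderiv g) y = h * w'"
      unfolding less(3) by (simp add: w'_def algebra_simps)
    moreover have "r * (v * u') \<in> C.units_at r"
      unfolding u'_def by (intro C.units_at_mult r_unit v u)
    moreover have "keval (pderiv g) y \<in> C" by (intro C.peval_mem \<pi>_C Y_gen)
    ultimately obtain z where "z \<in> C" "r * keval (pderiv g) y = h * z"
      using C.units_at_cancel w' by blast
    hence "pderiv g = 0"
      by (intro less(1)[of _ z]) (use False in \<open>auto simp: degree_pderiv\<close>)
    thus ?thesis using False by (simp add: pderiv_eq_0_iff)
  qed
qed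

end

section \<open>Lowering the degree of a relation in the variable of a new inner node\<close>

context truncated_presentation
begin

lemma Q_gen [simp]: "Q_poly T f \<in> gen E" using Q_poly_gen[OF f(1)] gen_mono[OF f(3)] by blast

text \<open>Within \<open>gen E\<close> these elements form an ideal. A leading coefficient in it
  allows the degree in \<open>X_f\<close> to be lowered by one.\<close>

definition red :: "'n tree_poly \<Rightarrow> bool" where
  "red z \<longleftrightarrow> (\<exists>t\<in>gen E. z * Var (Some f) - t \<in> tree_ideal T)"

lemma red_add: "red a \<Longrightarrow> red b \<Longrightarrow> red (a + b)"
proof -
  assume "red a" "red b"
  then obtain s t where "s \<in> gen E" "a * Var (Some f) - s \<in> tree_ideal T"
    "t \<in> gen E" "b * Var (Some f) - t \<in> tree_ideal T" by (auto simp: red_def)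
  thus "red (a + b)" unfolding red_def
    using ideal_add[of "a * Var (Some f) - s" "b * Var (Some f) - t"]
    by (intro bexI[of _ "s + t"]) (auto simp: algebra_simps intro: gen_add)
qed

lemma red_mult: "p \<in> gen E \<Longrightarrow> red a \<Longrightarrow> red (p * a)"
proof -
  assume p: "p \<in> gen E" and "red a"
  then obtain s where s: "s \<in> gen E" "a * Var (Some f) - s \<in> tree_ideal T" by (auto simp: red_def)
  show "red (p * a)" unfolding red_def
    using ideal_mult[OF s(2) gen_E_parents[OF p]] s p
    by (intro bexI[of _ "p * s"]) (auto simp: algebra_simps intro: gen_mult)
qed

lemma red_diff: "red a \<Longrightarrow> red b \<Longrightarrow> red (a - b)"
  using red_add[of a "(- 1) * b"] red_mult[of "- 1" b] G.uminus_mem[OF G.one_mem] by simp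

lemma red_0: "red 0"
  unfolding red_def by (rule bexI[of _ 0]) (auto simp: ideal_0)

text \<open>\<open>Delta0 T f\<close> replaces \<open>H * X_f\<close> by \<open>Q_poly T f\<close>,
  which does not contain \<open>X_f\<close>.\<close>

lemma red_near:
  assumes "f \<in> parents T" "near a" shows "red a"
proof -
  obtain s where s: "s \<in> gen E" "a - H * s \<in> tree_ideal T" using assms by (auto simp: near_def)
  have "Var (Some f) * (a - H * s) + s * Delta0 T f \<in> tree_ideal T"
    using assms(1) by (intro ideal_add ideal_mult s Delta0_ideal gen_E_parents gen_Some)
  hence "a * Var (Some f) - s * Q_poly T f \<in> tree_ideal T"
    by (simp add: Delta0_def algebra_simps)
  thus ?thesis unfolding red_def using s by (auto intro!: bexI[of _ "s * Q_poly T f"] gen_mult)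
qed

text \<open>The relation \<open>Delta T (par T e) f\<close> is itself the required reduction; this
  is where the \<open>Delta\<close> beyond \<open>Delta0\<close> enter.\<close>

lemma red_label:
  assumes "f \<in> parents T" "e \<noteq> tree_root T" "(e, f) \<in> tree_le T"
  shows "red (Var_par T (par T e) - Const [:lb T e:])"
proof -
  have e: "e \<in> nodes T" using le_nodes[OF assms(3)] by simp
  have "e \<in> child T (par T e)" using e assms by (simp add: child_iff')
  hence cb: "child_below T (par T e) f = e" by (rule child_below_unique[OF _ assms(3)])
  have p: "par T e \<in> anc T f"
    using par_anc[OF e assms(2)] anc_trans[of "par T e" e f] assms(3) by (cases "e = f") (auto simp: anc_iff)
  have "Delta T (par T e) f \<in> tree_ideal T" by (rule Delta_ideal[OF assms(1) p])
  moreover have "Var (Some (par T e)) * Q_quot T f e \<in> gen E"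
    using Q_quot_gen[OF assms(3)] gen_mono[OF f(3)] anc_E[OF p] by (auto intro!: gen_mult gen_Some)
  ultimately show ?thesis unfolding red_def Delta_def cb Let_def by blast
qed

definition approx :: "'n tree_poly \<Rightarrow> complex \<Rightarrow> bool" where
  "approx a c \<longleftrightarrow> a \<in> gen E \<and> c \<noteq> 0 \<and> red (a - Const [:c:])"

lemma approx_1: "approx 1 1"
  using red_0 CC.hom_one by (simp add: approx_def)

lemma approx_mult:
  assumes "approx a c" "approx b c'" shows "approx (a * b) (c * c')"
proof -
  have "red (a * (b - Const [:c':]) + Const [:c':] * (a - Const [:c:]))"
    using assms by (intro red_add red_mult gen_Const) (auto simp: approx_def)
  moreover have "a * (b - Const [:c':]) + Const [:c':] * (a - Const [:c:]) = a * b - Const [:c * c':]"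
    unfolding CC.hom_mult by (simp add: algebra_simps)
  ultimately show ?thesis using assms by (auto simp: approx_def intro: gen_mult)
qed

lemma approx_prod:
  assumes "\<And>x. x \<in> A \<Longrightarrow> \<exists>c. approx (g x) c" shows "\<exists>c. approx (prod g A) c"
  using assms
proof (induction A rule: infinite_finite_induct)
  case (insert x A)
  thus ?case using approx_mult by (metis insertCI prod.insert)
qed (use approx_1 in auto)

text \<open>Modulo \<open>red\<close> elements each coordinate on the path equals the label of the
  next node, so every factor of \<open>R\<close> becomes a difference of distinct sibling labels.
  This allows \<open>R\<close> to be cancelled from \<open>R * c\<close>.\<close>

lemma approx_R:
  assumes "f \<in> parents T" shows "\<exists>c. approx R c"
proof -
  have "\<exists>c. approx (R_poly T e) c" if "e \<in> nodes T" "(e, f) \<in> tree_le T" for e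
    using that
  proof (induction rule: tree_induct)
    case root
    show ?case unfolding R_poly_root[OF rooted] using approx_1 by blast
  next
    case (par e)
    have p: "par T e \<in> anc T e" by (rule par_anc[OF par(1,2)])
    hence pf: "(par T e, f) \<in> tree_le T" using par(4) le_trans by (auto simp: anc_iff)
    have Yp: "Var_par T (par T e) \<in> gen E"
    proof -
      have "anc T (par T e) \<subseteq> E"
        using f(3) anc_trans[of _ "par T e" f] pf by (cases "par T e = f") (auto simp: anc_iff)
      thus ?thesis using Var_par_gen[of "par T e"] gen_mono anc_nodes[OF p] by blast
    qed
    have "\<exists>c. approx (S_poly T (par T e) {e}) c"
      unfolding S_poly_def
    proof (rule approx_prod)
      fix g assume g: "g \<in> child T (par T e) - {e}"
      have "e \<in> child T (par T e)" using par by (simp add: child_iff')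
      hence "lb T g \<noteq> lb T e" using g inj_lb_child[of "par T e"] by (auto simp: inj_on_def)
      moreover have "Var_par T (par T e) - Const [:lb T g:] - Const [:lb T e - lb T g:]
          = Var_par T (par T e) - Const [:lb T e:]"
        using CC.hom_diff[of "lb T e" "lb T g"] by simp
      ultimately have "approx (Var_par T (par T e) - Const [:lb T g:]) (lb T e - lb T g)"
        unfolding approx_def using red_label[OF assms par(2,4)] Yp by (auto intro: G.diff_mem gen_Const)
      thus "\<exists>c. approx (Var_par T (par T e) - Const [:lb T g:]) c" by blast
    qed
    thus ?case using approx_mult par(3)[OF pf] R_poly_rec[OF rooted par(1,2)] by metis
  qed
  thus ?thesis using f(1) le_refl by blast
qed

text \<open>\<open>h * X_f\<close> evaluates to the value of \<open>Q_poly T f\<close>, an element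
  of \<open>C\<close>, so each power of \<open>X_f\<close> costs one power of
  \<open>h\<close>.\<close>

lemma bounded_pole:
  assumes "f \<in> parents T" "\<And>i. Polynomial.coeff q i \<in> gen E" "degree q \<le> n"
  shows "h ^ n * \<pi> (poly q (Var (Some f))) \<in> C"
  using assms(2,3)
proof (induction n arbitrary: q)
  case 0
  then obtain a where "q = [:a:]" by (metis degree_eq_zeroE le_zero_eq)
  thus ?case using 0(1)[of 0] by simp
next
  case (Suc n)
  obtain a q' where q: "q = pCons a q'" by (cases q) auto
  have "Polynomial.coeff q' i \<in> gen E" for i using Suc(2)[of "Suc i"] by (simp add: q)
  moreover have "degree q' \<le> n" using Suc(3) by (auto simp: q split: if_splits)
  ultimately have "h ^ n * \<pi> (poly q' (Var (Some f))) \<in> C" using Suc.IH by blast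
  moreover have "h ^ Suc n * \<pi> (poly q (Var (Some f))) =
      h ^ Suc n * \<pi> a + \<pi> (Q_poly T f) * (h ^ n * \<pi> (poly q' (Var (Some f))))"
    by (simp add: q algebra_simps flip: \<pi>_Q[OF assms(1)])
  moreover have "\<pi> a \<in> C" using Suc(2)[of 0] by (simp add: q)
  ultimately show ?case by (auto intro!: C.mems)
qed

text \<open>After multiplication by \<open>h ^ Suc n\<close> the relation says that
  \<open>c * Q_poly T f ^ Suc n\<close> is divisible by \<open>h\<close> in \<open>C\<close>. On the
  component of \<open>f\<close>, \<open>Q_poly T f\<close> is \<open>r\<close> times a nonzero
  polynomial in \<open>Y\<close>, so \<open>c\<close> vanishes there by
  \<open>Y_transcendental\<close>. Hence \<open>R * c\<close> is \<open>red\<close>, and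
  \<open>R\<close> is a nonzero constant modulo \<open>red\<close> elements.\<close>

lemma leading_coeff_red:
  assumes fp: "f \<in> parents T" and q: "\<And>i. Polynomial.coeff q i \<in> gen E" "degree q \<le> n"
    and c: "c \<in> gen E" and zero: "\<pi> (poly q (Var (Some f)) + c * Var (Some f) ^ Suc n) = 0"
  shows "red c"
proof -
  define S where "S = (\<Prod>c\<in>lb T ` child T f. [:- c, 1:])"
  have S0: "S \<noteq> 0" unfolding S_def using finite_child by (simp add: prod_zero_iff)
  have Q: "\<pi> (Q_poly T f) = keval S y * r"
    by (simp add: Q_poly_def \<pi>_S B.lin_peval S_def)
  define w where "w = h ^ n * \<pi> (poly q (Var (Some f)))"
  have w: "w \<in> C" unfolding w_def by (rule bounded_pole[OF fp q])
  have "h ^ Suc n * \<pi> (poly q (Var (Some f)) + c * Var (Some f) ^ Suc n) = h * w + \<pi> c * (h * \<xi> (Some f)) ^ Suc n"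
    unfolding power_mult_distrib by (simp add: w_def algebra_simps)
  hence cQ: "\<pi> c * \<pi> (Q_poly T f) ^ Suc n = h * (- w)"
    unfolding zero \<pi>_Q[OF fp] by (simp add: add_eq_0_iff)
  obtain g where g: "near (R * (c - CC.peval g Y))" using good[OF c] by blast
  then obtain v where v: "v \<in> C" "r * \<pi> c = r * keval g y + h * v"
    using near_\<pi> by (fastforce simp: \<pi>_peval algebra_simps)
  have Sn: "\<pi> (Q_poly T f) ^ Suc n = keval (S ^ Suc n) y * r ^ Suc n"
    unfolding Q power_mult_distrib B.k.peval_power ..
  have "r * (- (h * w)) = (r * \<pi> c) * \<pi> (Q_poly T f) ^ Suc n"
    using cQ by (simp add: mult.assoc)
  also have "\<dots> = r ^ Suc n * r * keval (g * S ^ Suc n) y + h * (v * \<pi> (Q_poly T f) ^ Suc n)"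
    unfolding v(2) B.k.peval_mult distrib_right by (simp only: Sn mult_ac)
  finally have "r ^ Suc n * r * keval (g * S ^ Suc n) y = r * (- (h * w)) - h * (v * \<pi> (Q_poly T f) ^ Suc n)"
    by (simp only: add_diff_cancel_right')
  hence "r ^ Suc n * r * keval (g * S ^ Suc n) y = h * (- (v * \<pi> (Q_poly T f) ^ Suc n) - r * w)"
    by (simp only: right_diff_distrib mult_minus_right mult.left_commute) simp
  moreover have "- (v * \<pi> (Q_poly T f) ^ Suc n) - r * w \<in> C"
    using v w by (intro C.diff_mem C.uminus_mem C.mult_mem C.power_mem \<pi>_C R_gen Q_gen)
  moreover have "keval (g * S ^ Suc n) y \<in> C" by (intro C.peval_mem \<pi>_C Y_gen)
  ultimately obtain z where "z \<in> C" "r * keval (g * S ^ Suc n) y = h * z"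
    using C.units_at_cancel[OF C.units_at_power[OF r_unit]] by blast
  hence "g * S ^ Suc n = 0" by (rule Y_transcendental)
  hence "g = 0" using S0 by simp
  hence 1: "red (R * c)" using g red_near[OF fp] by simp
  obtain c' where c': "c' \<noteq> 0" "red (R - Const [:c':])" using approx_R[OF fp] by (auto simp: approx_def)
  have "red (Const [:inverse c':] * (R * c - c * (R - Const [:c':])))"
    by (intro red_mult red_diff 1 c' c gen_Const)
  moreover have "Const [:inverse c':] * Const [:c':] = (1 :: 'n tree_poly)"
    using c' CC.hom_mult[of "inverse c'" c', symmetric] CC.hom_one by simp
  hence "Const [:inverse c':] * (R * c - c * (R - Const [:c':])) = c"
    by (simp add: algebra_simps)
  ultimately show ?thesis by simp
qed

end

section \<open>Kernel by adjoining inner nodes, image by dividing by \<open>h\<close>\<close>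

context tree_presentation
begin

lemma kernel_insert:
  assumes tp: "truncated_presentation T \<iota> D B \<xi> E f" and fp: "f \<in> parents T"
    and IH: "\<And>p. p \<in> gen E \<Longrightarrow> \<pi> p = 0 \<Longrightarrow> p \<in> tree_ideal T"
    and p: "p \<in> gen (insert f E)" "\<pi> p = 0"
  shows "p \<in> tree_ideal T"
proof -
  interpret truncated_presentation T \<iota> D B \<xi> E f by fact
  have main: "poly q (Var (Some f)) \<in> tree_ideal T"
    if "\<forall>i. Polynomial.coeff q i \<in> gen E" "degree q \<le> n" "\<pi> (poly q (Var (Some f))) = 0" for q n
    using that
  proof (induction n arbitrary: q)
    case 0
    then obtain a where "q = [:a:]" by (metis degree_eq_zeroE le_zero_eq)
    thus ?case using 0(1)[rule_format, of 0] 0(3) IH by simp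
  next
    case (Suc n)
    define c where "c = Polynomial.coeff q (Suc n)"
    define q' where "q' = q - Polynomial.monom c (Suc n)"
    have c: "c \<in> gen E" using Suc.prems by (simp add: c_def)
    have q': "\<forall>i. Polynomial.coeff q' i \<in> gen E" "degree q' \<le> n"
    proof -
      show "\<forall>i. Polynomial.coeff q' i \<in> gen E"
        using Suc.prems c by (auto simp: q'_def intro: G.diff_mem)
      show "degree q' \<le> n"
        by (rule degree_le) (use Suc.prems in \<open>auto simp: q'_def c_def coeff_eq_0\<close>)
    qed
    have q: "poly q (Var (Some f)) = poly q' (Var (Some f)) + c * Var (Some f) ^ Suc n"
      by (simp add: q'_def poly_monom)
    have "red c"
      by (rule leading_coeff_red[OF fp q'(1)[rule_format] q'(2) c]) (use Suc.prems(3) q in simp)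
    \<comment> \<open>Trading \<open>c * X_f\<close> for \<open>t\<close> turns the top term of
      degree \<open>Suc n\<close> into \<open>t * X_f ^ n\<close>.\<close>
    then obtain t where t: "t \<in> gen E" "c * Var (Some f) - t \<in> tree_ideal T" by (auto simp: red_def)
    have Vn: "Var (Some f) ^ n \<in> gen (parents T)"
      by (rule type_subring.power_mem[OF type_subring_gen]) (rule gen_Some[OF fp])
    have "Var (Some f) ^ n * (c * Var (Some f) - t) \<in> tree_ideal T" by (rule ideal_mult[OF t(2) Vn])
    moreover have eq: "poly q (Var (Some f)) =
        poly (q' + Polynomial.monom t n) (Var (Some f)) + Var (Some f) ^ n * (c * Var (Some f) - t)"
      unfolding q by (simp add: poly_monom algebra_simps)
    moreover have "poly (q' + Polynomial.monom t n) (Var (Some f)) \<in> tree_ideal T"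
    proof (rule Suc.IH)
      show "\<forall>i. Polynomial.coeff (q' + Polynomial.monom t n) i \<in> gen E"
        using q' t by (auto intro: gen_add)
      show "degree (q' + Polynomial.monom t n) \<le> n"
        by (intro degree_add_le q' degree_monom_le)
      show "\<pi> (poly (q' + Polynomial.monom t n) (Var (Some f))) = 0"
        using Suc.prems(3)[unfolded eq \<pi>.hom_add[of "poly (q' + Polynomial.monom t n) (Var (Some f))"]
            \<pi>_ideal[OF ideal_mult[OF t(2) Vn]]] by (simp only: add_0_right)
    qed
    ultimately show ?case using ideal_add by metis
  qed
  obtain q where "\<forall>i. Polynomial.coeff q i \<in> gen E" "p = poly q (Var (Some f))"
    using gen_insert[OF p(1)] by blast
  thus ?thesis using main[of q "degree q"] p(2) by simp
qed

lemma gen_empty: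
  fixes p :: "'n tree_poly"
  assumes "p \<in> gen {}" shows "\<exists>q. p = type_ring_hom.peval Const q (Var None)"
  using assms
proof induction
  interpret C': type_ring_hom "Const :: _ \<Rightarrow> 'n tree_poly" by (rule type_ring_hom_Const)
  {
    case (gen_Const a)
    show ?case by (rule exI[of _ "[:a:]"]) simp
  next
    case gen_None
    show ?case by (rule exI[of _ "[:0, 1:]"]) simp
  next
    case (gen_Some e)
    thus ?case by simp
  next
    case (gen_add p q)
    thus ?case by (auto simp flip: C'.peval_add)
  next
    case (gen_mult p q)
    thus ?case by (auto simp flip: C'.peval_mult)
  }
qed

lemma kernel_subset:
  assumes "E \<subseteq> parents T" "\<And>e. e \<in> E \<Longrightarrow> anc T e \<subseteq> E" "p \<in> gen E" "\<pi> p = 0"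
  shows "p \<in> tree_ideal T"
  using assms
proof (induction "card E" arbitrary: E p)
  case 0
  have "finite E" using 0(2) finite_nodes by (auto simp: parents_def intro: finite_subset)
  hence "E = {}" using 0(1) by simp
  then obtain q where q: "p = type_ring_hom.peval Const q (Var None)" using gen_empty 0(4) by blast
  have "\<pi> p = B.peval q (\<xi> None)"
    unfolding q using peval_natural[of Const \<iota> \<pi> q "Var None"] type_ring_hom_Const \<iota>_hom
      \<pi>.type_ring_hom_axioms by simp
  hence "q = 0" using transcendental 0(5) by simp
  thus ?case unfolding q using type_ring_hom.peval_0[OF type_ring_hom_Const] ideal_0 by metis
next
  case (Suc n)
  have fin: "finite E" using Suc(2) card.infinite by fastforce
  have "E \<noteq> {}" using Suc(2) by auto
  hence "Max ((\<lambda>y. card (anc T y)) ` E) \<in> (\<lambda>y. card (anc T y)) ` E" using fin by (intro Max_in) auto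
  then obtain f where f: "f \<in> E" "Max ((\<lambda>y. card (anc T y)) ` E) = card (anc T f)" by auto
  have max: "card (anc T y) \<le> card (anc T f)" if "y \<in> E" for y
    unfolding f(2)[symmetric] using that fin by (intro Max_ge) auto
  \<comment> \<open>A deepest node is an ancestor of no other node of \<open>E\<close>: removing it
    keeps the set closed under ancestors and makes \<open>f\<close> a leaf of the truncated
    tree.\<close>
  let ?E = "E - {f}"
  have closed: "anc T e \<subseteq> ?E" if "e \<in> E" for e
  proof
    fix x assume x: "x \<in> anc T e"
    have "x \<noteq> f" using anc_card[OF x] max[OF that] by auto
    thus "x \<in> ?E" using x Suc(4)[OF that] by blast
  qed
  have fp: "f \<in> parents T" using f Suc(3) by blast
  have tp: "truncated_presentation T \<iota> D B \<xi> ?E f"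
    by unfold_locales (use Suc(3) closed f parents_nodes[OF fp] in auto)
  show ?case
  proof (rule kernel_insert[OF tp fp])
    show "p \<in> gen (insert f ?E)" using Suc(5) f(1) by (simp add: insert_absorb)
    show "p \<in> tree_ideal T" if "p \<in> gen ?E" "\<pi> p = 0" for p
      by (rule Suc(1)[of ?E]) (use Suc(2,3) f(1) fin closed that in auto)
  qed (rule Suc(6))
qed

theorem kernel_eq: "p \<in> gen (parents T) \<Longrightarrow> \<pi> p = 0 \<longleftrightarrow> p \<in> tree_ideal T"
  using kernel_subset[of "parents T" p] \<pi>_ideal anc_parents by blast

text \<open>The products \<open>lin y (F - {c})\<close> have no common zero and hence generate the
  unit ideal. Applied to the labels of the children, this passes a membership from all children to
  their parent.\<close>

lemma Lagrange:
  assumes C: "type_subring C" "range k \<subseteq> C" "y \<in> C" and F: "finite F" "F \<noteq> {}"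
    and lin: "\<And>c. c \<in> F \<Longrightarrow> B.lin y (F - {c}) * w \<in> C"
  shows "w \<in> C"
  using F lin
proof (induction F arbitrary: w rule: finite_ne_induct)
  case (singleton c)
  thus ?case by simp
next
  case (insert a F)
  interpret C: type_subring C by fact
  have 1: "(y - k a) * w \<in> C"
  proof (rule insert.IH)
    fix c assume c: "c \<in> F"
    have "insert a F - {c} = insert a (F - {c})" using c insert by auto
    hence "B.lin y (insert a F - {c}) = (y - k a) * B.lin y (F - {c})"
      using insert by (simp add: B.lin_def)
    thus "B.lin y (F - {c}) * ((y - k a) * w) \<in> C"
      using insert.prems[of c] c by (simp add: mult_ac)
  qed
  \<comment> \<open>Division by \<open>y - k a\<close>: the remainder is the value of the product at
    \<open>a\<close>, which is nonzero since \<open>a\<close> is not in \<open>F\<close>.\<close>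
  have "\<exists>m\<in>C. \<exists>c. c \<noteq> 0 \<and> B.lin y F = k c + m * (y - k a)"
    using insert.hyps(1,3)
  proof (induction F rule: finite_induct)
    case empty
    show ?case by (rule bexI[of _ 0]) (auto intro!: exI[of _ 1])
  next
    case (insert b F)
    then obtain m c where m: "m \<in> C" "c \<noteq> 0" "B.lin y F = k c + m * (y - k a)" by auto
    have "B.lin y (insert b F) = ((y - k a) + k (a - b)) * (k c + m * (y - k a))"
      using insert(1,2) m(3) by (simp add: B.lin_def)
    also have "\<dots> = k ((a - b) * c) + (k c + m * (y - k b)) * (y - k a)"
      by (simp add: algebra_simps)
    finally show ?case using m C insert by (intro bexI[of _ "k c + m * (y - k b)"] exI[of _ "(a - b) * c"]) (auto intro!: C.mems)
  qed
  then obtain m c where m: "m \<in> C" "c \<noteq> 0" "B.lin y F = k c + m * (y - k a)" by auto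
  have "B.lin y F * w \<in> C" using insert.prems[of a] insert.hyps by simp
  moreover have "k c = B.lin y F - m * (y - k a)" using m by simp
  hence "k c * w = B.lin y F * w - m * ((y - k a) * w)" by (simp only: left_diff_distrib mult.assoc)
  ultimately have "k (inverse c) * (k c * w) \<in> C" using m 1 C by (auto intro!: C.mems)
  moreover have "k (inverse c) * (k c * w) = k (inverse c * c) * w" by (simp only: B.k.hom_mult mult.assoc)
  ultimately show ?case using m by simp
qed

text \<open>At a leaf, \<open>R_poly * p\<close> agrees modulo \<open>h\<close> with
  \<open>R_poly\<close> times a polynomial in the coordinate, which \<open>\<pi>_leaf\<close> forces
  to be zero; so \<open>R_poly\<close> times \<open>b\<close> lies in the image.
  \<open>Lagrange\<close> carries this from children to parents up to the root, where
  \<open>R_poly\<close> is 1.\<close>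

lemma divide_h:
  assumes p: "p \<in> gen (parents T)" and b: "b \<in> B" "\<pi> p = h * b"
  shows "b \<in> \<pi> ` gen (parents T)"
proof -
  define C where "C = \<pi> ` gen (parents T)"
  have leaf: "\<pi> (R_poly T f) * b \<in> C" if f: "f \<in> leaves T" for f
  proof -
    interpret t: truncated_presentation T \<iota> D B \<xi> "parents T" f
      by unfold_locales (use f leaf_iff anc_parents in auto)
    obtain g where g: "t.near (R_poly T f * (p - CC.peval g (Var_par T f)))" using t.good[OF p] by blast
    then obtain w where w: "w \<in> t.C" "\<pi> (R_poly T f) * (h * b) = \<pi> (R_poly T f) * keval g (\<pi> (Var_par T f)) + h * w"
      using t.near_\<pi> b(2) by (fastforce simp: \<pi>_peval algebra_simps)
    have "\<pi> (R_poly T f) * keval g (\<pi> (Var_par T f)) = h * (\<pi> (R_poly T f) * b - w)"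
      using w(2) by (simp add: algebra_simps)
    moreover have "\<pi> (R_poly T f) * b - w \<in> B"
      using w(1) t.C_B b(1) \<pi>_gen_B[OF _ t.R_gen] by (auto intro!: B.mems)
    ultimately have "g = 0" using \<pi>_leaf[OF f] by blast
    hence "h * (\<pi> (R_poly T f) * b) = h * w" using w(2) by (simp add: mult_ac)
    thus ?thesis using w(1) by (simp add: C_def t.C_def)
  qed
  have sub: "type_subring C" "range k \<subseteq> C"
  proof -
    interpret G: type_subring "gen (parents T)" by (rule type_subring_gen)
    show "type_subring C"
    proof
      show "1 \<in> C" unfolding C_def using \<pi>.hom_one G.one_mem by (metis imageI)
      show "a - b \<in> C" if "a \<in> C" "b \<in> C" for a b
        using that G.diff_mem by (auto simp: C_def simp flip: \<pi>.hom_diff)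
      show "a * b \<in> C" if "a \<in> C" "b \<in> C" for a b
        using that G.mult_mem by (auto simp: C_def simp flip: \<pi>.hom_mult)
    qed
    show "range k \<subseteq> C"
    proof
      fix z assume "z \<in> range k"
      then obtain c where "z = \<pi> (Const [:c:])" by auto
      thus "z \<in> C" unfolding C_def using gen_Const by blast
    qed
  qed
  have "\<pi> (R_poly T e) * b \<in> C" if "e \<in> nodes T" for e
    using that
  proof (induction "card (nodes T) - card (anc T e)" arbitrary: e rule: less_induct)
    case less
    show ?case
    proof (cases "e \<in> parents T")
      case False
      thus ?thesis using less(2) leaf leaf_iff by blast
    next
      case True
      have "anc T e \<subseteq> parents T" using anc_parents by blast
      hence "Var_par T e \<in> gen (parents T)" using Var_par_gen[OF less(2)] gen_mono by blast
      hence y: "\<pi> (Var_par T e) \<in> C" by (simp add: C_def)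
      show ?thesis
      proof (rule Lagrange[OF sub y])
        show "finite (lb T ` child T e)" "lb T ` child T e \<noteq> {}"
          using finite_child parent_has_child[OF True] by auto
        fix c assume "c \<in> lb T ` child T e"
        then obtain g where g: "g \<in> child T e" "c = lb T g" by blast
        have gn: "g \<in> nodes T" "g \<noteq> tree_root T" "par T g = e" using g(1) by (auto simp: child_iff')
        have "anc T g \<subset> nodes T" using anc_nodes gn not_anc_self by blast
        hence "card (anc T g) < card (nodes T)" by (rule psubset_card_mono[OF finite_nodes])
        moreover have "card (anc T e) < card (anc T g)" by (rule anc_card[OF child_anc[OF g(1)]])
        ultimately have "\<pi> (R_poly T g) * b \<in> C" using less(1) gn(1) by auto
        thus "B.lin (\<pi> (Var_par T e)) (lb T ` child T e - {c}) * (\<pi> (R_poly T e) * b) \<in> C"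
          unfolding \<pi>_R_poly[OF gn(1,2)] gn(3) g(2) by (simp add: mult_ac)
      qed
    qed
  qed
  from this[OF root_node] show ?thesis by (simp add: R_poly_root[OF rooted] C_def)
qed

theorem image_eq: "\<pi> ` gen (parents T) = B"
proof (intro equalityI subsetI)
  fix b assume "b \<in> \<pi> ` gen (parents T)"
  thus "b \<in> B" using \<pi>_gen_B[OF subset_refl] by blast
next
  fix b assume "b \<in> B"
  then obtain n q where nq: "h ^ n * b = B.peval q (\<xi> None)" using away_from_h by blast
  have "type_ring_hom.peval Const q (Var None) \<in> gen (parents T)"
  proof (induction q)
    case 0
    show ?case using type_ring_hom.peval_0[OF type_ring_hom_Const]
        type_subring.zero_mem[OF type_subring_gen] by metis
  next
    case (pCons a q)
    thus ?case unfolding type_ring_hom.peval_pCons[OF type_ring_hom_Const]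
      by (intro gen_add gen_mult gen_Const gen_None)
  qed
  moreover have "\<pi> (type_ring_hom.peval Const q (Var None)) = B.peval q (\<xi> None)"
    using peval_natural[of Const \<iota> \<pi> q "Var None"] type_ring_hom_Const \<iota>_hom
      \<pi>.type_ring_hom_axioms by simp
  ultimately have "h ^ n * b \<in> \<pi> ` gen (parents T)" unfolding nq by (metis imageI)
  thus "b \<in> \<pi> ` gen (parents T)"
  proof (induction n)
    case (Suc n)
    then obtain p where "p \<in> gen (parents T)" "\<pi> p = h * (h ^ n * b)" by (auto simp: mult_ac)
    moreover have "h ^ n * b \<in> B" using \<open>b \<in> B\<close> by (intro B.mult_mem B.power_mem B.h_mem)
    ultimately show ?case using divide_h Suc.IH by blast
  qed simp
qed

end

section \<open>The tree of a surface with reduced special fibre\<close>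

locale path_tree =
  fixes N :: "complex list set" and en :: "complex list \<Rightarrow> 'n"
  assumes finite_N: "finite N" and Nil_N: "[] \<in> N" and Cons_N: "\<And>c e. c # e \<in> N \<Longrightarrow> e \<in> N"
    and inj_en: "inj_on en N"
begin

text \<open>A node is the list of labels from it back to the root, newest first. The order is
  therefore \<open>suffix\<close>, the parent drops the head, and siblings carry distinct labels
  automatically. \<open>en\<close> transports the nodes to the desired type.\<close>

definition T :: "'n labelled_tree" where
  "T = \<lparr>nodes = en ` N, tree_le = {(en a, en b) | a b. a \<in> N \<and> b \<in> N \<and> suffix a b},
        lb = (\<lambda>n. hd (the_inv_into N en n))\<rparr>"

lemma nodes_T: "nodes T = en ` N" by (simp add: T_def)

lemma lb_T: "c # e \<in> N \<Longrightarrow> lb T (en (c # e)) = c"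
  by (simp add: T_def the_inv_into_f_f[OF inj_en])

lemma en_eq: "a \<in> N \<Longrightarrow> b \<in> N \<Longrightarrow> en a = en b \<longleftrightarrow> a = b"
  using inj_en by (auto simp: inj_on_def)

lemma le_T: "a \<in> N \<Longrightarrow> b \<in> N \<Longrightarrow> (en a, en b) \<in> tree_le T \<longleftrightarrow> suffix a b"
  by (auto simp: T_def en_eq)

lemma le_TE:
  assumes "(u, v) \<in> tree_le T"
  obtains a b where "u = en a" "v = en b" "a \<in> N" "b \<in> N" "suffix a b"
  using assms by (auto simp: T_def)

lemma rooted_T: "rooted_tree T"
  unfolding rooted_tree_def
proof (intro conjI ballI)
  show "finite (nodes T)" "nodes T \<noteq> {}" using finite_N Nil_N by (auto simp: nodes_T)
  show "partial_order_on (nodes T) (tree_le T)"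
    unfolding partial_order_on_def preorder_on_def
  proof (intro conjI)
    show "tree_le T \<subseteq> nodes T \<times> nodes T" by (auto simp: nodes_T elim: le_TE)
    show "refl_on (nodes T) (tree_le T)" by (auto simp: refl_on_def nodes_T le_T)
    show "trans (tree_le T)"
    proof (rule transI)
      fix u v w assume uv: "(u, v) \<in> tree_le T" and vw: "(v, w) \<in> tree_le T"
      obtain a b where ab: "u = en a" "v = en b" "a \<in> N" "b \<in> N" "suffix a b" using uv by (rule le_TE)
      obtain b' c where bc: "v = en b'" "w = en c" "b' \<in> N" "c \<in> N" "suffix b' c" using vw by (rule le_TE)
      show "(u, w) \<in> tree_le T" using ab bc en_eq[of b b'] by (auto simp: le_T intro: suffix_order.trans)
    qed
    show "antisym (tree_le T)"
    proof (rule antisymI)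
      fix u v assume uv: "(u, v) \<in> tree_le T" and vu: "(v, u) \<in> tree_le T"
      obtain a b where ab: "u = en a" "v = en b" "a \<in> N" "b \<in> N" "suffix a b" using uv by (rule le_TE)
      thus "u = v" using vu suffix_order.antisym[of a b] by (simp add: le_T)
    qed
  qed
  show "\<exists>!e. minimal_in (tree_le T) (nodes T) e"
  proof (rule ex1I)
    show "minimal_in (tree_le T) (nodes T) (en [])"
      using Nil_N by (auto simp: minimal_in_def nodes_T le_T)
    fix e assume "minimal_in (tree_le T) (nodes T) e"
    thus "e = en []" using Nil_N by (auto simp: minimal_in_def nodes_T le_T)
  qed
  fix e u v assume "e \<in> nodes T" "u \<in> down T e" "v \<in> down T e"
  then obtain l a b where "e = en l" "u = en a" "v = en b" "l \<in> N" "a \<in> N" "b \<in> N" "suffix a l" "suffix b l"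
    by (auto simp: down_def nodes_T le_T)
  thus "(u, v) \<in> tree_le T \<or> (v, u) \<in> tree_le T"
    using suffix_same_cases[of a l b] by (auto simp: le_T)
qed

lemma root_T: "tree_root T = en []"
proof -
  have "(tree_root T, en []) \<in> tree_le T" using root_least[OF rooted_T] Nil_N by (simp add: nodes_T)
  thus ?thesis using Nil_N by (auto elim!: le_TE simp: en_eq)
qed

lemma par_T:
  assumes "c # e \<in> N" shows "par T (en (c # e)) = en e"
proof -
  have e: "e \<in> N" by (rule Cons_N[OF assms])
  have n: "en (c # e) \<in> nodes T" "en (c # e) \<noteq> tree_root T"
    using assms Nil_N by (auto simp: nodes_T root_T en_eq)
  note p = par_greatest[OF rooted_T n]
  obtain q where q: "par T (en (c # e)) = en q" "q \<in> N" "suffix q (c # e)" "en q \<noteq> en (c # e)"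
    using p(1) assms by (auto simp: anc_def down_def nodes_T le_T)
  have "en e \<in> anc T (en (c # e))"
    using e assms en_eq[OF e assms] by (auto simp: anc_def down_def nodes_T le_T suffix_Cons)
  hence "(en e, en q) \<in> tree_le T" using p(2) unfolding q(1) by blast
  hence "suffix e q" using q e by (simp add: le_T)
  moreover have "suffix q e" using q by (auto simp: suffix_Cons)
  ultimately show ?thesis using q(1) suffix_order.antisym by metis
qed

lemma node_T_cases:
  assumes "f \<in> nodes T" "f \<noteq> tree_root T"
  obtains c e where "c # e \<in> N" "f = en (c # e)"
proof -
  obtain l where l: "l \<in> N" "f = en l" using assms by (auto simp: nodes_T)
  moreover have "l \<noteq> []" using l assms by (auto simp: root_T)
  ultimately show ?thesis using that by (cases l) auto
qed

lemma child_T: "e \<in> N \<Longrightarrow> child T (en e) = (\<lambda>c. en (c # e)) ` {c. c # e \<in> N}"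
proof (intro equalityI subsetI)
  fix f assume e: "e \<in> N" and "f \<in> child T (en e)"
  hence f: "f \<in> nodes T" "f \<noteq> tree_root T" "par T f = en e" by (simp_all add: child_iff[OF rooted_T])
  obtain c e' where "c # e' \<in> N" "f = en (c # e')" using node_T_cases[OF f(1,2)] .
  thus "f \<in> (\<lambda>c. en (c # e)) ` {c. c # e \<in> N}"
    using f(3) par_T[of c e'] e Cons_N[of c e'] by (auto simp: en_eq)
next
  fix f assume "e \<in> N" "f \<in> (\<lambda>c. en (c # e)) ` {c. c # e \<in> N}"
  thus "f \<in> child T (en e)"
    using Nil_N by (auto simp: child_iff[OF rooted_T] nodes_T root_T en_eq par_T)
qed

lemma fine_T: "fine_labelled_tree T"
  unfolding fine_labelled_tree_def
proof (intro conjI ballI impI rooted_T, elim conjE)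
  fix f g assume f: "f \<in> nodes T - {tree_root T}" "g \<in> nodes T - {tree_root T}" and "f \<noteq> g" "par T f = par T g"
  obtain c e where 1: "c # e \<in> N" "f = en (c # e)" using node_T_cases[of f] f by blast
  obtain c' e' where 2: "c' # e' \<in> N" "g = en (c' # e')" using node_T_cases[of g] f by blast
  have "e = e'" using \<open>par T f = par T g\<close> 1 2 Cons_N par_T by (simp add: en_eq)
  thus "lb T f \<noteq> lb T g" using \<open>f \<noteq> g\<close> 1 2 lb_T by auto
qed

lemma leaf_T: "e \<in> N \<Longrightarrow> en e \<in> leaves T \<Longrightarrow> c # e \<notin> N"
proof
  assume e: "e \<in> N" "en e \<in> leaves T" "c # e \<in> N"
  hence "(en e, en (c # e)) \<in> tree_le T" by (simp add: le_T suffix_Cons)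
  hence "en (c # e) = en e" using e by (auto simp: leaves_def maximal_in_def nodes_T)
  thus False using e by (simp add: en_eq)
qed

lemma parent_T: "e \<in> N \<Longrightarrow> en e \<in> parents T \<Longrightarrow> \<exists>c. c # e \<in> N"
proof -
  interpret L: labelled_rooted_tree T by unfold_locales (rule fine_T)
  show "e \<in> N \<Longrightarrow> en e \<in> parents T \<Longrightarrow> \<exists>c. c # e \<in> N"
    using L.parent_has_child[of "en e"] child_T by auto
qed

end

text \<open>
  The coordinate ring of a surface with reduced special fibre \<open>h = 0\<close> that is the affine
  line over \<open>\<complex>[h, 1/h]\<close> with coordinate \<open>x\<close>.
\<close>

locale reduced_fibre_surface = Ch_sub \<iota> D B
  for \<iota> :: "complex poly \<Rightarrow> 'r::idom" and D and B +
  fixes x :: 'r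
  assumes x: "x \<in> B" "D x = 1"
    and inj_\<iota>: "\<And>a. \<iota> a = 0 \<Longrightarrow> a = 0"
    and invert_h: "\<And>b. b \<in> B \<Longrightarrow> \<exists>n q. h ^ n * b = peval q x"
    and D_bounded: "\<exists>N. \<forall>b\<in>B. h ^ N * D b \<in> B"
    and h_nonunit: "\<And>w. w \<in> B \<Longrightarrow> h * w \<noteq> 1"
    and reduced: "\<And>b w n. b \<in> B \<Longrightarrow> w \<in> B \<Longrightarrow> b ^ n = h * w \<Longrightarrow> \<exists>v\<in>B. b = h * v"
begin

lemma D_peval_\<iota>: "D (peval q b) = peval (pderiv q) b * D b"
  by (induction q) (auto simp: D_add D_mult D_const pderiv_pCons peval_add algebra_simps)

lemma x_transcendental: "peval q x = 0 \<Longrightarrow> q = 0"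
proof (induction "degree q" arbitrary: q rule: less_induct)
  case less
  show ?case
  proof (cases "degree q = 0")
    case True
    then obtain a where "q = [:a:]" by (metis degree_eq_zeroE)
    thus ?thesis using less(2) inj_\<iota> by simp
  next
    case False
    have "peval (pderiv q) x = 0" using D_peval_\<iota>[of q x] less(2) x by simp
    moreover have "degree (pderiv q) < degree q" using False by (simp add: degree_pderiv)
    ultimately have "pderiv q = 0" using less(1) by blast
    thus ?thesis using False by (simp add: pderiv_eq_0_iff)
  qed
qed

section \<open>Values on the special fibre and the recursive construction of the nodes\<close>

definition in_h :: "'r \<Rightarrow> bool" where "in_h b \<longleftrightarrow> (\<exists>w\<in>B. b = h * w)"

lemma in_h_mult: "in_h b \<Longrightarrow> c \<in> B \<Longrightarrow> in_h (c * b)"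
proof -
  assume "in_h b" "c \<in> B"
  then obtain w where "w \<in> B" "c * b = h * (c * w)" by (auto simp: in_h_def mult_ac)
  thus ?thesis using \<open>c \<in> B\<close> mult_mem by (auto simp: in_h_def)
qed

definition divide_h :: "'r \<Rightarrow> 'r" where "divide_h b = (SOME w. w \<in> B \<and> b = h * w)"

lemma divide_h:
  assumes "in_h b" shows "divide_h b \<in> B" "h * divide_h b = b"
proof -
  have "\<exists>w. w \<in> B \<and> b = h * w" using assms by (auto simp: in_h_def)
  from someI_ex[OF this] show "divide_h b \<in> B" "h * divide_h b = b" by (auto simp: divide_h_def)
qed

definition annihilating :: "'r \<Rightarrow> 'r \<Rightarrow> complex set \<Rightarrow> bool" where
  "annihilating y r F \<longleftrightarrow> finite F \<and> in_h (lin y F * r)"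

text \<open>
  The values of \<open>y\<close> on the part of the fibre where \<open>r\<close> does not vanish; the empty set if
  \<open>y\<close> is transcendental there.
\<close>

definition labels :: "'r \<Rightarrow> 'r \<Rightarrow> complex set" where
  "labels y r = (if \<exists>F. annihilating y r F then arg_min card (annihilating y r) else {})"

lemma labels:
  assumes "annihilating y r F0"
  shows "annihilating y r (labels y r)" "\<And>F. annihilating y r F \<Longrightarrow> card (labels y r) \<le> card F"
  unfolding labels_def
  using assms arg_min_nat_lemma[of "annihilating y r" F0 card] by auto

lemma labels_nonempty: "labels y r \<noteq> {} \<Longrightarrow> annihilating y r (labels y r)"
proof -
  assume "labels y r \<noteq> {}"
  then obtain F where "annihilating y r F" unfolding labels_def by (metis (full_types))
  thus ?thesis by (rule labels(1))
qed

lemma finite_labels: "finite (labels y r)"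
  using labels_nonempty annihilating_def by (cases "labels y r = {}") auto

text \<open>The purpose of choosing a smallest annihilating set: the function \<open>R\<close> of
  each child is then not divisible by \<open>h\<close>, so every node has a component to live
  on.\<close>

lemma labels_minimal:
  assumes "c \<in> labels y r" shows "\<not> in_h (lin y (labels y r - {c}) * r)"
proof
  assume "in_h (lin y (labels y r - {c}) * r)"
  hence "annihilating y r (labels y r - {c})" by (simp add: annihilating_def finite_labels)
  from labels(2)[OF this this] show False
    using card_Diff1_less[OF finite_labels assms] by simp
qed

text \<open>The relation \<open>g\<close> may have multiple roots; a power of the product over its
  distinct roots is a multiple of it, and reducedness of the fibre removes the power.\<close>

lemma in_h_peval_imp_annihilating:
  assumes y: "y \<in> B" and r: "r \<in> B" and g: "g \<noteq> 0" "in_h (r * k.peval g y)"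
  shows "\<exists>F. annihilating y r F"
proof -
  define F where "F = {z. poly g z = 0}"
  have F: "finite F" unfolding F_def using g(1) by (rule poly_roots_finite)
  define m where "m = degree g"
  have "g = Polynomial.smult (lead_coeff g) (\<Prod>z\<in>F. [:- z, 1:] ^ order z g)"
    using complex_poly_decompose[of g] by (simp add: F_def)
  hence "k.peval g y = k (lead_coeff g) * k.peval (\<Prod>z\<in>F. [:- z, 1:] ^ order z g) y"
    using k.peval_smult by metis
  hence gy: "k.peval g y = k (lead_coeff g) * (\<Prod>z\<in>F. (y - k z) ^ order z g)"
    by (simp add: k.peval_prod k.peval_power)
  define G where "G = (\<Prod>z\<in>F. (y - k z) ^ (m - order z g))"
  have GB: "G \<in> B" unfolding G_def using y by (auto intro!: mems)
  have "lin y F ^ m = (\<Prod>z\<in>F. (y - k z) ^ order z g * (y - k z) ^ (m - order z g))"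
    unfolding lin_def prod_power_distrib
    by (intro prod.cong refl) (use order_degree[OF g(1)] in \<open>simp add: m_def flip: power_add\<close>)
  also have "\<dots> = (\<Prod>z\<in>F. (y - k z) ^ order z g) * G" by (simp add: prod.distrib G_def)
  finally have "k (lead_coeff g) * lin y F ^ m = k.peval g y * G" by (simp add: gy)
  moreover have "k (inverse (lead_coeff g)) * k (lead_coeff g) = 1" using g(1) by (simp flip: k.hom_mult)
  ultimately have lm: "lin y F ^ m = k (inverse (lead_coeff g)) * (k.peval g y * G)"
    by (metis mult.assoc mult_1)
  \<comment> \<open>Every root has order at most \<open>m = degree g\<close>, so
    \<open>lin y F ^ m\<close> absorbs \<open>k.peval g y\<close>. The exponent \<open>Suc m\<close>
    also guarantees a factor \<open>r\<close> when \<open>m = 0\<close>.\<close>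
  have "(lin y F * r) ^ Suc m = (r ^ m * lin y F) * r * lin y F ^ m"
    by (simp add: power_mult_distrib mult_ac)
  also have "\<dots> = (r ^ m * lin y F * k (inverse (lead_coeff g)) * G) * (r * k.peval g y)"
    unfolding lm by (simp add: mult_ac)
  finally have eq: "(lin y F * r) ^ Suc m = \<dots>" .
  have "in_h ((lin y F * r) ^ Suc m)"
    unfolding eq by (intro in_h_mult g mult_mem power_mem lin_mem k_mem y r GB)
  then obtain w where w: "w \<in> B" "(lin y F * r) ^ Suc m = h * w" unfolding in_h_def by blast
  have "in_h (lin y F * r)"
    unfolding in_h_def by (rule reduced[OF mult_mem[OF lin_mem[OF y] r] w])
  thus ?thesis using F by (auto simp: annihilating_def)
qed

text \<open>The pair consists of a coordinate and the function that singles out its component. All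
  children of \<open>e\<close> share the coordinate and differ only in the second entry.\<close>

fun YR :: "complex list \<Rightarrow> 'r \<times> 'r" where
  "YR [] = (x, 1)"
| "YR (c # e) = (let (y, r) = YR e; F = labels y r in (divide_h (lin y F * r), lin y (F - {c}) * r))"

definition Y :: "complex list \<Rightarrow> 'r" where "Y e = fst (YR e)"
definition R :: "complex list \<Rightarrow> 'r" where "R e = snd (YR e)"
abbreviation "ch e \<equiv> labels (Y e) (R e)"
definition Xn :: "complex list \<Rightarrow> 'r" where "Xn e = divide_h (lin (Y e) (ch e) * R e)"

lemma Y_Nil [simp]: "Y [] = x" and R_Nil [simp]: "R [] = 1"
  and Y_Cons: "Y (c # e) = Xn e" and R_Cons: "R (c # e) = lin (Y e) (ch e - {c}) * R e"
  by (simp_all add: Y_def R_def Xn_def Let_def split: prod.splits)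

inductive_set N :: "complex list set" where
  N_Nil: "[] \<in> N"
| N_Cons: "e \<in> N \<Longrightarrow> c \<in> ch e \<Longrightarrow> c # e \<in> N"

lemma N_Cons_iff: "c # e \<in> N \<longleftrightarrow> e \<in> N \<and> c \<in> ch e"
  using N.cases[of "c # e"] N_Cons by blast

lemma Xn:
  assumes "ch e \<noteq> {}" shows "Xn e \<in> B" "h * Xn e = lin (Y e) (ch e) * R e"
  using labels_nonempty[OF assms] divide_h by (auto simp: annihilating_def Xn_def)

lemma N_inv: "e \<in> N \<Longrightarrow> chainok (length e) (Y e) (R e) \<and> \<not> in_h (R e)"
proof (induction rule: N.induct)
  case N_Nil
  show ?case using x h_nonunit by (auto simp: chainok_0 in_h_def)
next
  case (N_Cons e c)
  hence ne: "ch e \<noteq> {}" by blast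
  show ?case
    using chainok_step[OF _ finite_labels N_Cons(2) Xn[OF ne]] N_Cons labels_minimal
    by (simp add: Y_Cons R_Cons)
qed

lemma finite_N: "finite N"
proof -
  obtain M where M: "\<And>b. b \<in> B \<Longrightarrow> h ^ M * D b \<in> B" using D_bounded by blast
  have len: "length e \<le> M" if "e \<in> N" for e
    using chainok_depth[of "length e" "Y e" "R e" M] N_inv[OF that] M by (auto simp: in_h_def)
  have fin: "finite {e \<in> N. length e = n}" for n
  proof (induction n)
    case 0
    have "{e \<in> N. length e = 0} \<subseteq> {[]}" by auto
    thus ?case by (rule finite_subset) simp
  next
    case (Suc n)
    have "{e \<in> N. length e = Suc n} \<subseteq> (\<Union>e\<in>{e \<in> N. length e = n}. (\<lambda>c. c # e) ` ch e)"
      by (auto simp: length_Suc_conv N_Cons_iff)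
    thus ?case by (rule finite_subset) (use Suc finite_labels in auto)
  qed
  have "N \<subseteq> (\<Union>n\<le>M. {e \<in> N. length e = n})" using len by auto
  thus ?thesis by (rule finite_subset) (use fin in auto)
qed

theorem exists_presentation:
  "\<exists>(T :: nat labelled_tree) \<xi>. fine_labelled_tree T \<and> tree_presentation T \<iota> D B \<xi> \<and> \<xi> None = x"
proof -
  obtain en :: "complex list \<Rightarrow> nat" where en: "inj_on en N"
    using finite_imp_inj_to_nat_seg[OF finite_N] by blast
  interpret P: path_tree N en
    by unfold_locales (auto simp: finite_N N_Nil N_Cons_iff en)
  define \<xi> where "\<xi> v = (case v of None \<Rightarrow> x | Some n \<Rightarrow> Xn (the_inv_into N en n))" for v
  have \<xi>: "\<xi> None = x" "\<And>e. e \<in> N \<Longrightarrow> \<xi> (Some (en e)) = Xn e"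
    by (simp_all add: \<xi>_def the_inv_into_f_f[OF en])
  interpret E: tree_evaluation P.T \<iota> D \<xi> by unfold_locales (rule P.fine_T)
  have Ypi: "E.\<pi> (Var_par P.T (en e)) = Y e" if "e \<in> N" for e
  proof (cases e)
    case Nil
    thus ?thesis by (simp add: Var_par_def P.root_T \<xi>)
  next
    case (Cons c e')
    hence "e' \<in> N" using that by (simp add: N_Cons_iff)
    thus ?thesis using that Cons P.par_T[of c e'] N_Nil
      by (simp add: Var_par_def P.root_T \<xi> P.en_eq Y_Cons)
  qed
  have lbch: "lb P.T ` child P.T (en e) = ch e" if "e \<in> N" for e
  proof -
    have "lb P.T ` child P.T (en e) = (\<lambda>c. lb P.T (en (c # e))) ` {c. c # e \<in> N}"
      by (simp add: P.child_T[OF that] image_image)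
    also have "\<dots> = {c. c # e \<in> N}" by (auto simp: P.lb_T)
    finally show ?thesis using that by (simp add: N_Cons_iff)
  qed
  have Rpi: "E.\<pi> (R_poly P.T (en e)) = R e" if "e \<in> N" for e
    using that
  proof (induction e rule: list.induct)
    case Nil
    show ?case using R_poly_root[OF P.rooted_T] by (simp add: P.root_T)
  next
    case (Cons c e)
    have e: "e \<in> N" using Cons(2) by (simp add: N_Cons_iff)
    have "en (c # e) \<in> nodes P.T" "en (c # e) \<noteq> tree_root P.T"
      using Cons(2) N_Nil by (auto simp: P.nodes_T P.root_T P.en_eq)
    from E.\<pi>_R_poly[OF this] show ?case
      by (simp add: P.par_T[OF Cons(2)] Ypi[OF e] lbch[OF e] P.lb_T[OF Cons(2)] Cons(1)[OF e] R_Cons)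
  qed
  have "tree_presentation P.T \<iota> D B \<xi>"
  proof unfold_locales
    show "\<xi> None \<in> B" "D (\<xi> None) = 1" using x by (simp_all add: \<xi>)
    show "q = 0" if "peval q (\<xi> None) = 0" for q using that x_transcendental by (simp add: \<xi>)
    show "\<exists>n q. h ^ n * b = peval q (\<xi> None)" if "b \<in> B" for b using invert_h[OF that] by (simp add: \<xi>)
    show "\<xi> (Some n) \<in> B" "h * \<xi> (Some n) = E.\<pi> (Q_poly P.T n)" if n: "n \<in> parents P.T" for n
    proof -
      obtain e where e: "e \<in> N" "n = en e" using n by (auto simp: parents_def P.nodes_T)
      have "ch e \<noteq> {}" using P.parent_T[OF e(1)] n e by (auto simp: N_Cons_iff)
      from Xn[OF this] show "\<xi> (Some n) \<in> B" "h * \<xi> (Some n) = E.\<pi> (Q_poly P.T n)"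
        using e lbch[OF e(1)] by (simp_all add: \<xi> Q_poly_def E.\<pi>_S Ypi Rpi)
    qed
    show "E.\<pi> (R_poly P.T n) \<noteq> h * w" if n: "n \<in> nodes P.T" "w \<in> B" for n w
    proof -
      obtain e where e: "e \<in> N" "n = en e" using n by (auto simp: P.nodes_T)
      thus ?thesis using N_inv[OF e(1)] Rpi n(2) by (auto simp: in_h_def)
    qed
    show "E.\<pi> (R_poly P.T n) * k.peval g (E.\<pi> (Var_par P.T n)) \<noteq> h * w"
      if n: "n \<in> leaves P.T" "g \<noteq> 0" "w \<in> B" for n g w
    proof
      assume eq: "E.\<pi> (R_poly P.T n) * k.peval g (E.\<pi> (Var_par P.T n)) = h * w"
      have "n \<in> nodes P.T" using n(1) by (simp add: leaves_def maximal_in_def)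
      then obtain e where e: "e \<in> N" "n = en e" unfolding P.nodes_T by blast
      have B: "Y e \<in> B" "R e \<in> B" and R: "\<not> in_h (R e)"
        using N_inv[OF e(1)] by (auto simp: chainok_def)
      have "in_h (R e * k.peval g (Y e))"
        using eq n(3) e by (auto simp: in_h_def Ypi Rpi)
      then obtain F where "annihilating (Y e) (R e) F"
        using in_h_peval_imp_annihilating[OF B n(2)] by blast
      \<comment> \<open>At a leaf the label set is empty, so if it annihilated, \<open>R e\<close>
        itself would be divisible by \<open>h\<close>.\<close>
      hence "annihilating (Y e) (R e) (ch e)" by (rule labels(1))
      moreover have "ch e = {}" using P.leaf_T[OF e(1)] n(1) e by (auto simp: N_Cons_iff)
      ultimately show False using R by (simp add: annihilating_def)
    qed
  qed
  thus ?thesis using P.fine_T \<xi>(1) by blast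
qed

end

section \<open>A coordinate away from the special fibre\<close>

definition cst :: "complex poly \<Rightarrow> complex poly fract poly" where
  "cst a = [:Fract a 1:]"

lemma cst_hom: "type_ring_hom cst"
proof
  show "cst 1 = 1" unfolding cst_def One_fract_def[symmetric] by (rule one_pCons[symmetric])
qed (simp_all add: cst_def mult.commute)

lemma cst_eq_0_iff [simp]: "cst a = 0 \<longleftrightarrow> a = 0"
  by (simp add: cst_def Zero_fract_def eq_fract)

lemma complex_poly_root:
  fixes p :: "complex poly"
  assumes "degree p \<noteq> 0" obtains z q where "p = [:- z, 1:] * q" "degree p = Suc (degree q)"
proof -
  obtain z where "poly p z = 0" using fundamental_theorem_of_algebra_alt[of p] assms by fastforce
  then obtain q where q: "p = [:- z, 1:] * q" by (auto simp: poly_eq_0_iff_dvd)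
  hence "q \<noteq> 0" using assms by auto
  hence "degree p = Suc (degree q)" unfolding q by (subst degree_mult_eq) auto
  with q that show ?thesis by blast
qed

text \<open>The form in which the geometry is used: \<open>nonunit\<close> comes from surjectivity
  onto the base, \<open>prime\<close> from integrality of the fibres over
  \<open>c \<noteq> 0\<close>, \<open>pderiv_bounded\<close> from finite generation.\<close>

locale generic_line_subring = type_subring B for B :: "complex poly fract poly set" +
  assumes cst_mem [simp]: "cst a \<in> B"
    and clear_denominators: "\<exists>a. a \<noteq> 0 \<and> cst a * p \<in> B"
    and pderiv_bounded: "\<exists>f. f \<noteq> 0 \<and> (\<forall>b\<in>B. cst f * pderiv b \<in> B)"
    and nonunit: "w \<in> B \<Longrightarrow> cst [:- c, 1:] * w \<noteq> 1"
    and prime: "c \<noteq> 0 \<Longrightarrow> y \<in> B \<Longrightarrow> z \<in> B \<Longrightarrow> w \<in> B \<Longrightarrow> y * z = cst [:- c, 1:] * w \<Longrightarrow>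
      (\<exists>v\<in>B. y = cst [:- c, 1:] * v) \<or> (\<exists>v\<in>B. z = cst [:- c, 1:] * v)"
begin

sublocale cst: type_ring_hom cst by (rule cst_hom)

lemma nonunit': 
  assumes "w \<in> B" "k \<noteq> 0" shows "cst [:- c, 1:] * w \<noteq> cst [:k:]"
proof
  assume eq: "cst [:- c, 1:] * w = cst [:k:]"
  have "cst [:- c, 1:] * (cst [:inverse k:] * w) = cst [:inverse k:] * (cst [:- c, 1:] * w)" by (simp only: mult_ac)
  also have "\<dots> = cst ([:inverse k:] * [:k:])" by (simp only: eq cst.hom_mult)
  also have "[:inverse k:] * [:k:] = 1" using assms by simp
  finally show False using nonunit[of "cst [:inverse k:] * w" c] assms mult_mem by simp
qed

text \<open>The slope is \<open>m / f\<close>. With the common denominator \<open>f\<close> fixed,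
  the degree of the numerator \<open>m\<close> can be minimised.\<close>

definition slope :: "complex poly \<Rightarrow> complex poly fract poly \<Rightarrow> complex poly \<Rightarrow> bool" where
  "slope f x m \<longleftrightarrow> x \<in> B \<and> degree x \<le> 1 \<and> m \<noteq> 0 \<and> cst f * pderiv x = cst m"

lemma exists_slope:
  assumes "f \<noteq> 0" "\<forall>b\<in>B. cst f * pderiv b \<in> B" shows "\<exists>x m. slope f x m"
proof -
  obtain a where a: "a \<noteq> 0" "cst a * [:0, 1:] \<in> B" using clear_denominators by blast
  have "cst f * pderiv (cst a * [:0, 1:]) = cst (f * a)"
    by (simp add: cst_def pderiv_pCons mult.commute)
  moreover have "degree (cst a * [:0, 1:]) \<le> 1" by (simp add: cst_def)
  ultimately have "slope f (cst a * [:0, 1:]) (f * a)" using a assms(1) by (simp add: slope_def)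
  thus ?thesis by blast
qed

lemma pderiv_cst [simp]: "pderiv (cst a) = 0" by (simp add: cst_def pderiv_pCons)

lemma pderiv_cst_mult: "pderiv (cst a * b) = cst a * pderiv b" by (simp add: pderiv_mult)

text \<open>
  The element \<open>x\<close> of least slope: subtracting a constant and dividing by \<open>h - c\<close> would
  lower the slope, so \<open>x\<close> is not constant on any fibre.
\<close>

lemma exists_coordinate:
  "\<exists>f x m. f \<noteq> 0 \<and> (\<forall>b\<in>B. cst f * pderiv b \<in> B) \<and> slope f x m \<and>
     (\<forall>c a. \<forall>w\<in>B. x - cst [:a:] \<noteq> cst [:- c, 1:] * w)"
proof -
  obtain f where f: "f \<noteq> 0" "\<forall>b\<in>B. cst f * pderiv b \<in> B" using pderiv_bounded by blast
  define P where "P n \<longleftrightarrow> (\<exists>x m. slope f x m \<and> degree m = n)" for n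
  have "\<exists>n. P n" using exists_slope[OF f] by (auto simp: P_def)
  from LeastI_ex[OF this] obtain x m where x: "slope f x m" "degree m = (LEAST n. P n)"
    by (auto simp: P_def)
  have "x - cst [:a:] \<noteq> cst [:- c, 1:] * w" if w: "w \<in> B" for c a w
  proof
    assume eq: "x - cst [:a:] = cst [:- c, 1:] * w"
    have "pderiv x = cst [:- c, 1:] * pderiv w"
      using arg_cong[OF eq, of pderiv] by (simp add: pderiv_diff pderiv_cst_mult)
    hence 1: "cst [:- c, 1:] * (cst f * pderiv w) = cst m"
      using x(1) by (simp add: slope_def mult_ac)
    \<comment> \<open>The remainder \<open>poly m c\<close> is \<open>h - c\<close> times an element
      of \<open>B\<close>, so it vanishes by \<open>nonunit'\<close>; then \<open>w\<close> has the
      numerator \<open>m'\<close> of smaller degree.\<close>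
    define m' where "m' = synthetic_div m c"
    have m: "m = [:- c, 1:] * m' + [:poly m c:]"
      using synthetic_div_correct'[of c m] by (simp add: m'_def)
    have 2: "cst [:- c, 1:] * (cst f * pderiv w - cst m') = cst [:poly m c:]"
      using 1 by (subst (asm) m) (simp only: cst.hom_add cst.hom_mult, simp add: algebra_simps)
    moreover have "cst f * pderiv w - cst m' \<in> B" using f w by (intro diff_mem cst_mem) auto
    ultimately have "poly m c = 0" using nonunit' by metis
    hence m': "cst f * pderiv w = cst m'" "m = [:- c, 1:] * m'" using 2 m by simp_all
    have "m' \<noteq> 0" using m' x by (auto simp: slope_def)
    moreover have "degree w \<le> 1"
    proof -
      have "degree w = degree (x - cst [:a:])"
        unfolding eq using cst_eq_0_iff[of "[:- c, 1:]"] by (simp add: cst_def)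
      also have "\<dots> \<le> 1" using x(1) by (intro degree_diff_le) (auto simp: slope_def cst_def)
      finally show ?thesis .
    qed
    ultimately have "slope f w m'" using m' w by (simp add: slope_def)
    moreover have "degree m = Suc (degree m')" unfolding m'(2) using \<open>m' \<noteq> 0\<close> by (subst degree_mult_eq) auto
    ultimately show False using Least_le[of P "degree m'"] x(2) by (auto simp: P_def)
  qed
  thus ?thesis using f x(1) by blast
qed

end

section \<open>Inverting \<open>h\<close> and bounding the poles of the derivation\<close>

locale generic_line_coordinate = generic_line_subring +
  fixes f x m
  assumes f: "f \<noteq> 0" "\<And>b. b \<in> B \<Longrightarrow> cst f * pderiv b \<in> B"
    and x: "slope f x m"
    and nonconst: "\<And>c a w. w \<in> B \<Longrightarrow> x - cst [:a:] \<noteq> cst [:- c, 1:] * w"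
begin

lemma x_mem: "x \<in> B" and m_nz: "m \<noteq> 0" and x_slope: "cst f * pderiv x = cst m"
  using x by (auto simp: slope_def)

text \<open>The derivative with respect to \<open>x\<close>, since \<open>x\<close> has slope
  \<open>m / f\<close> in the original variable.\<close>

definition D :: "complex poly fract poly \<Rightarrow> complex poly fract poly" where
  "D b = [:Fract f m:] * pderiv b"

lemma cst_m_D: "cst m * D b = cst f * pderiv b"
proof -
  have "cst m * [:Fract f m:] = cst f" using m_nz by (simp add: cst_def eq_fract)
  thus ?thesis unfolding D_def mult.assoc[symmetric] by (rule arg_cong)
qed

lemma D_x: "D x = 1"
proof -
  have "cst m * D x = cst m * 1" by (simp add: cst_m_D x_slope)
  thus ?thesis using m_nz by (simp only: mult_cancel_left cst_eq_0_iff) simp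
qed

sublocale Ch_sub cst D B
proof
  show "D (a + b) = D a + D b" for a b
    unfolding D_def pderiv_add by (rule distrib_left)
  show "D (a * b) = D a * b + a * D b" for a b
    unfolding D_def pderiv_mult distrib_left by (simp only: mult_ac add_ac)
  show "cst [:0, 1:] \<noteq> 0" by simp
qed (simp_all add: D_def)

text \<open>Over the complex numbers \<open>g\<close> splits into linear factors. None of the
  \<open>x - a\<close> vanishes on the fibre, by \<open>nonconst\<close>, and the fibre is
  integral.\<close>

lemma x_transcendental_fibre:
  assumes "c \<noteq> 0" "w \<in> B" "k.peval g x = cst [:- c, 1:] * w" shows "g = 0"
  using assms(2,3)
proof (induction "degree g" arbitrary: g w)
  case 0
  then obtain a where a: "g = [:a:]" by (metis degree_eq_zeroE)
  have "cst [:- c, 1:] * w = cst [:a:]" using 0 a by (simp flip: k_def)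
  hence "a = 0" using nonunit' 0 by metis
  thus ?case using a by simp
next
  case (Suc n)
  obtain a g' where g: "g = [:- a, 1:] * g'" "degree g = Suc (degree g')"
    using complex_poly_root[of g] Suc(2) by auto
  have "k.peval g x = (x - cst [:a:]) * k.peval g' x"
    unfolding g(1) k.peval_mult by (simp add: algebra_simps flip: k_def)
  hence eq: "(x - cst [:a:]) * k.peval g' x = cst [:- c, 1:] * w" using Suc(4) by simp
  have "x - cst [:a:] \<in> B" "k.peval g' x \<in> B" using x_mem by (auto intro: mems peval_mem)
  from prime[OF assms(1) this Suc(3) eq] nonconst obtain v where "v \<in> B" "k.peval g' x = cst [:- c, 1:] * v"
    by blast
  hence "g' = 0" using Suc(1)[of g' v] Suc(2) g by simp
  thus ?case using g by simp
qed

text \<open>\<open>x\<close> is an affine function of the generic coordinate with nonzero slope, so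
  both generate the same polynomial ring over the function field; \<open>s\<close> clears
  denominators.\<close>

lemma multiple_peval: "\<exists>s q. s \<noteq> 0 \<and> cst s * b = cst.peval q x"
proof -
  define P where "P b \<longleftrightarrow> (\<exists>s q. s \<noteq> 0 \<and> cst s * b = cst.peval q x)" for b
  have const: "P [:l:]" for l
  proof (cases l)
    case (Fract u v)
    hence "cst v * [:l:] = cst u" by (simp add: cst_def eq_fract)
    thus ?thesis unfolding P_def using Fract by (intro exI[of _ v] exI[of _ "[:u:]"]) simp
  qed
  have add: "P (a + b)" if ab: "P a" "P b" for a b
  proof -
    obtain s q t r where "s \<noteq> 0" "cst s * a = cst.peval q x" "t \<noteq> 0" "cst t * b = cst.peval r x"
      using ab by (auto simp: P_def)
    thus ?thesis unfolding P_def
      by (intro exI[of _ "s * t"] exI[of _ "[:t:] * q + [:s:] * r"])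
         (auto simp: cst.peval_add cst.peval_smult algebra_simps)
  qed
  have mult: "P (a * b)" if ab: "P a" "P b" for a b
  proof -
    obtain s q t r where "s \<noteq> 0" "cst s * a = cst.peval q x" "t \<noteq> 0" "cst t * b = cst.peval r x"
      using ab by (auto simp: P_def)
    moreover have "cst (s * t) * (a * b) = (cst s * a) * (cst t * b)" by (simp add: mult_ac)
    ultimately show ?thesis unfolding P_def
      by (intro exI[of _ "s * t"] exI[of _ "q * r"]) (auto simp: cst.peval_mult)
  qed
  have "P x" unfolding P_def by (intro exI[of _ 1] exI[of _ "[:0, 1:]"]) simp
  obtain l' where l': "pderiv x = [:l':]" "l' \<noteq> 0"
  proof -
    have "pderiv x = [:Fract m f:]"
    proof -
      have "cst f * [:Fract m f:] = cst m" using f(1) by (simp add: cst_def eq_fract)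
      hence "cst f * pderiv x = cst f * [:Fract m f:]" using x_slope by simp
      thus ?thesis using f(1) by (simp only: mult_cancel_left cst_eq_0_iff) simp
    qed
    moreover have "Fract m f \<noteq> 0" using f(1) m_nz by (simp add: Zero_fract_def eq_fract)
    ultimately show ?thesis using that by blast
  qed
  have "degree x \<le> 1" using x by (simp add: slope_def)
  hence "x = [:Polynomial.coeff x 0, Polynomial.coeff x 1:]"
    by (intro poly_eqI) (auto simp: coeff_pCons coeff_eq_0 split: nat.splits)
  then obtain b0 l1 where "x = [:b0, l1:]" by blast
  hence "[:0, l':] = x + [:- b0:]" using l' by (simp add: pderiv_pCons)
  moreover have "[:inverse l':] * [:0, l':] = [:0, 1:]" using l'(2) by simp
  ultimately have "[:inverse l':] * (x + [:- b0:]) = [:0, 1:]" by simp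
  hence X: "P [:0, 1:]" using mult[OF const add[OF \<open>P x\<close> const]] by metis
  have "P b"
  proof (induction b)
    case 0
    show ?case using const[of 0] by simp
  next
    case (pCons a b)
    have "pCons a b = [:a:] + [:0, 1:] * b" by simp
    thus ?case using add[OF const mult[OF X pCons(2)]] by metis
  qed
  thus ?thesis by (simp add: P_def)
qed

lemma split_order:
  fixes s :: "complex poly"
  assumes "s \<noteq> 0" obtains n s' where "s = [:0, 1:] ^ n * s'" "poly s' 0 \<noteq> 0"
  using order_decomp[OF assms, of 0] by (auto simp: poly_eq_0_iff_dvd)

lemma poly_mod_root:
  fixes q :: "complex poly poly"
  shows "\<exists>q1 g. q = Polynomial.smult [:- c, 1:] q1 + map_poly (\<lambda>a. [:a:]) g"
proof (induction q)
  case 0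
  show ?case by (intro exI[of _ 0]) simp
next
  case (pCons a q)
  then obtain q1 g where q: "q = Polynomial.smult [:- c, 1:] q1 + map_poly (\<lambda>a. [:a:]) g" by blast
  have a: "a = [:- c, 1:] * synthetic_div a c + [:poly a c:]"
    using synthetic_div_correct'[of c a] by simp
  have "pCons a q = Polynomial.smult [:- c, 1:] (pCons (synthetic_div a c) q1)
      + map_poly (\<lambda>a. [:a:]) (pCons (poly a c) g)"
    using a by (simp add: q map_poly_pCons)
  thus ?case by blast
qed

lemma peval_map: "cst.peval (map_poly (\<lambda>a. [:a:]) g) b = k.peval g b"
  by (induction g) (auto simp: map_poly_pCons simp flip: k_def)

lemma peval_cst_mem: "b \<in> B \<Longrightarrow> cst.peval q b \<in> B"
  by (induction q) (auto intro!: add_mem mult_mem)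

text \<open>Roots \<open>c \<noteq> 0\<close> of the denominator are removed one at a time: modulo
  \<open>h - c\<close> the numerator is a polynomial in \<open>x\<close> with constant coefficients
  that vanishes on the fibre, hence zero, and \<open>h - c\<close> cancels. A power of
  \<open>h\<close> times a constant remains.\<close>

lemma invert_h:
  assumes "b \<in> B" shows "\<exists>n q. h ^ n * b = cst.peval q x"
proof -
  have "\<exists>n q. h ^ n * b = cst.peval q x" if "s \<noteq> 0" "cst s * b = cst.peval q x" for s q
    using that
  proof (induction "degree s" arbitrary: s q rule: less_induct)
    case less
    obtain n s' where s: "s = [:0, 1:] ^ n * s'" "poly s' 0 \<noteq> 0" using split_order[OF less(2)] .
    have "s' \<noteq> 0" using s by auto
    show ?case
    proof (cases "degree s' = 0")
      case True
      then obtain a where a: "s' = [:a:]" "a \<noteq> 0" using \<open>s' \<noteq> 0\<close> by (metis degree_eq_zeroE pCons_0_0)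
      have "cst s = h ^ n * cst [:a:]" unfolding s(1) a(1) cst.hom_mult cst.hom_power by (simp add: h_def)
      hence "cst [:inverse a:] * cst.peval q x = (cst [:inverse a:] * cst [:a:]) * (h ^ n * b)"
        using less(3) by (simp add: mult_ac)
      also have "cst [:inverse a:] * cst [:a:] = 1" using a(2) k.hom_mult[of "inverse a" a] by (simp flip: k_def)
      finally have "h ^ n * b = cst.peval ([:[:inverse a:]:] * q) x" by (simp add: cst.peval_smult)
      thus ?thesis by blast
    next
      case False
      then obtain c t where t: "s' = [:- c, 1:] * t" using complex_poly_root by metis
      have c: "c \<noteq> 0" using s(2) t by auto
      define s1 where "s1 = [:0, 1:] ^ n * t"
      have s1: "s = [:- c, 1:] * s1" by (simp only: s1_def s(1) t mult_ac)
      have s1_nz: "s1 \<noteq> 0" using less(2) s1 by auto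
      have deg: "degree s1 < degree s" unfolding s1 using s1_nz by (subst degree_mult_eq) auto
      obtain q1 g where q: "q = Polynomial.smult [:- c, 1:] q1 + map_poly (\<lambda>a. [:a:]) g"
        using poly_mod_root by blast
      have "cst [:- c, 1:] * (cst s1 * b) = cst [:- c, 1:] * cst.peval q1 x + k.peval g x"
        using less(3) unfolding s1 cst.hom_mult q cst.peval_add cst.peval_smult peval_map by (simp only: mult.assoc)
      hence eq: "k.peval g x = cst [:- c, 1:] * (cst s1 * b - cst.peval q1 x)"
        by (simp only: right_diff_distrib) simp
      have "cst s1 * b - cst.peval q1 x \<in> B"
        by (intro diff_mem mult_mem cst_mem assms peval_cst_mem x_mem)
      hence "g = 0" using x_transcendental_fibre[OF c _ eq] by blast
      hence "cst s1 * b = cst.peval q1 x" using eq by simp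
      thus ?thesis using less(1)[OF deg s1_nz] by blast
    qed
  qed
  thus ?thesis using multiple_peval[of b] by blast
qed

text \<open>\<open>t\<close> and \<open>h\<close> are coprime: writing \<open>t = a + h * t'\<close>
  with a constant \<open>a \<noteq> 0\<close>, membership of \<open>t * b\<close> and
  \<open>h * b\<close> gives that of \<open>a * b\<close>.\<close>

lemma h_power_cancel:
  assumes "poly t 0 \<noteq> 0" "cst t * b \<in> B" "h ^ n * b \<in> B" shows "b \<in> B"
  using assms(2,3)
proof (induction n arbitrary: b)
  case (Suc n)
  obtain a t' where t: "t = pCons a t'" by (cases t)
  have a: "a \<noteq> 0" using assms(1) by (simp add: t)
  have hn: "h ^ n * (h * b) \<in> B" using Suc(3) by (simp add: mult_ac)
  have "cst t * (h * b) = h * (cst t * b)" by (simp only: mult_ac)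
  hence "cst t * (h * b) \<in> B" by (simp only: mult_mem[OF h_mem Suc(2)])
  hence hb: "h * b \<in> B" using Suc(1) hn by blast
  have "t = [:a:] + [:0, 1:] * t'" by (simp add: t)
  hence "cst t = cst [:a:] + h * cst t'" by (simp only: cst.hom_add cst.hom_mult h_def)
  hence "cst [:a:] * b = cst t * b - cst t' * (h * b)" by (simp add: algebra_simps)
  also have "\<dots> \<in> B" by (rule diff_mem[OF Suc(2) mult_mem[OF cst_mem hb]])
  finally have "cst [:inverse a:] * (cst [:a:] * b) \<in> B" by (rule mult_mem[OF cst_mem])
  moreover have "cst [:inverse a:] * cst [:a:] = 1" using a k.hom_mult[of "inverse a" a] by (simp flip: k_def)
  ultimately show ?case by (simp flip: mult.assoc)
qed simp

text \<open>\<open>N\<close> is the order of \<open>m\<close> at 0, so it does not depend on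
  \<open>b\<close>. A power of \<open>h\<close> that does depend on \<open>b\<close> moves
  \<open>h ^ N * D b\<close> into \<open>B\<close>, and so does the cofactor \<open>m'\<close>;
  coprimality then removes both.\<close>

lemma D_bounded: "\<exists>N. \<forall>b\<in>B. h ^ N * D b \<in> B"
proof -
  obtain N m' where m: "m = [:0, 1:] ^ N * m'" "poly m' 0 \<noteq> 0" using split_order[OF m_nz] .
  have "h ^ N * D b \<in> B" if b: "b \<in> B" for b
  proof -
    obtain n q where nq: "h ^ n * b = cst.peval q x" using invert_h[OF b] by blast
    have "D (cst.peval q x) = cst.peval (pderiv q) x"
      by (induction q) (auto simp: D_add D_mult D_const D_x pderiv_pCons cst.peval_add algebra_simps)
    hence "h ^ n * D b = cst.peval (pderiv q) x" by (simp flip: nq add: D_h_power)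
    also have "\<dots> \<in> B" by (rule peval_cst_mem[OF x_mem])
    finally have "h ^ n * (h ^ N * D b) \<in> B"
      using mult_mem[of "h ^ N" "h ^ n * D b"] power_mem by (simp add: mult_ac)
    moreover have "cst m' * (h ^ N * D b) = cst m * D b"
      unfolding m(1) cst.hom_mult cst.hom_power h_def by (simp only: mult_ac)
    hence "cst m' * (h ^ N * D b) \<in> B" using f(2)[OF b] by (simp add: cst_m_D)
    ultimately show ?thesis using h_power_cancel[OF m(2)] by blast
  qed
  thus ?thesis by blast
qed

end

theorem (in generic_line_subring) subring_presentation:
  assumes reduced: "\<And>b w n. b \<in> B \<Longrightarrow> w \<in> B \<Longrightarrow> b ^ n = cst [:0, 1:] * w \<Longrightarrow> \<exists>v\<in>B. b = cst [:0, 1:] * v"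
  shows "\<exists>(T :: nat labelled_tree) D \<xi>. fine_labelled_tree T \<and> tree_presentation T cst D B \<xi>"
proof -
  obtain f x m where fx: "f \<noteq> 0" "\<forall>b\<in>B. cst f * pderiv b \<in> B" "slope f x m"
    "\<forall>c a. \<forall>w\<in>B. x - cst [:a:] \<noteq> cst [:- c, 1:] * w"
    using exists_coordinate by blast
  interpret X: generic_line_coordinate B f x m
    by unfold_locales (use fx in auto)
  interpret S: reduced_fibre_surface cst X.D B x
  proof unfold_locales
    show "x \<in> B" "X.D x = 1" using X.x_mem X.D_x by auto
    show "X.h * w \<noteq> 1" if "w \<in> B" for w using nonunit[OF that, of 0] by (simp add: X.h_def)
    show "\<exists>v\<in>B. b = X.h * v" if "b \<in> B" "w \<in> B" "b ^ n = X.h * w" for b w n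
      using reduced that by (simp add: X.h_def)
  qed (use X.invert_h X.D_bounded in auto)
  show ?thesis using S.exists_presentation by blast
qed

section \<open>Generalized Danielewski surfaces\<close>

lemma Ch_simps:
  "carrier Ch = UNIV" "a \<otimes>\<^bsub>Ch\<^esub> b = a * b" "a \<oplus>\<^bsub>Ch\<^esub> b = a + b" "\<one>\<^bsub>Ch\<^esub> = 1" "\<zero>\<^bsub>Ch\<^esub> = 0"
  by (simp_all add: ring_of_type_algebra_def)

lemma cring_Ch: "cring Ch" by (rule cring_from_type_algebra)

lemma Idl_linear: "Idl\<^bsub>Ch\<^esub> {[:- c, 1:]} = {p. poly p c = 0}"
proof -
  interpret cring Ch by (rule cring_Ch)
  have "Idl\<^bsub>Ch\<^esub> {[:- c, 1:]} = PIdl\<^bsub>Ch\<^esub> [:- c, 1:]"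
    by (rule cgenideal_eq_genideal[symmetric]) (simp add: Ch_simps)
  also have "\<dots> = {p. [:- c, 1:] dvd p}"
    unfolding cgenideal_def by (auto simp: Ch_simps dvd_def mult.commute)
  finally show ?thesis by (simp add: poly_eq_0_iff_dvd)
qed

lemma maximalideal_linear: "maximalideal {p. poly p c = 0} Ch"
proof (rule maximalidealI)
  interpret cring Ch by (rule cring_Ch)
  show "ideal {p. poly p c = 0} Ch"
    using genideal_ideal[of "{[:- c, 1:]}"] by (simp add: Idl_linear Ch_simps)
  have "(1 :: complex poly) \<notin> {p. poly p c = 0}" by simp
  thus "carrier Ch \<noteq> {p. poly p c = 0}" unfolding Ch_simps by blast
  fix J assume J: "ideal J Ch" "{p. poly p c = 0} \<subseteq> J"
  interpret J: ideal J Ch by fact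
  show "J = {p. poly p c = 0} \<or> J = carrier Ch"
  proof (cases "J \<subseteq> {p. poly p c = 0}")
    case False
    then obtain q where q: "q \<in> J" "poly q c \<noteq> 0" by blast
    have "p \<in> J" for p
    proof -
      define s where "s = Polynomial.smult (poly p c / poly q c) q"
      have "p - s \<in> J" using J(2) q(2) by (auto simp: s_def)
      moreover have "s = [:poly p c / poly q c:] * q" by (simp add: s_def)
      hence "s \<in> J" using J.I_l_closed[OF q(1), of "[:poly p c / poly q c:]"] by (simp add: Ch_simps)
      ultimately have "(p - s) \<oplus>\<^bsub>Ch\<^esub> s \<in> J" by (rule J.a_closed)
      thus ?thesis by (simp add: Ch_simps)
    qed
    thus ?thesis by (auto simp: Ch_simps)
  qed (use J(2) in blast)
qed

lemma (in cring) Idl_image_linear: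
  assumes "\<phi> \<in> ring_hom Ch R"
  shows "Idl (\<phi> ` {p. poly p c = 0}) = PIdl (\<phi> [:- c, 1:])"
proof
  have cl: "\<phi> a \<in> carrier R" for a using ring_hom_closed[OF assms] by (simp add: Ch_simps)
  show "Idl (\<phi> ` {p. poly p c = 0}) \<subseteq> PIdl (\<phi> [:- c, 1:])"
  proof (rule genideal_minimal[OF cgenideal_ideal[OF cl]], rule image_subsetI)
    fix p assume "p \<in> {p. poly p c = 0}"
    then obtain q where "p = q \<otimes>\<^bsub>Ch\<^esub> [:- c, 1:]" by (auto simp: poly_eq_0_iff_dvd Ch_simps dvd_def mult.commute)
    hence "\<phi> p = \<phi> q \<otimes> \<phi> [:- c, 1:]" using ring_hom_mult[OF assms] by (simp add: Ch_simps(1))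
    thus "\<phi> p \<in> PIdl (\<phi> [:- c, 1:])" using cl by (auto simp: cgenideal_def)
  qed
  show "PIdl (\<phi> [:- c, 1:]) \<subseteq> Idl (\<phi> ` {p. poly p c = 0})"
    using cl by (intro cgenideal_minimal genideal_ideal set_mp[OF genideal_self]) auto
qed

lemma zero_FactRing: "\<zero>\<^bsub>R Quot I\<^esub> = I"
  by (simp add: FactRing_def)

section \<open>From the axioms of the surface to a subring of a polynomial ring\<close>

locale gds =
  fixes B :: "('b, 'm) ring_scheme" and \<phi> :: "complex poly \<Rightarrow> 'b"
  assumes GDS: "GDS B \<phi>"
    and integral_fibres: "\<And>p. maximalideal p Ch \<Longrightarrow> p \<noteq> Idl\<^bsub>Ch\<^esub> {[:0, 1:]} \<Longrightarrow> domain (closed_fibre B \<phi> p)"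
begin

sublocale B: domain B
  using GDS by (simp add: GDS_def normal_affine_surface_def normal_domain_def)

lemma \<phi>_hom: "\<phi> \<in> ring_hom Ch B" using GDS by (simp add: GDS_def)

lemma \<phi>_closed [simp]: "\<phi> a \<in> carrier B"
  and \<phi>_mult: "\<phi> (a * b) = \<phi> a \<otimes>\<^bsub>B\<^esub> \<phi> b"
  and \<phi>_add: "\<phi> (a + b) = \<phi> a \<oplus>\<^bsub>B\<^esub> \<phi> b"
  and \<phi>_one: "\<phi> 1 = \<one>\<^bsub>B\<^esub>"
  using ring_hom_closed[OF \<phi>_hom] ring_hom_mult[OF \<phi>_hom] ring_hom_add[OF \<phi>_hom] ring_hom_one[OF \<phi>_hom]
  by (simp_all add: Ch_simps)

lemma \<phi>_zero: "\<phi> 0 = \<zero>\<^bsub>B\<^esub>"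
  using \<phi>_add[of 0 0] B.add.l_cancel_one[of "\<phi> 0" "\<phi> 0"] by simp

abbreviation "lin c \<equiv> \<phi> [:- c, 1:]"

lemma closed_fibre_eq: "closed_fibre B \<phi> {p. poly p c = 0} = B Quot (PIdl\<^bsub>B\<^esub> (lin c))"
  by (simp add: closed_fibre_def B.Idl_image_linear[OF \<phi>_hom])

lemma mem_PIdl: "y \<in> PIdl\<^bsub>B\<^esub> (lin c) \<longleftrightarrow> (\<exists>w\<in>carrier B. y = lin c \<otimes>\<^bsub>B\<^esub> w)"
  unfolding cgenideal_def using B.m_comm \<phi>_closed by auto

lemma PIdl_ideal: "ideal (PIdl\<^bsub>B\<^esub> (lin c)) B" by (rule B.cgenideal_ideal) simp

text \<open>Faithful flatness supplies a prime of \<open>B\<close> over the point \<open>c\<close>;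
  it contains \<open>lin c\<close>, which therefore cannot be a unit.\<close>

lemma linear_nonunit:
  assumes "w \<in> carrier B" shows "lin c \<otimes>\<^bsub>B\<^esub> w \<noteq> \<one>\<^bsub>B\<^esub>"
proof
  assume eq: "lin c \<otimes>\<^bsub>B\<^esub> w = \<one>\<^bsub>B\<^esub>"
  have "faithfully_flat Ch B \<phi>" using GDS by (simp only: GDS_def)
  hence ff: "\<And>p. primeideal p Ch \<Longrightarrow> \<exists>P. primeideal P B \<and> {a \<in> carrier Ch. \<phi> a \<in> P} = p"
    unfolding faithfully_flat_def by (elim conjE allE) (rule mp)
  have "primeideal {p. poly p c = 0} Ch"
    by (rule cring.maximalideal_prime[OF cring_Ch maximalideal_linear])
  then obtain P where P: "primeideal P B" "{a \<in> carrier Ch. \<phi> a \<in> P} = {p. poly p c = 0}"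
    using ff by metis
  interpret P: primeideal P B by (rule P(1))
  have "[:- c, 1:] \<in> {a \<in> carrier Ch. \<phi> a \<in> P}" unfolding P(2) by simp
  hence "lin c \<in> P" by blast
  hence "\<one>\<^bsub>B\<^esub> \<in> P" using P.I_r_closed[OF _ assms] eq by metis
  thus False using P.one_imp_carrier P.I_notcarr by simp
qed

lemma linear_prime:
  assumes "c \<noteq> 0" "y \<in> carrier B" "z \<in> carrier B" "w \<in> carrier B" "y \<otimes>\<^bsub>B\<^esub> z = lin c \<otimes>\<^bsub>B\<^esub> w"
  shows "(\<exists>v\<in>carrier B. y = lin c \<otimes>\<^bsub>B\<^esub> v) \<or> (\<exists>v\<in>carrier B. z = lin c \<otimes>\<^bsub>B\<^esub> v)"
proof -
  have "[:0, 1:] \<notin> {p. poly p c = 0}" using assms(1) by simp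
  moreover have "[:0, 1:] \<in> {p :: complex poly. poly p 0 = 0}" by simp
  ultimately have "{p. poly p c = 0} \<noteq> {p. poly p 0 = 0}" by blast
  hence "{p. poly p c = 0} \<noteq> Idl\<^bsub>Ch\<^esub> {[:0, 1:]}" using Idl_linear[of 0] by simp
  from integral_fibres[OF maximalideal_linear this]
  have "primeideal (PIdl\<^bsub>B\<^esub> (lin c)) B"
    unfolding closed_fibre_eq by (rule B.quot_domain_imp_primeideal[OF PIdl_ideal])
  moreover have "y \<otimes>\<^bsub>B\<^esub> z \<in> PIdl\<^bsub>B\<^esub> (lin c)" using assms mem_PIdl by blast
  ultimately have "y \<in> PIdl\<^bsub>B\<^esub> (lin c) \<or> z \<in> PIdl\<^bsub>B\<^esub> (lin c)"
    using primeideal.I_prime assms(2,3) by metis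
  thus ?thesis by (simp add: mem_PIdl)
qed

lemma linear_reduced:
  assumes "y \<in> carrier B" "w \<in> carrier B" "y [^]\<^bsub>B\<^esub> (n::nat) = lin c \<otimes>\<^bsub>B\<^esub> w"
  shows "\<exists>v\<in>carrier B. y = lin c \<otimes>\<^bsub>B\<^esub> v"
proof -
  let ?I = "PIdl\<^bsub>B\<^esub> (lin c)"
  interpret I: ideal ?I B by (rule PIdl_ideal)
  interpret H: ring_hom_ring B "B Quot ?I" "(+>\<^bsub>B\<^esub>) ?I" by (rule I.rcos_ring_hom_ring)
  have "\<forall>p. maximalideal p Ch \<longrightarrow> reduced_ring (closed_fibre B \<phi> p)"
    using GDS unfolding GDS_def by (elim conjE)
  hence "reduced_ring (closed_fibre B \<phi> {p. poly p c = 0})" using maximalideal_linear by (elim allE) (rule mp)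
  hence red: "reduced_ring (B Quot ?I)" by (simp only: closed_fibre_eq)
  note zero = zero_FactRing[of B ?I]
  have "y [^]\<^bsub>B\<^esub> n \<in> ?I" using assms mem_PIdl by blast
  hence "(?I +>\<^bsub>B\<^esub> y) [^]\<^bsub>B Quot ?I\<^esub> n = \<zero>\<^bsub>B Quot ?I\<^esub>"
    using H.hom_nat_pow[OF assms(1), of n] B.a_rcos_zero[OF PIdl_ideal] by (simp add: zero)
  hence "?I +>\<^bsub>B\<^esub> y = ?I"
    using red H.hom_closed[OF assms(1)] unfolding reduced_ring_def zero by blast
  hence "y \<in> ?I" by (rule I.rcos_const_imp_mem[OF assms(1)])
  thus ?thesis by (simp add: mem_PIdl)
qed

abbreviation "S \<equiv> \<phi> ` (UNIV - {0})"
abbreviation "fr \<equiv> fraction B S"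

lemma submonoid_S: "submonoid S B"
proof
  show "x \<otimes>\<^bsub>B\<^esub> y \<in> S" if "x \<in> S" "y \<in> S" for x y
    using that by (auto simp flip: \<phi>_mult)
  show "\<one>\<^bsub>B\<^esub> \<in> S" unfolding \<phi>_one[symmetric] by (rule imageI) simp
qed auto

lemma fr_closed: "b \<in> carrier B \<Longrightarrow> s \<in> S \<Longrightarrow> fr b s \<in> carrier (generic_fibre B \<phi>)"
  by (simp add: generic_fibre_def ring_of_fractions_def fraction_def quotientI)

lemma fr_eq_iff:
  assumes "a \<in> carrier B" "b \<in> carrier B" "s \<in> S" "t \<in> S"
  shows "fr a s = fr b t \<longleftrightarrow> (\<exists>u\<in>S. u \<otimes>\<^bsub>B\<^esub> (t \<otimes>\<^bsub>B\<^esub> a) = u \<otimes>\<^bsub>B\<^esub> (s \<otimes>\<^bsub>B\<^esub> b))"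
  unfolding fraction_def
  using eq_equiv_class_iff[OF B.equiv_fraction_rel[OF submonoid_S], of "(a, s)" "(b, t)"] assms
  by (simp add: fraction_rel_def)

lemma one_S: "\<one>\<^bsub>B\<^esub> \<in> S" using submonoid.one_closed[OF submonoid_S] .

text \<open>\<open>b\<close> goes to the fraction \<open>b/1\<close> in the generic fibre and back
  through the given isomorphism. Injectivity holds because \<open>B\<close> is a domain and no
  denominator is zero.\<close>

lemma embedding:
  obtains j :: "'b \<Rightarrow> complex poly fract poly"
  where "inj_on j (carrier B)" "j \<one>\<^bsub>B\<^esub> = 1"
    "\<And>a b. a \<in> carrier B \<Longrightarrow> b \<in> carrier B \<Longrightarrow> j (a \<oplus>\<^bsub>B\<^esub> b) = j a + j b"
    "\<And>a b. a \<in> carrier B \<Longrightarrow> b \<in> carrier B \<Longrightarrow> j (a \<otimes>\<^bsub>B\<^esub> b) = j a * j b"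
    "\<And>a. j (\<phi> a) = cst a" "\<And>p. \<exists>a. a \<noteq> 0 \<and> cst a * p \<in> j ` carrier B"
proof -
  let ?P = "ring_of_type_algebra :: complex poly fract poly ring"
  let ?G = "generic_fibre B \<phi>"
  obtain \<theta> where \<theta>: "\<theta> \<in> ring_iso ?P ?G" "\<And>a s. s \<noteq> 0 \<Longrightarrow> \<theta> [:Fract a s:] = fr (\<phi> a) (\<phi> s)"
    using GDS unfolding GDS_def generic_fibre_is_affine_line_def by (elim conjE bexE) metis
  have bij: "bij_betw \<theta> UNIV (carrier ?G)" and hom: "\<theta> \<in> ring_hom ?P ?G"
    using \<theta>(1) by (simp_all add: ring_iso_def ring_of_type_algebra_def)
  have inj: "\<theta> p = \<theta> q \<longleftrightarrow> p = q" for p q using bij by (auto simp: bij_betw_def inj_on_def)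
  have mult: "\<theta> (p * q) = \<theta> p \<otimes>\<^bsub>?G\<^esub> \<theta> q" and add: "\<theta> (p + q) = \<theta> p \<oplus>\<^bsub>?G\<^esub> \<theta> q" for p q
    using ring_hom_mult[OF hom] ring_hom_add[OF hom] by (simp_all add: ring_of_type_algebra_def)
  have G: "?G = ring_of_fractions B S" by (simp add: generic_fibre_def)
  have \<theta>_cst: "\<theta> (cst a) = fr (\<phi> a) \<one>\<^bsub>B\<^esub>" for a
    using \<theta>(2)[of 1 a] by (simp add: cst_def \<phi>_one)
  \<comment> \<open>If zero were a denominator, all fractions would coincide, whereas the generic
    fibre is isomorphic to a nonzero ring.\<close>
  have \<phi>_nz: "\<phi> a \<noteq> \<zero>\<^bsub>B\<^esub>" if "a \<noteq> 0" for a
  proof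
    assume "\<phi> a = \<zero>\<^bsub>B\<^esub>"
    hence "\<zero>\<^bsub>B\<^esub> \<in> S" using that by (metis Diff_iff UNIV_I imageI singletonD)
    hence "\<exists>u\<in>S. u \<otimes>\<^bsub>B\<^esub> (\<one>\<^bsub>B\<^esub> \<otimes>\<^bsub>B\<^esub> \<phi> 0) = u \<otimes>\<^bsub>B\<^esub> (\<one>\<^bsub>B\<^esub> \<otimes>\<^bsub>B\<^esub> \<phi> 1)"
      by (rule bexI[rotated]) simp
    hence "fr (\<phi> 0) \<one>\<^bsub>B\<^esub> = fr (\<phi> 1) \<one>\<^bsub>B\<^esub>"
      by (rule fr_eq_iff[THEN iffD2, OF \<phi>_closed \<phi>_closed one_S one_S])
    hence "cst 0 = cst 1" using \<theta>_cst inj by metis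
    thus False using cst_eq_0_iff[of 1] cst_eq_0_iff[of 0] by simp
  qed
  define j where "j b = inv_into UNIV \<theta> (fr b \<one>\<^bsub>B\<^esub>)" for b
  have \<theta>j: "\<theta> (j b) = fr b \<one>\<^bsub>B\<^esub>" if "b \<in> carrier B" for b
    unfolding j_def by (rule f_inv_into_f) (use fr_closed[OF that one_S] bij in \<open>simp add: bij_betw_def\<close>)
  have j_eq: "j b = p" if "b \<in> carrier B" "\<theta> p = fr b \<one>\<^bsub>B\<^esub>" for b p
    using \<theta>j[OF that(1)] that(2) inj by metis
  have 1: "inj_on j (carrier B)"
  proof (rule inj_onI)
    fix a b assume ab: "a \<in> carrier B" "b \<in> carrier B" "j a = j b"
    hence "fr a \<one>\<^bsub>B\<^esub> = fr b \<one>\<^bsub>B\<^esub>" using \<theta>j by metis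
    then obtain u where "u \<noteq> 0" "\<phi> u \<otimes>\<^bsub>B\<^esub> a = \<phi> u \<otimes>\<^bsub>B\<^esub> b" using fr_eq_iff[of a b] ab one_S by auto
    thus "a = b" using B.m_lcancel[of "\<phi> u" a b] ab \<phi>_nz by simp
  qed
  have 2: "j (\<phi> a) = cst a" for a by (rule j_eq) (simp_all add: \<theta>_cst)
  have 3: "j \<one>\<^bsub>B\<^esub> = 1" using 2[of 1] type_ring_hom.hom_one[OF cst_hom] by (simp add: \<phi>_one)
  have 4: "j (a \<oplus>\<^bsub>B\<^esub> b) = j a + j b" if "a \<in> carrier B" "b \<in> carrier B" for a b
    by (rule j_eq) (use that one_S in \<open>simp_all add: add \<theta>j G B.fraction_add[OF submonoid_S]\<close>)
  have 5: "j (a \<otimes>\<^bsub>B\<^esub> b) = j a * j b" if "a \<in> carrier B" "b \<in> carrier B" for a b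
    by (rule j_eq) (use that one_S in \<open>simp_all add: mult \<theta>j G B.fraction_mult[OF submonoid_S]\<close>)
  have 6: "\<exists>a. a \<noteq> 0 \<and> cst a * p \<in> j ` carrier B" for p
  proof -
    have "\<theta> p \<in> carrier ?G" using bij by (auto simp: bij_betw_def)
    then obtain b a where b: "b \<in> carrier B" "a \<noteq> 0" "\<theta> p = fr b (\<phi> a)"
      by (auto simp: G ring_of_fractions_def fraction_def elim!: quotientE)
    have a: "\<phi> a \<in> S" using b(2) by auto
    have eq: "\<theta> (cst a * p) = fr (\<phi> a \<otimes>\<^bsub>B\<^esub> b) (\<one>\<^bsub>B\<^esub> \<otimes>\<^bsub>B\<^esub> \<phi> a)"
      using b a one_S by (simp add: mult \<theta>_cst G B.fraction_mult[OF submonoid_S] del: B.l_one)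
    have "\<exists>u\<in>S. u \<otimes>\<^bsub>B\<^esub> (\<one>\<^bsub>B\<^esub> \<otimes>\<^bsub>B\<^esub> (\<phi> a \<otimes>\<^bsub>B\<^esub> b)) =
        u \<otimes>\<^bsub>B\<^esub> ((\<one>\<^bsub>B\<^esub> \<otimes>\<^bsub>B\<^esub> \<phi> a) \<otimes>\<^bsub>B\<^esub> b)"
      by (rule bexI[OF _ one_S]) (simp add: b)
    hence "fr (\<phi> a \<otimes>\<^bsub>B\<^esub> b) (\<one>\<^bsub>B\<^esub> \<otimes>\<^bsub>B\<^esub> \<phi> a) = fr b \<one>\<^bsub>B\<^esub>"
      by (intro fr_eq_iff[THEN iffD2] one_S) (use a b in simp_all)
    hence "j b = cst a * p" using eq by (intro j_eq b) simp
    thus ?thesis using b by (metis imageI)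
  qed
  show ?thesis by (rule that[OF 1 3 4 5 2 6])
qed

theorem isomorphic_to_tree_algebra:
  "\<exists>T :: nat labelled_tree. fine_labelled_tree T \<and>
     isomorphic_over_Ch B \<phi> (tree_algebra T) (tree_structure_map T)"
proof -
  obtain j where j: "inj_on j (carrier B)" "j \<one>\<^bsub>B\<^esub> = 1"
    "\<And>a b. a \<in> carrier B \<Longrightarrow> b \<in> carrier B \<Longrightarrow> j (a \<oplus>\<^bsub>B\<^esub> b) = j a + j b"
    "\<And>a b. a \<in> carrier B \<Longrightarrow> b \<in> carrier B \<Longrightarrow> j (a \<otimes>\<^bsub>B\<^esub> b) = j a * j b"
    "\<And>a. j (\<phi> a) = cst a" "\<And>p. \<exists>a. a \<noteq> 0 \<and> cst a * p \<in> j ` carrier B"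
    using embedding by blast
  define B' where "B' = j ` carrier B"
  have j_eq: "j a = j b \<longleftrightarrow> a = b" if "a \<in> carrier B" "b \<in> carrier B" for a b
    using j(1) that by (auto simp: inj_on_def)
  have j0: "j \<zero>\<^bsub>B\<^esub> = 0" using j(5)[of 0] by (simp add: \<phi>_zero)
  have jm: "j (\<ominus>\<^bsub>B\<^esub> b) = - j b" if "b \<in> carrier B" for b
    using j(3)[of b "\<ominus>\<^bsub>B\<^esub> b"] that j0 by (simp add: B.r_neg eq_neg_iff_add_eq_0 add.commute)
  have jd: "j (a \<ominus>\<^bsub>B\<^esub> b) = j a - j b" if "a \<in> carrier B" "b \<in> carrier B" for a b
    using that by (simp add: B.minus_eq j(3) jm)
  have jp: "j (b [^]\<^bsub>B\<^esub> n) = j b ^ n" if "b \<in> carrier B" for b and n :: nat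
    by (induction n) (use that in \<open>auto simp: j(2,4)\<close>)
  have linj: "cst [:- c, 1:] * j w = j (lin c \<otimes>\<^bsub>B\<^esub> w)" if "w \<in> carrier B" for c w
    using that by (simp add: j(4,5))
  interpret C: type_ring_hom cst by (rule cst_hom)
  interpret B': type_subring B'
  proof
    show "1 \<in> B'" unfolding B'_def j(2)[symmetric] by (rule imageI) simp
    show "a - b \<in> B'" if "a \<in> B'" "b \<in> B'" for a b
      using that by (auto simp: B'_def simp flip: jd)
    show "a * b \<in> B'" if "a \<in> B'" "b \<in> B'" for a b
      using that by (auto simp: B'_def simp flip: j(4))
  qed
  have cst: "cst a \<in> B'" for a unfolding B'_def j(5)[symmetric] by (rule imageI) simp
  have pderiv_cst: "pderiv (cst a) = 0" for a by (simp add: cst_def pderiv_pCons)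
  interpret L: generic_line_subring B'
  proof
    show "cst a \<in> B'" for a by (rule cst)
    show "\<exists>a. a \<noteq> 0 \<and> cst a * p \<in> B'" for p using j(6) by (simp add: B'_def)
    show "cst [:- c, 1:] * w \<noteq> 1" if w: "w \<in> B'" for w c
    proof -
      obtain b where b: "b \<in> carrier B" "w = j b" using w by (auto simp: B'_def)
      thus ?thesis using linear_nonunit[OF b(1), of c] j_eq[of "lin c \<otimes>\<^bsub>B\<^esub> b" "\<one>\<^bsub>B\<^esub>"] by (simp add: linj j(2))
    qed
    show "(\<exists>v\<in>B'. y = cst [:- c, 1:] * v) \<or> (\<exists>v\<in>B'. z = cst [:- c, 1:] * v)"
      if c: "c \<noteq> 0" and yzw: "y \<in> B'" "z \<in> B'" "w \<in> B'" "y * z = cst [:- c, 1:] * w" for c y z w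
    proof -
      obtain y' z' w' where b: "y' \<in> carrier B" "y = j y'" "z' \<in> carrier B" "z = j z'" "w' \<in> carrier B" "w = j w'"
        using yzw by (auto simp: B'_def)
      have "y' \<otimes>\<^bsub>B\<^esub> z' = lin c \<otimes>\<^bsub>B\<^esub> w'"
        using yzw(4) b j_eq[of "y' \<otimes>\<^bsub>B\<^esub> z'" "lin c \<otimes>\<^bsub>B\<^esub> w'"] by (simp add: linj j(4))
      from linear_prime[OF c b(1,3,5) this] show ?thesis
        using b by (auto simp: B'_def linj)
    qed
    show "\<exists>f. f \<noteq> 0 \<and> (\<forall>b\<in>B'. cst f * pderiv b \<in> B')"
    proof -
      obtain F where F: "finite F" "F \<subseteq> carrier B" "generate_ring B (range (\<lambda>c. \<phi> [:c:]) \<union> F) = carrier B"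
        using GDS unfolding GDS_def normal_affine_surface_def by blast
      obtain d where d: "\<And>p. d p \<noteq> 0 \<and> cst (d p) * p \<in> B'" using j(6) unfolding B'_def by metis
      \<comment> \<open>By the product rule it is enough to clear the denominators of the
        derivatives of the finitely many generators.\<close>
      define f where "f = (\<Prod>g\<in>F. d (pderiv (j g)))"
      have "f \<noteq> 0" using F(1) d by (simp add: f_def)
      moreover have "cst f * pderiv (j b) \<in> B'" if "b \<in> carrier B" for b
      proof -
        have "b \<in> generate_ring B (range (\<lambda>c. \<phi> [:c:]) \<union> F)" using that F(3) by simp
        thus ?thesis
        proof induction
          case one
          show ?case using pderiv_cst[of 1] by (simp add: j(2))
        next
          case (incl b)
          show ?case
          proof (cases "b \<in> F")
            case True
            have "f = (\<Prod>g\<in>F - {b}. d (pderiv (j g))) * d (pderiv (j b))"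
              unfolding f_def using prod.remove[OF F(1) True] by (simp add: mult.commute)
            hence "cst f * pderiv (j b) = cst (\<Prod>g\<in>F - {b}. d (pderiv (j g))) * (cst (d (pderiv (j b))) * pderiv (j b))"
              by (simp add: mult.assoc)
            also have "\<dots> \<in> B'" by (rule B'.mult_mem[OF cst]) (use d in blast)
            finally show ?thesis .
          next
            case False
            then obtain c where "b = \<phi> [:c:]" using incl by auto
            thus ?thesis by (simp add: j(5) pderiv_cst)
          qed
        next
          case (a_inv b)
          have "b \<in> carrier B" using a_inv(1) F(3) by simp
          thus ?case using B'.uminus_mem[OF a_inv(2)] by (simp add: jm pderiv_minus)
        next
          case (eng_add a b)
          have "a \<in> carrier B" "b \<in> carrier B" using eng_add(1,2) F(3) by simp_all
          thus ?case using B'.add_mem[OF eng_add(3,4)] by (simp add: j(3) pderiv_add distrib_left)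
        next
          case (eng_mult a b)
          have ab: "a \<in> carrier B" "b \<in> carrier B" using eng_mult(1,2) F(3) by simp_all
          hence "j b * (cst f * pderiv (j a)) + j a * (cst f * pderiv (j b)) \<in> B'"
            by (intro B'.add_mem B'.mult_mem[of "j _"] eng_mult(3,4)) (auto simp: B'_def)
          thus ?case using ab by (simp add: j(4) pderiv_mult algebra_simps)
        qed
      qed
      ultimately show ?thesis by (auto simp: B'_def)
    qed
  qed
  have red: "\<exists>v\<in>B'. b = cst [:0, 1:] * v" if bw: "b \<in> B'" "w \<in> B'" "b ^ n = cst [:0, 1:] * w" for b w n
  proof -
    obtain b' w' where b: "b' \<in> carrier B" "b = j b'" "w' \<in> carrier B" "w = j w'"
      using bw by (auto simp: B'_def)
    have "j (b' [^]\<^bsub>B\<^esub> n) = j (lin 0 \<otimes>\<^bsub>B\<^esub> w')" using bw(3) b linj[of w' 0] by (simp add: jp)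
    hence "b' [^]\<^bsub>B\<^esub> n = lin 0 \<otimes>\<^bsub>B\<^esub> w'" using b j_eq by simp
    from linear_reduced[OF b(1,3) this] show ?thesis using b linj[of _ 0] by (auto simp: B'_def)
  qed
  have "\<exists>(T :: nat labelled_tree) D \<xi>. fine_labelled_tree T \<and> tree_presentation T cst D B' \<xi>"
    by (rule L.subring_presentation) (rule red)
  then obtain T :: "nat labelled_tree" and D \<xi>
    where T: "fine_labelled_tree T" "tree_presentation T cst D B' \<xi>" by blast
  interpret T: tree_presentation T cst D B' \<xi> by (rule T(2))
  interpret I: ideal "tree_ideal T" "tree_poly_ring T" by (rule T.ideal_tree_ideal)
  let ?P = "tree_poly_ring T" and ?I = "tree_ideal T"
  have P: "carrier ?P = gen (parents T)" by (rule tree_poly_ring_eq_gen)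
  interpret G: type_subring "gen (parents T)" by (rule type_subring_gen)
  have coset: "?I +>\<^bsub>?P\<^esub> p = {i + p | i. i \<in> ?I}" for p
    by (auto simp: a_r_coset_def' T.tree_poly_ring_simps)
  have coset_eq: "?I +>\<^bsub>?P\<^esub> p = ?I +>\<^bsub>?P\<^esub> q \<longleftrightarrow> T.\<pi> p = T.\<pi> q" if pq: "p \<in> carrier ?P" "q \<in> carrier ?P" for p q
  proof
    assume eq: "?I +>\<^bsub>?P\<^esub> p = ?I +>\<^bsub>?P\<^esub> q"
    have "p \<in> ?I +>\<^bsub>?P\<^esub> p" unfolding coset using T.ideal_0 by force
    then obtain i where "p = i + q" "i \<in> ?I" unfolding eq unfolding coset by blast
    thus "T.\<pi> p = T.\<pi> q" using T.\<pi>_ideal by simp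
  next
    assume "T.\<pi> p = T.\<pi> q"
    hence "T.\<pi> (p - q) = 0" by simp
    moreover have "p - q \<in> gen (parents T)" using pq unfolding P by (rule G.diff_mem)
    ultimately have i: "p - q \<in> ?I" using T.kernel_eq by blast
    have "x - q \<in> ?I \<longleftrightarrow> x - p \<in> ?I" for x
      using T.ideal_add[OF _ i, of "x - p"] T.ideal_diff[OF _ i, of "x - q"] by auto
    moreover have "x \<in> ?I +>\<^bsub>?P\<^esub> r \<longleftrightarrow> x - r \<in> ?I" for x r
      unfolding coset by (auto intro: exI[of _ "x - r"])
    ultimately show "?I +>\<^bsub>?P\<^esub> p = ?I +>\<^bsub>?P\<^esub> q" by blast
  qed
  \<comment> \<open>Any preimage will do: by \<open>coset_eq\<close> its coset depends only on its
    value under \<open>T.\<pi>\<close>.\<close>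
  define lift where "lift b = (SOME p. p \<in> carrier ?P \<and> T.\<pi> p = j b)" for b
  have lift: "lift b \<in> carrier ?P" "T.\<pi> (lift b) = j b" if "b \<in> carrier B" for b
  proof -
    have "j b \<in> T.\<pi> ` gen (parents T)" unfolding T.image_eq using that by (simp add: B'_def)
    hence "\<exists>p. p \<in> carrier ?P \<and> T.\<pi> p = j b" unfolding P by force
    from someI_ex[OF this] show "lift b \<in> carrier ?P" "T.\<pi> (lift b) = j b" by (auto simp: lift_def)
  qed
  define \<Theta> where "\<Theta> b = ?I +>\<^bsub>?P\<^esub> lift b" for b
  have \<Theta>_eq: "\<Theta> b = ?I +>\<^bsub>?P\<^esub> p" if "b \<in> carrier B" "p \<in> carrier ?P" "T.\<pi> p = j b" for b p
    unfolding \<Theta>_def using coset_eq lift that by simp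
  note hom = ring_hom_memE[OF I.rcos_ring_hom]
  have "\<Theta> \<in> ring_hom B (tree_algebra T)"
    unfolding tree_algebra_def
  proof (rule ring_hom_memI)
    show "\<Theta> a \<in> carrier (?P Quot ?I)" if "a \<in> carrier B" for a
      unfolding \<Theta>_def by (rule hom(1)[OF lift(1)[OF that]])
    have "\<Theta> \<one>\<^bsub>B\<^esub> = ?I +>\<^bsub>?P\<^esub> \<one>\<^bsub>?P\<^esub>"
      by (rule \<Theta>_eq) (simp_all add: T.tree_poly_ring_simps(3) j(2) P)
    thus "\<Theta> \<one>\<^bsub>B\<^esub> = \<one>\<^bsub>?P Quot ?I\<^esub>" using hom(4) by simp
  next
    fix a b assume ab: "a \<in> carrier B" "b \<in> carrier B"
    have "\<Theta> (a \<otimes>\<^bsub>B\<^esub> b) = ?I +>\<^bsub>?P\<^esub> (lift a \<otimes>\<^bsub>?P\<^esub> lift b)"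
      by (rule \<Theta>_eq) (use ab lift[OF ab(1)] lift[OF ab(2)] in \<open>simp_all add: T.tree_poly_ring_simps(1) j(4) P G.mult_mem\<close>)
    thus "\<Theta> (a \<otimes>\<^bsub>B\<^esub> b) = \<Theta> a \<otimes>\<^bsub>?P Quot ?I\<^esub> \<Theta> b"
      unfolding \<Theta>_def using hom(2)[OF lift(1)[OF ab(1)] lift(1)[OF ab(2)]] by simp
    have "\<Theta> (a \<oplus>\<^bsub>B\<^esub> b) = ?I +>\<^bsub>?P\<^esub> (lift a \<oplus>\<^bsub>?P\<^esub> lift b)"
      by (rule \<Theta>_eq) (use ab lift[OF ab(1)] lift[OF ab(2)] in \<open>simp_all add: T.tree_poly_ring_simps(2) j(3) P G.add_mem\<close>)
    thus "\<Theta> (a \<oplus>\<^bsub>B\<^esub> b) = \<Theta> a \<oplus>\<^bsub>?P Quot ?I\<^esub> \<Theta> b"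
      unfolding \<Theta>_def using hom(3)[OF lift(1)[OF ab(1)] lift(1)[OF ab(2)]] by simp
  qed
  moreover have "bij_betw \<Theta> (carrier B) (carrier (tree_algebra T))"
    unfolding bij_betw_def
  proof
    show "inj_on \<Theta> (carrier B)"
      by (rule inj_onI) (use lift j_eq coset_eq in \<open>auto simp: \<Theta>_def\<close>)
    have "C \<in> \<Theta> ` carrier B" if C: "C \<in> carrier (tree_algebra T)" for C
    proof -
      obtain p where p: "p \<in> carrier ?P" "C = ?I +>\<^bsub>?P\<^esub> p"
        using C by (auto simp: tree_algebra_def FactRing_def A_RCOSETS_def')
      have "T.\<pi> p \<in> B'" using p(1) T.image_eq unfolding P by blast
      then obtain b where "b \<in> carrier B" "T.\<pi> p = j b" by (auto simp: B'_def)
      thus ?thesis using \<Theta>_eq[OF _ p(1)] p(2) by (metis imageI)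
    qed
    moreover have "\<Theta> b \<in> carrier (tree_algebra T)" if "b \<in> carrier B" for b
      unfolding \<Theta>_def tree_algebra_def by (rule hom(1)[OF lift(1)[OF that]])
    ultimately show "\<Theta> ` carrier B = carrier (tree_algebra T)" by blast
  qed
  moreover have "\<Theta> (\<phi> a) = tree_structure_map T a" for a
    unfolding tree_structure_map_def by (rule \<Theta>_eq) (simp_all add: j(5))
  ultimately have "isomorphic_over_Ch B \<phi> (tree_algebra T) (tree_structure_map T)"
    unfolding isomorphic_over_Ch_def ring_iso_def by blast
  thus ?thesis using T(1) by blast
qed

end

theorem theorem0p2:
  fixes B :: "('b, 'm) ring_scheme" and \<phi> :: "complex poly \<Rightarrow> 'b"
  assumes "GDS B \<phi>"
    and "\<And>p. maximalideal p Ch \<Longrightarrow> p \<noteq> Idl\<^bsub>Ch\<^esub> {[:0, 1:]} \<Longrightarrow> domain (closed_fibre B \<phi> p)"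
  shows "\<exists>T :: nat labelled_tree. fine_labelled_tree T \<and>
           isomorphic_over_Ch B \<phi> (tree_algebra T) (tree_structure_map T)"
proof -
  interpret gds B \<phi> by (rule gds.intro[OF assms])
  show ?thesis by (rule isomorphic_to_tree_algebra)
qed

end
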